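(* Let $(\phi_n)_n$ be a uniformly bounded sequence in $H^1(\mathbb{R}^3)$, and suppose that there are profiles $\psi^j\in H^1$ ($j\ge1$), time shifts $t_n^j\in\mathbb{R}$, space shifts $x_n^j\in\mathbb{R}^3$ and remainders $W_n^M\in H^1$ ($M\ge1$) such that for each $M\ge 1$ and each $n$ $$\phi_n(x)=\sum_{j=1}^M \left(e^{-it_n^j\Delta}\psi^j\right)(x-x_n^j)+W_n^M(x),$$ and such that: (i) for all $j\ne k$, $\lim_{n\to+\infty}\left(|t_n^j-t_n^k|+|x_n^j-x_n^k|\right)=+\infty$; (ii) $\lim_{M\to+\infty}\left[\lim_{n\to+\infty}\|e^{it\Delta}W_n^M\|_{S(\dot H^{1/2})}\right]=0$ (the inner limits existing); (iii) for each fixed $M\ge1$ and each $0\le s\le 1$, $\|\phi_n\|_{\dot H^s}^2=\sum_{j=1}^M\|\psi^j\|_{\dot H^s}^2+\|W_n^M\|_{\dot H^s}^2+o_n(1)$. Then for each $M\ge1$, $$E[\phi_n]=\sum_{j=1}^M E\left[e^{-it_n^j\Delta}\psi^j\right]+E[W_n^M]+o_n(1)\quad\text{as } n\to+\infty.$$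
   Context: Functions are complex-valued on $\mathbb{R}^3$; $e^{it\Delta}$ is the free Schrödinger group. For $f\in H^1(\mathbb{R}^3)$, $E[f]=\frac12\int|\nabla f|^2dx-\frac14\int|f|^4dx$. A pair $(q,r)$ is called $\dot H^s$ Strichartz admissible (in 3D) if $\frac2q+\frac3r=\frac32-s$. Fix once and for all numbers $6^-<6$ and $4^+>4$ (arbitrarily preselected, close to $6$ and $4$). For a space-time function $v(x,t)$, $$\|v\|_{S(\dot H^{1/2})}=\sup\left\{\|v\|_{L_t^qL_x^r}:\ (q,r)\ \dot H^{1/2}\text{ admissible},\ 3\le r\le 6^-,\ 4^+\le q\le\infty\right\},$$ where here the time variable ranges over $\mathbb{R}$. $o_n(1)$ denotes a quantity tending to $0$ as $n\to+\infty$. *)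

theory Defs
  imports "HOL-Analysis.Analysis" "HOL-Probability.Essential_Supremum"
begin

(* Elements of Lebesgue spaces are Borel representatives, considered up to equality almost
   everywhere. Every notion below is insensitive to the choice of representative; where a class
   has to be turned into a function (fourier, weak_gradient), some representative is picked. *)

type_synonym space = "real ^ 3"

section \<open>Lebesgue and Strichartz norms\<close>

(* The power a^p of an extended nonnegative number, for p > 0. *)
definition epowr :: "ennreal \<Rightarrow> real \<Rightarrow> ennreal" where
  "epowr a p = (if a = top then top else ennreal (enn2real a powr p))"

(* L^p norm, 0 < p \<le> \<infinity>, of a function with values in [0, \<infinity>]; such values arise for the
   inner norms of a space-time function. *)
definition Lp_norm :: "'a measure \<Rightarrow> ereal \<Rightarrow> ('a \<Rightarrow> ennreal) \<Rightarrow> ennreal" where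
  "Lp_norm M p F =
     (if p = \<infinity> then esssup M F
      else epowr (\<integral>\<^sup>+ x. epowr (F x) (real_of_ereal p) \<partial>M) (1 / real_of_ereal p))"

definition mixed_norm :: "ereal \<Rightarrow> ereal \<Rightarrow> (real \<Rightarrow> space \<Rightarrow> complex) \<Rightarrow> ennreal" where
  "mixed_norm q r v =
     Lp_norm lborel q (\<lambda>t. Lp_norm lborel r (\<lambda>x. ennreal (norm (v t x))))"

definition strichartz_admissible :: "real \<Rightarrow> ereal \<Rightarrow> ereal \<Rightarrow> bool" where
  "strichartz_admissible s q r \<longleftrightarrow> 2 / q + 3 / r = ereal (3 / 2 - s)"

(* The norm of S(H-dot^{1/2}); six_minus and four_plus are the preselected numbers 6^- and 4^+. *)
definition S_half_norm :: "real \<Rightarrow> real \<Rightarrow> (real \<Rightarrow> space \<Rightarrow> complex) \<Rightarrow> ennreal" where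
  "S_half_norm six_minus four_plus v =
     Sup {mixed_norm q r v | q r. strichartz_admissible (1 / 2) q r \<and>
            3 \<le> r \<and> r \<le> ereal six_minus \<and> ereal four_plus \<le> q \<and> q \<le> \<infinity>}"

section \<open>Fourier transform and Schroedinger group\<close>

definition in_L2 :: "('a::euclidean_space \<Rightarrow> 'b::euclidean_space) \<Rightarrow> bool" where
  "in_L2 f \<longleftrightarrow> f \<in> borel_measurable lborel \<and> integrable lborel (\<lambda>x. (norm (f x))\<^sup>2)"

definition truncated_fourier :: "real \<Rightarrow> (space \<Rightarrow> complex) \<Rightarrow> space \<Rightarrow> complex" where
  "truncated_fourier R f \<xi> =
     ((2 * pi) powr (- 3 / 2)) *\<^sub>R (LINT x:cball 0 R|lborel. cis (- (x \<bullet> \<xi>)) * f x)"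

(* The unitary Fourier transform on L^2, as the limit in L^2 of the truncated Fourier integrals. *)
definition is_fourier :: "(space \<Rightarrow> complex) \<Rightarrow> (space \<Rightarrow> complex) \<Rightarrow> bool" where
  "is_fourier f g \<longleftrightarrow> in_L2 g \<and>
     ((\<lambda>R. \<integral>\<^sup>+ \<xi>. ennreal ((norm (g \<xi> - truncated_fourier R f \<xi>))\<^sup>2) \<partial>lborel)
        \<longlongrightarrow> 0) at_top"

definition fourier :: "(space \<Rightarrow> complex) \<Rightarrow> space \<Rightarrow> complex" where
  "fourier f = (SOME g. is_fourier f g)"

(* With the unitary normalisation, the inverse transform only flips the sign in the phase. *)
definition inverse_fourier :: "(space \<Rightarrow> complex) \<Rightarrow> space \<Rightarrow> complex" where
  "inverse_fourier g x = fourier g (- x)"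

(* exp(i t Laplacian): the Fourier multiplier exp(-i t |xi|^2). *)
definition schrodinger :: "real \<Rightarrow> (space \<Rightarrow> complex) \<Rightarrow> space \<Rightarrow> complex" where
  "schrodinger t f = inverse_fourier (\<lambda>\<xi>. cis (- t * (norm \<xi>)\<^sup>2) * fourier f \<xi>)"

definition Hdot_norm :: "real \<Rightarrow> (space \<Rightarrow> complex) \<Rightarrow> real" where
  "Hdot_norm s f = sqrt (LINT \<xi>|lborel. norm \<xi> powr (2 * s) * (norm (fourier f \<xi>))\<^sup>2)"

section \<open>Weak gradient, the space H1 and the energy\<close>

definition partial_deriv :: "3 \<Rightarrow> (space \<Rightarrow> complex) \<Rightarrow> space \<Rightarrow> complex" where
  "partial_deriv i f x = frechet_derivative f (at x) (axis i 1)"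

primrec C_times :: "nat \<Rightarrow> (space \<Rightarrow> complex) \<Rightarrow> bool" where
  "C_times 0 f \<longleftrightarrow> continuous_on UNIV f"
| "C_times (Suc k) f \<longleftrightarrow>
     (\<forall>x. f differentiable (at x)) \<and> (\<forall>i. C_times k (partial_deriv i f))"

definition test_function :: "(space \<Rightarrow> complex) \<Rightarrow> bool" where
  "test_function \<eta> \<longleftrightarrow> (\<forall>k. C_times k \<eta>) \<and> (\<exists>K. compact K \<and> (\<forall>x. x \<notin> K \<longrightarrow> \<eta> x = 0))"

(* The distributional gradient of f is the (locally integrable) vector field g. *)
definition is_weak_gradient :: "(space \<Rightarrow> complex) \<Rightarrow> (space \<Rightarrow> complex ^ 3) \<Rightarrow> bool" where
  "is_weak_gradient f g \<longleftrightarrow>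
     (\<forall>K. compact K \<longrightarrow> set_integrable lborel K f \<and> set_integrable lborel K g) \<and>
     g \<in> borel_measurable lborel \<and>
     (\<forall>\<eta> i. test_function \<eta> \<longrightarrow>
        (LINT x|lborel. f x * partial_deriv i \<eta> x) = - (LINT x|lborel. g x $ i * \<eta> x))"

definition weak_gradient :: "(space \<Rightarrow> complex) \<Rightarrow> space \<Rightarrow> complex ^ 3" where
  "weak_gradient f = (SOME g. is_weak_gradient f g)"

definition in_H1 :: "(space \<Rightarrow> complex) \<Rightarrow> bool" where
  "in_H1 f \<longleftrightarrow> in_L2 f \<and> (\<exists>g. is_weak_gradient f g \<and> in_L2 g)"

definition H1_norm :: "(space \<Rightarrow> complex) \<Rightarrow> real" where
  "H1_norm f = sqrt ((LINT x|lborel. (norm (f x))\<^sup>2) + (LINT x|lborel. (norm (weak_gradient f x))\<^sup>2))"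

definition energy :: "(space \<Rightarrow> complex) \<Rightarrow> real" where
  "energy f = 1 / 2 * (LINT x|lborel. (norm (weak_gradient f x))\<^sup>2)
            - 1 / 4 * (LINT x|lborel. (norm (f x)) ^ 4)"

end

(* The gradient part of the energy is the case s = 1 of the Pythagorean expansion, by Plancherel. For the
   quartic part, every profile is, up to a small error in L^4, either negligible (when its time shift is
   large, by dispersion) or supported in a ball of fixed radius around its space shift (when the time shift
   stays bounded, by compactness). Asymptotic orthogonality makes these balls disjoint, so the sum of
   finitely many profiles has no cross terms in the limit. The remainder with a large index is small in L^4:
   the endpoint (infinity, 3) of the Strichartz norm bounds its L^3 norm, Sobolev's inequality bounds its
   L^6 norm, and L^4 lies in between. Applying this to the first M' >> M profiles, and to those with
   M < j <= M', gives the expansion at every M. *)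

theory Submission
  imports Defs "HOL-Probability.Characteristic_Functions"
begin

section \<open>Lebesgue seminorms with integer exponent\<close>

text \<open>The Schroedinger group and the H-dot norms live on the Fourier side, while the energy
  contains a distributional gradient, and both \<open>fourier\<close> and
  \<open>weak_gradient\<close> are representatives picked by \<open>SOME\<close>. Plancherel,
  inversion and the identification of the weak gradient with multiplication by i xi therefore come
  before any estimate, and identities between such functions hold almost everywhere only. Dispersion
  is obtained without the explicit kernel of the group: the square of an oscillatory integral with
  quadratic phase is an integral of ones with linear phase, so Riemann-Lebesgue gives decay in L^4
  without a rate, and that suffices. The time shift of a profile may alternate between bounded and
  large along the sequence. No subsequence of the data is extracted: for a given accuracy each
  profile has one time threshold T and one radius R valid for all times, and for each n the profile
  is either dropped or cut off. The sum of the time and space separations then enters through a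
  single inequality, since two retained profiles have time shifts at distance at most the sum of
  their thresholds.\<close>

definition in_Lp :: "nat \<Rightarrow> ('a::euclidean_space \<Rightarrow> 'b::euclidean_space) \<Rightarrow> bool" where
  "in_Lp p f \<longleftrightarrow> f \<in> borel_measurable lborel \<and> integrable lborel (\<lambda>x. norm (f x) ^ p)"

text \<open>Only the exponents 2, 3, 4 and 6 occur, so natural powers and \<open>root\<close>
  replace real powers. The integral of a non-integrable function is 0, hence this is meaningful as a
  norm only on \<open>in_Lp\<close>.\<close>

definition pnorm :: "nat \<Rightarrow> ('a::euclidean_space \<Rightarrow> 'b::euclidean_space) \<Rightarrow> real" where
  "pnorm p f = root p (LBINT x. norm (f x) ^ p)"

lemma in_L2_iff: "in_L2 f \<longleftrightarrow> in_Lp 2 f"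
  by (simp add: in_L2_def in_Lp_def)

lemma in_LpD [dest]:
  assumes "in_Lp p f"
  shows "f \<in> borel_measurable borel" "integrable lborel (\<lambda>x. norm (f x) ^ p)"
  using assms by (auto simp: in_Lp_def)

lemma in_LpI:
  assumes "f \<in> borel_measurable borel" "integrable lborel (\<lambda>x. norm (f x) ^ p)"
  shows "in_Lp p f"
  using assms by (auto simp: in_Lp_def)

lemma pnorm_nonneg [simp]: "0 \<le> pnorm p f"
  by (cases "p = 0") (simp_all add: pnorm_def real_root_ge_zero)

lemma pnorm_power: "0 < p \<Longrightarrow> pnorm p f ^ p = (LBINT x. norm (f x) ^ p)"
  by (simp add: pnorm_def real_root_pow_pos2)

lemma pnorm_le_iff:
  assumes "0 < p" "0 \<le> C"
  shows "pnorm p f \<le> C \<longleftrightarrow> (LBINT x. norm (f x) ^ p) \<le> C ^ p"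
  unfolding pnorm_power[OF assms(1), symmetric]
  using assms by (simp add: power_mono_iff)

lemma pnorm_AE_cong:
  assumes "AE x in lborel. f x = g x" "f \<in> borel_measurable borel" "g \<in> borel_measurable borel"
  shows "pnorm p f = pnorm p g"
  unfolding pnorm_def
  by (intro arg_cong[where f="root p"] integral_cong_AE) (use assms in auto)

lemma in_Lp_bound:
  assumes "in_Lp p g" "f \<in> borel_measurable borel" "AE x in lborel. norm (f x) \<le> norm (g x)"
  shows "in_Lp p f"
proof (rule in_LpI)
  show "integrable lborel (\<lambda>x. norm (f x) ^ p)"
    by (rule Bochner_Integration.integrable_bound[OF in_LpD(2)[OF assms(1)]])
       (use assms in \<open>auto elim!: eventually_mono intro!: power_mono\<close>)
qed (use assms in auto)

lemma in_Lp_AE_cong: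
  assumes "in_Lp p g" "f \<in> borel_measurable borel" "AE x in lborel. f x = g x"
  shows "in_Lp p f"
  by (rule in_Lp_bound[OF assms(1,2)]) (use assms(3) in auto)

lemma pnorm_bound:
  assumes "in_Lp p g" "f \<in> borel_measurable borel" "AE x in lborel. norm (f x) \<le> norm (g x)" "0 < p"
  shows "pnorm p f \<le> pnorm p g"
  unfolding pnorm_def
proof (subst real_root_le_iff[OF assms(4)], rule integral_mono_AE)
  show "integrable lborel (\<lambda>x. norm (f x) ^ p)" using in_Lp_bound[OF assms(1-3)] by auto
  show "AE x in lborel. norm (f x) ^ p \<le> norm (g x) ^ p"
    using assms(3) by (auto elim!: eventually_mono intro!: power_mono)
qed (use assms in auto)

lemma in_Lp_zero [simp]: "0 < p \<Longrightarrow> in_Lp p (\<lambda>x. 0)"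
  by (auto simp: in_Lp_def zero_power)

lemma pnorm_zero [simp]: "0 < p \<Longrightarrow> pnorm p (\<lambda>x. 0) = 0"
  by (auto simp: pnorm_def zero_power)

lemma in_Lp_add:
  assumes "in_Lp p f" "in_Lp p g"
  shows "in_Lp p (\<lambda>x. f x + g x)"
proof (rule in_LpI)
  have [measurable]: "f \<in> borel_measurable borel" "g \<in> borel_measurable borel" using assms by auto
  show "(\<lambda>x. f x + g x) \<in> borel_measurable borel" by measurable
  have le: "norm (f x + g x) ^ p \<le> 2 ^ p * (norm (f x) ^ p + norm (g x) ^ p)" for x
  proof -
    have "norm (f x + g x) \<le> 2 * max (norm (f x)) (norm (g x))"
      using norm_triangle_ineq[of "f x" "g x"] by linarith
    then have "norm (f x + g x) ^ p \<le> (2 * max (norm (f x)) (norm (g x))) ^ p"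
      by (intro power_mono) auto
    also have "\<dots> \<le> 2 ^ p * (norm (f x) ^ p + norm (g x) ^ p)"
      by (auto simp: power_mult_distrib max_def)
    finally show ?thesis .
  qed
  show "integrable lborel (\<lambda>x. norm (f x + g x) ^ p)"
  proof (rule Bochner_Integration.integrable_bound)
    show "integrable lborel (\<lambda>x. 2 ^ p * (norm (f x) ^ p + norm (g x) ^ p))"
      using assms by auto
    show "AE x in lborel. norm (norm (f x + g x) ^ p) \<le> norm (2 ^ p * (norm (f x) ^ p + norm (g x) ^ p))"
      using le by (intro always_eventually allI) (simp add: abs_mult)
  qed measurable
qed

lemma in_Lp_scaleR:
  assumes "in_Lp p f" shows "in_Lp p (\<lambda>x. c *\<^sub>R f x)"
  using assms by (auto simp: in_Lp_def power_mult_distrib)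

lemma in_Lp_uminus:
  assumes "in_Lp p f" shows "in_Lp p (\<lambda>x. - f x)"
  using assms by (auto simp: in_Lp_def)

lemma in_Lp_diff:
  assumes "in_Lp p f" "in_Lp p g"
  shows "in_Lp p (\<lambda>x. f x - g x)"
  using in_Lp_add[OF assms(1) in_Lp_uminus[OF assms(2)]] by simp

lemma in_Lp_sum:
  assumes "0 < p" "\<And>i. i \<in> I \<Longrightarrow> in_Lp p (f i)"
  shows "in_Lp p (\<lambda>x. \<Sum>i\<in>I. f i x)"
  using assms(2) by (induction I rule: infinite_finite_induct) (auto intro!: in_Lp_add simp: assms)

lemma pnorm_uminus [simp]: "pnorm p (\<lambda>x. - f x) = pnorm p f"
  by (simp add: pnorm_def)

lemma pnorm_minus_commute: "pnorm p (\<lambda>x. f x - g x) = pnorm p (\<lambda>x. g x - f x)"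
  by (simp add: pnorm_def norm_minus_commute)

lemma pnorm_scaleR: "0 < p \<Longrightarrow> pnorm p (\<lambda>x. c *\<^sub>R f x) = \<bar>c\<bar> * pnorm p f"
  by (simp add: pnorm_def power_mult_distrib real_root_mult real_root_power_cancel)

text \<open>Convexity of the power function is applied to the functions divided by their norms; the extra
  \<open>e / 2\<close> keeps the norms away from zero.\<close>

lemma pnorm_triangle:
  assumes f: "in_Lp p f" and g: "in_Lp p g" and p: "0 < p"
  shows "pnorm p (\<lambda>x. f x + g x) \<le> pnorm p f + pnorm p g"
proof (rule field_le_epsilon)
  fix e :: real assume e: "0 < e"
  define A where "A = pnorm p f + e / 2"
  define B where "B = pnorm p g + e / 2"
  have A: "0 < A" and B: "0 < B" using e by (auto simp: A_def B_def add_nonneg_pos)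
  have cvx: "convex_on {0::real..} (\<lambda>x. x ^ p)"
    by (cases "even p") (simp_all add: convex_power_odd convex_on_subset[OF convex_power_even])
  have pw: "norm (f x + g x) ^ p
      \<le> (A + B) ^ p * (A / (A + B) * (norm (f x) ^ p / A ^ p) + B / (A + B) * (norm (g x) ^ p / B ^ p))" for x
  proof -
    have "norm (f x + g x) \<le> norm (f x) + norm (g x)" by (rule norm_triangle_ineq)
    also have "\<dots> = (A + B) * (A / (A + B) * (norm (f x) / A) + B / (A + B) * (norm (g x) / B))"
      using A B by (simp add: divide_simps)
    finally have "norm (f x + g x) ^ p
       \<le> ((A + B) * (A / (A + B) * (norm (f x) / A) + B / (A + B) * (norm (g x) / B))) ^ p"
      by (intro power_mono) auto
    also have "\<dots> = (A + B) ^ p * (A / (A + B) * (norm (f x) / A) + B / (A + B) * (norm (g x) / B)) ^ p"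
      by (simp add: power_mult_distrib)
    also have "(A / (A + B) * (norm (f x) / A) + B / (A + B) * (norm (g x) / B)) ^ p
       \<le> A / (A + B) * (norm (f x) / A) ^ p + B / (A + B) * (norm (g x) / B) ^ p"
      using convex_onD[OF cvx, of "B / (A + B)" "norm (f x) / A" "norm (g x) / B"] A B
      by (simp add: field_simps)
    finally show ?thesis using A B by (simp add: power_divide)
  qed
  have le1: "(LBINT x. norm (f x) ^ p) / A ^ p \<le> 1" "(LBINT x. norm (g x) ^ p) / B ^ p \<le> 1"
    using A B p e by (auto simp: pnorm_power[OF p, symmetric] A_def B_def intro!: power_mono)
  have "(LBINT x. norm (f x + g x) ^ p)
    \<le> (LBINT x. (A + B) ^ p * (A / (A + B) * (norm (f x) ^ p / A ^ p) + B / (A + B) * (norm (g x) ^ p / B ^ p)))"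
  proof (rule integral_mono)
    show "integrable lborel (\<lambda>x. norm (f x + g x) ^ p)" using in_Lp_add[OF f g] by auto
    show "integrable lborel (\<lambda>x. (A + B) ^ p * (A / (A + B) * (norm (f x) ^ p / A ^ p) + B / (A + B) * (norm (g x) ^ p / B ^ p)))"
      by (intro integrable_mult_right Bochner_Integration.integrable_add integrable_divide in_LpD(2)[OF f] in_LpD(2)[OF g])
  qed (rule pw)
  also have "\<dots> = (A + B) ^ p * (A / (A + B) * ((LBINT x. norm (f x) ^ p) / A ^ p)
                            + B / (A + B) * ((LBINT x. norm (g x) ^ p) / B ^ p))"
    by (subst integral_mult_right_zero, subst Bochner_Integration.integral_add)
       (intro integrable_mult_right integrable_divide in_LpD(2)[OF f] in_LpD(2)[OF g], simp)+
  also have "\<dots> \<le> (A + B) ^ p * (A / (A + B) * 1 + B / (A + B) * 1)"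
    using A B by (intro mult_left_mono add_mono le1) auto
  also have "\<dots> = (A + B) ^ p" using A B by (simp add: add_divide_distrib[symmetric])
  finally have "pnorm p (\<lambda>x. f x + g x) \<le> A + B"
    using A B p by (subst pnorm_le_iff) auto
  then show "pnorm p (\<lambda>x. f x + g x) \<le> pnorm p f + pnorm p g + e" by (simp add: A_def B_def)
qed

lemma pnorm_triangle_diff:
  assumes "in_Lp p f" "in_Lp p g" "0 < p"
  shows "pnorm p (\<lambda>x. f x - g x) \<le> pnorm p f + pnorm p g"
  using pnorm_triangle[OF assms(1) in_Lp_uminus[OF assms(2)] assms(3)] by simp

lemma pnorm_triangle3:
  assumes "in_Lp p f" "in_Lp p g" "in_Lp p h" "0 < p"
  shows "pnorm p (\<lambda>x. f x - h x) \<le> pnorm p (\<lambda>x. f x - g x) + pnorm p (\<lambda>x. g x - h x)"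
  using pnorm_triangle[OF in_Lp_diff[OF assms(1,2)] in_Lp_diff[OF assms(2,3)] assms(4)] by simp

lemma pnorm_abs_diff:
  assumes "in_Lp p f" "in_Lp p g" "0 < p"
  shows "\<bar>pnorm p f - pnorm p g\<bar> \<le> pnorm p (\<lambda>x. f x - g x)"
  using pnorm_triangle[OF in_Lp_diff[OF assms(1,2)] assms(2,3)]
        pnorm_triangle[OF in_Lp_diff[OF assms(2,1)] assms(1,3)]
        pnorm_minus_commute[of p f g] by simp

lemma pnorm_sum:
  assumes "0 < p" "\<And>i. i \<in> I \<Longrightarrow> in_Lp p (f i)"
  shows "pnorm p (\<lambda>x. \<Sum>i\<in>I. f i x) \<le> (\<Sum>i\<in>I. pnorm p (f i))"
  using assms(2)
proof (induction I rule: infinite_finite_induct)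
  case (insert i I)
  have "pnorm p (\<lambda>x. f i x + (\<Sum>i\<in>I. f i x)) \<le> pnorm p (f i) + pnorm p (\<lambda>x. \<Sum>i\<in>I. f i x)"
    by (rule pnorm_triangle) (use insert assms(1) in \<open>auto intro!: in_Lp_sum\<close>)
  with insert show ?case by auto
qed (auto simp: assms)

lemma pnorm_tendsto:
  assumes "\<And>n. in_Lp p (f n)" "in_Lp p g" "0 < p" "((\<lambda>n. pnorm p (\<lambda>x. f n x - g x)) \<longlongrightarrow> 0) F"
  shows "((\<lambda>n. pnorm p (f n)) \<longlongrightarrow> pnorm p g) F"
proof (rule Lim_transform2[OF tendsto_const[of "pnorm p g"]])
  have "((\<lambda>n. pnorm p (f n) - pnorm p g) \<longlongrightarrow> 0) F"
    by (rule tendsto_rabs_zero_cancel, rule tendsto_sandwich[OF _ _ tendsto_const assms(4)])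
       (use pnorm_abs_diff[OF assms(1,2,3)] in auto)
  from tendsto_minus[OF this]
  show "((\<lambda>n. pnorm p g - pnorm p (f n)) \<longlongrightarrow> 0) F" by simp
qed

lemma pnorm_eq_0D:
  assumes "in_Lp p f" "0 < p" "pnorm p f = 0"
  shows "AE x in lborel. f x = 0"
proof -
  have "(LBINT x. norm (f x) ^ p) = 0"
    using assms(3) pnorm_power[OF assms(2), of f] assms(2) by (simp add: zero_power)
  then have "AE x in lborel. norm (f x) ^ p = 0"
    using assms(1) by (subst (asm) integral_nonneg_eq_0_iff_AE) auto
  then show ?thesis using assms(2) by (auto simp: power_eq_0_iff)
qed

text \<open>The means of identifying two Fourier transforms: both are exhibited as L^2 limits of the
  same truncated integrals.\<close>

lemma pnorm_lim_unique:
  assumes "\<And>n. in_Lp p (f n)" "in_Lp p g" "in_Lp p h" "0 < p"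
    "((\<lambda>n. pnorm p (\<lambda>x. f n x - g x)) \<longlongrightarrow> 0) F" "((\<lambda>n. pnorm p (\<lambda>x. f n x - h x)) \<longlongrightarrow> 0) F" "F \<noteq> bot"
  shows "AE x in lborel. g x = h x"
proof -
  have "pnorm p (\<lambda>x. g x - h x) \<le> 0 + 0"
  proof (rule tendsto_lowerbound[OF tendsto_add[OF assms(5,6)] _ assms(7)], intro always_eventually allI)
    show "pnorm p (\<lambda>x. g x - h x) \<le> pnorm p (\<lambda>x. f n x - g x) + pnorm p (\<lambda>x. f n x - h x)" for n
      using pnorm_triangle3[OF assms(2) assms(1)[of n] assms(3,4)] by (simp add: pnorm_minus_commute)
  qed
  then have "pnorm p (\<lambda>x. g x - h x) = 0" using pnorm_nonneg[of p "\<lambda>x. g x - h x"] by linarith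
  from pnorm_eq_0D[OF in_Lp_diff[OF assms(2,3)] assms(4) this] show ?thesis by simp
qed

lemma pnorm_dominated:
  assumes "in_Lp p h" "\<And>n. f n \<in> borel_measurable borel" "0 < p"
    "\<And>n. AE x in lborel. norm (f n x) \<le> norm (h x)" "AE x in lborel. (\<lambda>n. f n x) \<longlonglongrightarrow> 0"
  shows "(\<lambda>n. pnorm p (f n)) \<longlonglongrightarrow> 0"
proof -
  have [measurable]: "f n \<in> borel_measurable borel" for n by fact
  have "(\<lambda>n. LBINT x. norm (f n x) ^ p) \<longlonglongrightarrow> (LINT x|(lborel::'a measure). 0)"
  proof (rule integral_dominated_convergence[where w="\<lambda>x. norm (h x) ^ p"])
    show "AE x in lborel. (\<lambda>i. norm (f i x) ^ p) \<longlonglongrightarrow> 0"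
      using assms(5)
    proof eventually_elim
      case (elim x)
      then have "(\<lambda>i. norm (f i x) ^ p) \<longlonglongrightarrow> norm (0::'c) ^ p" by (intro tendsto_power tendsto_norm)
      then show ?case using assms(3) by (simp add: zero_power)
    qed
    show "AE x in lborel. norm (norm (f n x) ^ p) \<le> norm (h x) ^ p" for n
      using assms(4)[of n] by eventually_elim (auto intro: power_mono)
  qed (use assms in auto)
  from tendsto_real_root[OF this, of p] show ?thesis using assms(3) by (simp add: pnorm_def)
qed

lemma pnorm_AE_subseq:
  assumes "\<And>n. in_Lp p (f n)" "in_Lp p g" "0 < p" "(\<lambda>n. pnorm p (\<lambda>x. f n x - g x)) \<longlonglongrightarrow> 0"
  obtains r where "strict_mono (r::nat\<Rightarrow>nat)" "AE x in lborel. (\<lambda>n. f (r n) x) \<longlonglongrightarrow> g x"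
proof -
  have "(\<lambda>n. pnorm p (\<lambda>x. f n x - g x) ^ p) \<longlonglongrightarrow> 0 ^ p" by (intro tendsto_power assms)
  then have *: "(\<lambda>n. LBINT x. norm (norm (f n x - g x) ^ p)) \<longlonglongrightarrow> 0"
    using assms(3) by (simp add: pnorm_power zero_power)
  have "integrable lborel (\<lambda>x. norm (f n x - g x) ^ p)" for n using in_Lp_diff[OF assms(1,2)] by auto
  from tendsto_L1_AE_subseq[OF this *] obtain r where r: "strict_mono (r::nat\<Rightarrow>nat)"
     "AE x in lborel. (\<lambda>n. norm (f (r n) x - g x) ^ p) \<longlonglongrightarrow> 0" by auto
  have "AE x in lborel. (\<lambda>n. f (r n) x) \<longlonglongrightarrow> g x"
    using r(2)
  proof eventually_elim
    case (elim x)
    from tendsto_real_root[OF elim, of p] have "(\<lambda>n. norm (f (r n) x - g x)) \<longlonglongrightarrow> 0"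
      using assms(3) by (simp add: real_root_power_cancel)
    then show ?case by (simp add: tendsto_norm_zero_iff LIM_zero_iff)
  qed
  with r(1) that show ?thesis by blast
qed

text \<open>Membership of the limit is part of the conclusion; this is how functions known only as
  pointwise limits are placed in L^2 or L^3.\<close>

lemma pnorm_Fatou:
  assumes "\<And>n. in_Lp p (f n)" "g \<in> borel_measurable borel" "0 < p" "AE x in lborel. (\<lambda>n. f n x) \<longlonglongrightarrow> g x"
    "eventually (\<lambda>n. pnorm p (f n) \<le> C) sequentially" "0 \<le> C"
  shows "in_Lp p g" "pnorm p g \<le> C"
proof -
  have [measurable]: "f n \<in> borel_measurable borel" for n using assms(1) by auto
  note [measurable] = assms(2)
  have "(\<integral>\<^sup>+x. ennreal (norm (g x) ^ p) \<partial>lborel) = (\<integral>\<^sup>+x. liminf (\<lambda>n. ennreal (norm (f n x) ^ p)) \<partial>lborel)"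
  proof (rule nn_integral_cong_AE, use assms(4) in eventually_elim)
    case (elim x)
    then have "(\<lambda>n. ennreal (norm (f n x) ^ p)) \<longlonglongrightarrow> ennreal (norm (g x) ^ p)"
      by (intro tendsto_ennrealI tendsto_power tendsto_norm)
    from lim_imp_Liminf[OF _ this] show ?case by simp
  qed
  also have "\<dots> \<le> liminf (\<lambda>n. \<integral>\<^sup>+x. ennreal (norm (f n x) ^ p) \<partial>lborel)"
    by (rule nn_integral_liminf) measurable
  also have "(\<lambda>n. \<integral>\<^sup>+x. ennreal (norm (f n x) ^ p) \<partial>lborel) = (\<lambda>n. ennreal (pnorm p (f n) ^ p))"
    using assms(1,3) by (subst nn_integral_eq_integral) (auto simp: pnorm_power)
  also have "liminf (\<lambda>n. ennreal (pnorm p (f n) ^ p)) \<le> liminf (\<lambda>n. ennreal (C ^ p))"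
    by (rule Liminf_mono) (use assms(5) in \<open>auto elim!: eventually_mono intro!: power_mono ennreal_leI\<close>)
  also have "\<dots> = ennreal (C ^ p)" by (simp add: Liminf_const)
  finally have le: "(\<integral>\<^sup>+x. ennreal (norm (g x) ^ p) \<partial>lborel) \<le> ennreal (C ^ p)" .
  then have "integrable lborel (\<lambda>x. norm (g x) ^ p)"
    by (intro integrableI_bounded) (auto intro: le_less_trans)
  then show g: "in_Lp p g" using assms(2) by (auto simp: in_Lp_def)
  show "pnorm p g \<le> C" unfolding pnorm_le_iff[OF assms(3,6)]
    using le g assms(6) by (subst (asm) nn_integral_eq_integral) auto
qed

section \<open>Reflections, translations and the Cauchy-Schwarz inequality\<close>

lemma lborel_distr_uminus_euclidean:
  "distr lborel borel (\<lambda>x::'a::euclidean_space. - x) = lborel"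
  by (subst (2) lborel_affine[of "-1" 0]) (simp_all add: density_1)

lemma lborel_distr_translate:
  "distr lborel borel (\<lambda>x::'a::euclidean_space. x + c) = lborel"
  using lborel_distr_plus[of c] by (simp add: add.commute[of _ c])

lemma lborel_AE_uminus:
  assumes "AE x in lborel. P x" shows "AE x in lborel. P (- x :: 'a::euclidean_space)"
  using AE_distrD[of uminus lborel borel P] assms by (simp only: lborel_distr_uminus_euclidean) simp

lemma lborel_integral_translate:
  fixes f :: "'a::euclidean_space \<Rightarrow> 'b::{banach, second_countable_topology}"
  assumes [measurable]: "f \<in> borel_measurable borel"
  shows "(LBINT x. f (x + c)) = (LBINT x. f x)"
    "integrable lborel (\<lambda>x. f (x + c)) \<longleftrightarrow> integrable lborel f"
  using integral_distr[of "\<lambda>x. x + c" lborel borel f] integrable_distr_eq[of "\<lambda>x. x + c" lborel borel f]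
  by (simp_all add: lborel_distr_translate)

lemma lborel_integral_uminus:
  fixes f :: "'a::euclidean_space \<Rightarrow> 'b::{banach, second_countable_topology}"
  assumes [measurable]: "f \<in> borel_measurable borel"
  shows "(LBINT x. f (- x)) = (LBINT x. f x)"
    "integrable lborel (\<lambda>x. f (- x)) \<longleftrightarrow> integrable lborel f"
  using integral_distr[of "\<lambda>x. - x" lborel borel f] integrable_distr_eq[of "\<lambda>x. - x" lborel borel f]
  by (simp_all add: lborel_distr_uminus_euclidean)

lemma borel_measurable_shift:
  fixes f :: "'a::euclidean_space \<Rightarrow> 'b::euclidean_space"
  assumes [measurable]: "f \<in> borel_measurable borel"
  shows "(\<lambda>x. f (x + c)) \<in> borel_measurable borel" "(\<lambda>x. f (x - c)) \<in> borel_measurable borel"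
    "(\<lambda>x. f (- x)) \<in> borel_measurable borel"
  by measurable

lemma in_Lp_translate: "in_Lp p f \<Longrightarrow> in_Lp p (\<lambda>x. f (x + c))"
  using lborel_integral_translate(2)[of "\<lambda>x. norm (f x) ^ p" c]
  by (auto simp: in_Lp_def borel_measurable_shift)

lemma pnorm_translate: "in_Lp p f \<Longrightarrow> pnorm p (\<lambda>x. f (x + c)) = pnorm p f"
  using lborel_integral_translate(1)[of "\<lambda>x. norm (f x) ^ p" c]
  by (auto simp: pnorm_def)

lemma in_Lp_reflect: "in_Lp p f \<Longrightarrow> in_Lp p (\<lambda>x. f (- x))"
  using lborel_integral_uminus(2)[of "\<lambda>x. norm (f x) ^ p"]
  by (auto simp: in_Lp_def borel_measurable_shift)

lemma pnorm_reflect: "in_Lp p f \<Longrightarrow> pnorm p (\<lambda>x. f (- x)) = pnorm p f"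
  using lborel_integral_uminus(1)[of "\<lambda>x. norm (f x) ^ p"]
  by (auto simp: pnorm_def)

lemma in_Lp_restrict:
  assumes "in_Lp p f" "A \<in> sets borel"
  shows "in_Lp p (\<lambda>x. indicator A x *\<^sub>R f x)"
  by (rule in_Lp_bound[OF assms(1)])
     (use assms(2) in \<open>auto intro!: borel_measurable_scaleR in_LpD(1)[OF assms(1)] simp: indicator_def\<close>)

lemma in_L2_mult_integrable:
  fixes f g :: "'a::euclidean_space \<Rightarrow> complex"
  assumes "in_Lp 2 f" "in_Lp 2 g"
  shows "integrable lborel (\<lambda>x. f x * g x)"
proof (rule Bochner_Integration.integrable_bound)
  show "integrable lborel (\<lambda>x. norm (f x) ^ 2 + norm (g x) ^ 2)" using assms by auto
  have "norm (f x) * norm (g x) \<le> norm (f x) ^ 2 + norm (g x) ^ 2" for x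
    using sum_squares_bound[of "norm (f x)" "norm (g x)"] mult_nonneg_nonneg[OF norm_ge_zero[of "f x"] norm_ge_zero[of "g x"]]
    by linarith
  then show "AE x in lborel. norm (f x * g x) \<le> norm (norm (f x) ^ 2 + norm (g x) ^ 2)"
    by (auto simp: norm_mult)
  have [measurable]: "f \<in> borel_measurable borel" "g \<in> borel_measurable borel" using assms by auto
  show "(\<lambda>x. f x * g x) \<in> borel_measurable lborel" by measurable
qed

lemma pnorm_norm [simp]: "pnorm p (\<lambda>x. norm (f x)) = pnorm p f"
  by (simp add: pnorm_def)

lemma L2_Cauchy_Schwarz:
  fixes f g :: "'a::euclidean_space \<Rightarrow> complex"
  assumes "in_Lp 2 f" "in_Lp 2 g"
  shows "(LBINT x. norm (f x * g x)) \<le> pnorm 2 f * pnorm 2 g"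
proof -
  have [measurable]: "f \<in> borel_measurable borel" "g \<in> borel_measurable borel" using assms by auto
  have "(\<integral>\<^sup>+x. ennreal (norm (f x)) * ennreal (norm (g x)) \<partial>lborel)\<^sup>2
     \<le> (\<integral>\<^sup>+x. (ennreal (norm (f x)))\<^sup>2 \<partial>lborel) * (\<integral>\<^sup>+x. (ennreal (norm (g x)))\<^sup>2 \<partial>lborel)"
    by (rule Cauchy_Schwarz_nn_integral) measurable
  also have "(\<integral>\<^sup>+x. (ennreal (norm (f x)))\<^sup>2 \<partial>lborel) = ennreal (pnorm 2 f ^ 2)"
    using assms by (simp add: pnorm_power ennreal_power nn_integral_eq_integral in_LpD)
  also have "(\<integral>\<^sup>+x. (ennreal (norm (g x)))\<^sup>2 \<partial>lborel) = ennreal (pnorm 2 g ^ 2)"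
    using assms by (simp add: pnorm_power ennreal_power nn_integral_eq_integral in_LpD)
  also have "(\<integral>\<^sup>+x. ennreal (norm (f x)) * ennreal (norm (g x)) \<partial>lborel) = ennreal (LBINT x. norm (f x * g x))"
    using in_L2_mult_integrable[OF assms]
    by (subst nn_integral_eq_integral[symmetric]) (auto simp: norm_mult ennreal_mult dest: integrable_norm)
  finally have "(LBINT x. norm (f x * g x))\<^sup>2 \<le> (pnorm 2 f * pnorm 2 g)\<^sup>2"
    by (simp add: ennreal_power ennreal_mult[symmetric] power_mult_distrib)
  then show ?thesis by (rule power2_le_imp_le) simp
qed

lemma L2_Cauchy_Schwarz_integral:
  fixes f g :: "'a::euclidean_space \<Rightarrow> complex"
  assumes "in_Lp 2 f" "in_Lp 2 g"
  shows "norm (LBINT x. f x * g x) \<le> pnorm 2 f * pnorm 2 g"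
  by (rule order_trans[OF integral_norm_bound L2_Cauchy_Schwarz[OF assms]])

text \<open>Riesz--Fischer. Along a subsequence whose increments have norm at most $4^{-k}$, the function
  $\sum_k 4^k |d_k|^2$ is integrable, so the increments $d_k$ are almost everywhere $O(2^{-k})$.\<close>

lemma L2_complete:
  fixes f :: "nat \<Rightarrow> 'a::euclidean_space \<Rightarrow> 'b::euclidean_space"
  assumes f: "\<And>n. in_Lp 2 (f n)"
    and cauchy: "\<And>e. 0 < e \<Longrightarrow> \<exists>N. \<forall>m\<ge>N. \<forall>n\<ge>N. pnorm 2 (\<lambda>x. f m x - f n x) \<le> e"
  shows "\<exists>g. in_Lp 2 g \<and> (\<lambda>n. pnorm 2 (\<lambda>x. f n x - g x)) \<longlonglongrightarrow> 0"
proof -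
  have [measurable]: "f n \<in> borel_measurable borel" for n using f by auto
  have "\<exists>N. \<forall>m\<ge>N. \<forall>n\<ge>N. pnorm 2 (\<lambda>x. f m x - f n x) \<le> (1/4)^k" for k by (rule cauchy) simp
  then obtain N where N: "\<And>k m n. m \<ge> N k \<Longrightarrow> n \<ge> N k \<Longrightarrow> pnorm 2 (\<lambda>x. f m x - f n x) \<le> (1/4)^k" by metis
  \<comment> \<open>Adding up the \<open>N i\<close> makes \<open>r\<close> increasing and
    \<open>r k\<close> at least \<open>N k\<close>; the summand \<open>k\<close> gives
    \<open>k \<le> r k\<close>, so the subsequence passes every index.\<close>
  define r where "r k = k + (\<Sum>i\<le>k. N i)" for k
  have rN: "N k \<le> r k" for k
    using member_le_sum[of k "{..k}" N] by (simp add: r_def)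
  have rS: "r k \<le> r (Suc k)" for k by (simp add: r_def)
  have rk: "k \<le> r k" for k by (simp add: r_def)
  define d where "d k x = f (r (Suc k)) x - f (r k) x" for k x
  have dL: "in_Lp 2 (d k)" for k unfolding d_def by (intro in_Lp_diff f)
  have [measurable]: "d k \<in> borel_measurable borel" for k using dL by auto
  have dk: "pnorm 2 (d k) \<le> (1/4)^k" for k
    unfolding d_def by (rule N) (use rN[of k] rS[of k] in auto)
  have "(\<integral>\<^sup>+x. (\<Sum>k. ennreal (4^k * norm (d k x)^2)) \<partial>lborel) = (\<Sum>k. \<integral>\<^sup>+x. ennreal (4^k * norm (d k x)^2) \<partial>lborel)"
    by (rule nn_integral_suminf) measurable
  also have "\<dots> = (\<Sum>k. ennreal (4^k * pnorm 2 (d k) ^ 2))"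
    using dL by (subst nn_integral_eq_integral) (auto simp: pnorm_power)
  also have "\<dots> \<le> (\<Sum>k. ennreal ((1/4)^k))"
  proof (rule suminf_le, rule ennreal_leI)
    fix k
    have "4^k * pnorm 2 (d k) ^ 2 \<le> 4^k * ((1/4)^k)^2" by (intro mult_left_mono power_mono dk) auto
    also have "\<dots> = (1/4::real)^k" by (simp add: power2_eq_square power_divide)
    finally show "4^k * pnorm 2 (d k) ^ 2 \<le> (1/4)^k" .
  qed auto
  also have "\<dots> < \<infinity>"
    using summable_geometric[of "1/4::real"] by (subst suminf_ennreal2) auto
  finally have fin: "(\<integral>\<^sup>+x. (\<Sum>k. ennreal (4^k * norm (d k x)^2)) \<partial>lborel) \<noteq> \<infinity>" by simp
  have "AE x in lborel. (\<Sum>k. ennreal (4^k * norm (d k x)^2)) \<noteq> \<infinity>"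
    by (rule nn_integral_PInf_AE[OF _ fin]) measurable
  then have conv: "AE x in lborel. convergent (\<lambda>k. f (r k) x)"
  proof eventually_elim
    case (elim x)
    then have "summable (\<lambda>k. 4^k * norm (d k x)^2)"
      by (intro summable_suminf_not_top) auto
    then have "bounded (range (\<lambda>k. 4^k * norm (d k x)^2))"
      by (intro convergent_imp_bounded) (auto dest: summable_LIMSEQ_zero)
    then obtain C where C: "\<And>k. 4^k * norm (d k x)^2 \<le> C" by (auto simp: bounded_iff)
    have "norm (d k x) \<le> sqrt C * (1/2)^k" for k
    proof -
      have four: "(2^k)^2 = (4::real)^k"
        using power_mult[of "2::real" k 2] power_mult[of "2::real" 2 k] by (simp only: mult.commute[of k 2]) simp
      have "(2^k * norm (d k x))^2 \<le> C"
        using C[of k] by (simp only: power_mult_distrib four)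
      then have "2^k * norm (d k x) \<le> sqrt C" by (rule real_le_rsqrt)
      then show ?thesis by (simp add: field_simps)
    qed
    then have "summable (\<lambda>k. d k x)"
      by (rule summable_comparison_test'[of "\<lambda>k. sqrt C * (1/2)^k" 0, rotated]) (intro summable_mult summable_geometric, simp)
    then have "convergent (\<lambda>n. \<Sum>k<n. d k x)" by (simp add: summable_iff_convergent)
    moreover have "(\<Sum>k<n. d k x) = f (r n) x - f (r 0) x" for n
      unfolding d_def by (rule sum_lessThan_telescope)
    ultimately have "convergent (\<lambda>n. (f (r n) x - f (r 0) x) + f (r 0) x)"
      by (intro convergent_add convergent_const) simp
    then show ?case by simp
  qed
  define g where "g x = lim (\<lambda>k. f (r k) x)" for x
  have [measurable]: "g \<in> borel_measurable borel" unfolding g_def by measurable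
  have lim: "AE x in lborel. (\<lambda>k. f (r k) x) \<longlonglongrightarrow> g x"
    using conv by eventually_elim (simp add: g_def convergent_LIMSEQ_iff)
  \<comment> \<open>Fatou in the index of the subsequence, with n fixed, turns the Cauchy bound into
    a bound on the distance to the limit.\<close>
  have key: "in_Lp 2 (\<lambda>x. f n x - g x) \<and> pnorm 2 (\<lambda>x. f n x - g x) \<le> e"
    if n: "\<And>m. m \<ge> n \<Longrightarrow> pnorm 2 (\<lambda>x. f n x - f m x) \<le> e" and e: "0 < e" for n e
  proof (rule conjI)
    note * = pnorm_Fatou[where f="\<lambda>k x. f n x - f (r k) x" and g="\<lambda>x. f n x - g x" and p=2 and C=e]
    have a: "AE x in lborel. (\<lambda>k. f n x - f (r k) x) \<longlonglongrightarrow> f n x - g x"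
      using lim by eventually_elim (intro tendsto_intros)
    have b: "\<forall>\<^sub>F k in sequentially. pnorm 2 (\<lambda>x. f n x - f (r k) x) \<le> e"
      using eventually_ge_at_top[of n] by eventually_elim (rule n, use rk order_trans in blast)
    show "in_Lp 2 (\<lambda>x. f n x - g x)" by (rule *(1)) (use a b e f in \<open>auto intro: in_Lp_diff\<close>)
    show "pnorm 2 (\<lambda>x. f n x - g x) \<le> e" by (rule *(2)) (use a b e f in \<open>auto intro: in_Lp_diff\<close>)
  qed
  obtain n0 where n0: "\<forall>m\<ge>n0. \<forall>n\<ge>n0. pnorm 2 (\<lambda>x. f m x - f n x) \<le> 1" using cauchy[of 1] by auto
  have "in_Lp 2 (\<lambda>x. f n0 x - g x)" using key[of n0 1] n0 by auto
  then have "in_Lp 2 (\<lambda>x. f n0 x - (f n0 x - g x))"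
    by (rule in_Lp_diff[OF f])
  then have g: "in_Lp 2 g" by simp
  have "(\<lambda>n. pnorm 2 (\<lambda>x. f n x - g x)) \<longlonglongrightarrow> 0"
  proof (rule LIMSEQ_I)
    fix e :: real assume "0 < e"
    then obtain N where "\<forall>m\<ge>N. \<forall>n\<ge>N. pnorm 2 (\<lambda>x. f m x - f n x) \<le> e / 2" using cauchy[of "e/2"] by auto
    then have "pnorm 2 (\<lambda>x. f n x - g x) \<le> e / 2" if "n \<ge> N" for n
      using key[of n "e/2"] that \<open>0 < e\<close> by auto
    then show "\<exists>no. \<forall>n\<ge>no. norm (pnorm 2 (\<lambda>x. f n x - g x) - 0) < e"
      using \<open>0 < e\<close> by (intro exI[of _ N]) (auto, smt (verit) field_sum_of_halves)
  qed
  with g show ?thesis by blast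
qed

section \<open>Continuity of translations in L^1 and L^2\<close>

text \<open>Indicators of open sets are lower semicontinuous, so dominated convergence settles them; outer
  regularity extends this to measurable sets.\<close>

lemma translation_continuous_open:
  fixes U :: "'a::euclidean_space set"
  assumes U: "open U" "emeasure lborel U < \<infinity>" and a: "a \<longlonglongrightarrow> 0"
  shows "(\<lambda>n. LBINT x. \<bar>indicator U (x + a n) - indicator U x :: real\<bar>) \<longlonglongrightarrow> 0"
proof -
  have [measurable]: "U \<in> sets borel" using U by auto
  have iU: "integrable lborel (indicator U :: 'a \<Rightarrow> real)" using U by auto
  have iUn: "integrable lborel (\<lambda>x. indicator U (x + a n) :: real)" for n
    using iU by (subst lborel_integral_translate(2)) auto
  have imin: "integrable lborel (\<lambda>x. indicator U x * indicator U (x + a n) :: real)" for n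
    by (rule Bochner_Integration.integrable_bound[OF iU]) (auto simp: indicator_def)
  \<comment> \<open>With the factor \<open>indicator U x\<close> in front, the integrand vanishes
    off U, so a limit is required only at interior points.\<close>
  have "(\<lambda>n. LBINT x. (indicator U x * indicator U (x + a n) :: real)) \<longlonglongrightarrow> (LBINT x. indicator U x)"
  proof (rule integral_dominated_convergence[where w="indicator U"])
    show "AE x in lborel. (\<lambda>i. indicator U x * indicator U (x + a i)) \<longlonglongrightarrow> (indicator U x :: real)"
    proof (rule AE_I2)
      fix x
      show "(\<lambda>i. indicator U x * indicator U (x + a i)) \<longlonglongrightarrow> (indicator U x :: real)"
      proof (cases "x \<in> U")
        case True
        have "(\<lambda>i. x + a i) \<longlonglongrightarrow> x + 0" by (intro tendsto_intros a)
        then have "\<forall>\<^sub>F i in sequentially. x + a i \<in> U" using topological_tendstoD[OF _ U(1)] True by auto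
        then have "\<forall>\<^sub>F i in sequentially. indicator U x * indicator U (x + a i) = (indicator U x :: real)"
          by eventually_elim (use True in auto)
        then show ?thesis by (rule tendsto_eventually)
      qed auto
    qed
  qed (use iU in \<open>auto simp: indicator_def\<close>)
  then have "(\<lambda>n. 2 * ((LBINT x. indicator U x) - (LBINT x. (indicator U x * indicator U (x + a n) :: real)))) \<longlonglongrightarrow>
     2 * ((LBINT x. indicator U x) - (LBINT x. indicator U x))"
    by (intro tendsto_intros)
  moreover have "(LBINT x. \<bar>indicator U (x + a n) - indicator U x :: real\<bar>)
     = 2 * ((LBINT x. indicator U x) - (LBINT x. (indicator U x * indicator U (x + a n) :: real)))" for n
  proof -
    have "(LBINT x. \<bar>indicator U (x + a n) - indicator U x :: real\<bar>)
      = (LBINT x. indicator U x + indicator U (x + a n) - 2 * (indicator U x * indicator U (x + a n) :: real))"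
      by (intro Bochner_Integration.integral_cong) (auto simp: indicator_def)
    also have "\<dots> = (LBINT x. indicator U x) + (LBINT x. indicator U (x + a n)) - 2 * (LBINT x. (indicator U x * indicator U (x + a n) :: real))"
      using iU iUn imin by simp
    also have "(LBINT x. indicator U (x + a n) :: real) = (LBINT x. indicator U x)"
      by (rule lborel_integral_translate) measurable
    finally show ?thesis by simp
  qed
  ultimately show ?thesis by simp
qed

lemma integrable_translate_diff:
  fixes f :: "'a::euclidean_space \<Rightarrow> 'b::euclidean_space"
  assumes "integrable lborel f"
  shows "integrable lborel (\<lambda>x. norm (f (x + c) - f x))"
  using assms lborel_integral_translate(2)[of f c] by auto

lemma translation_L1_approx:
  fixes f g :: "'a::euclidean_space \<Rightarrow> 'b::euclidean_space"
  assumes f: "integrable lborel f" and g: "integrable lborel g"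
  shows "(LBINT x. norm (f (x + c) - f x))
     \<le> 2 * (LBINT x. norm (f x - g x)) + (LBINT x. norm (g (x + c) - g x))"
proof -
  have fm [measurable]: "f \<in> borel_measurable borel" "g \<in> borel_measurable borel" using f g by auto
  have fg: "integrable lborel (\<lambda>x. norm (f x - g x))" using f g by auto
  have fgc: "integrable lborel (\<lambda>x. norm (f (x + c) - g (x + c)))"
    by (subst lborel_integral_translate(2)[of "\<lambda>x. norm (f x - g x)" c]) (use fg in auto)
  have "(LBINT x. norm (f (x + c) - f x))
     \<le> (LBINT x. norm (f (x + c) - g (x + c)) + norm (g (x + c) - g x) + norm (f x - g x))"
  proof (rule integral_mono)
    show "norm (f (x + c) - f x) \<le> norm (f (x + c) - g (x + c)) + norm (g (x + c) - g x) + norm (f x - g x)" for x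
      using norm_triangle_ineq4[of "(f (x + c) - g (x + c)) + (g (x + c) - g x)" "f x - g x"]
        norm_triangle_ineq[of "f (x + c) - g (x + c)" "g (x + c) - g x"] by (simp add: algebra_simps)
  qed (use fg fgc integrable_translate_diff[OF f] integrable_translate_diff[OF g] in auto)
  also have "\<dots> = (LBINT x. norm (f (x + c) - g (x + c))) + (LBINT x. norm (g (x + c) - g x)) + (LBINT x. norm (f x - g x))"
    using fg fgc integrable_translate_diff[OF g] by simp
  also have "(LBINT x. norm (f (x + c) - g (x + c))) = (LBINT x. norm (f x - g x))"
    by (rule lborel_integral_translate(1)[of "\<lambda>x. norm (f x - g x)"]) measurable
  finally show ?thesis by simp
qed

text \<open>The property is closed under approximation in L^1. This serves both the base case (a set
  approximated by an open set) and the limit case of the induction below.\<close>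

lemma translation_L1_limit:
  fixes f :: "'a::euclidean_space \<Rightarrow> 'b::euclidean_space"
  assumes f: "integrable lborel f"
    and approx: "\<And>e. 0 < e \<Longrightarrow> \<exists>g. integrable lborel g \<and> (LBINT x. norm (f x - g x)) \<le> e \<and>
       (\<lambda>n. LBINT x. norm (g (x + a n) - g x)) \<longlonglongrightarrow> 0"
  shows "(\<lambda>n. LBINT x. norm (f (x + a n) - f x)) \<longlonglongrightarrow> 0"
proof (rule LIMSEQ_I)
  fix e :: real assume e: "0 < e"
  obtain g where g: "integrable lborel g" "(LBINT x. norm (f x - g x)) \<le> e / 4"
       "(\<lambda>n. LBINT x. norm (g (x + a n) - g x)) \<longlonglongrightarrow> 0"
    using approx[of "e/4"] e by auto
  from LIMSEQ_D[OF g(3), of "e/2"] e obtain N where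
    N: "\<And>n. n \<ge> N \<Longrightarrow> \<bar>LBINT x. norm (g (x + a n) - g x)\<bar> < e / 2" by auto
  show "\<exists>no. \<forall>n\<ge>no. norm ((LBINT x. norm (f (x + a n) - f x)) - 0) < e"
  proof (intro exI[of _ N] allI impI)
    fix n assume "N \<le> n"
    have "0 \<le> (LBINT x. norm (f (x + a n) - f x))" by simp
    with translation_L1_approx[OF f g(1), of "a n"] N[OF \<open>N \<le> n\<close>] g(2)
    show "norm ((LBINT x. norm (f (x + a n) - f x)) - 0) < e" by simp
  qed
qed

lemma translation_continuous_L1:
  fixes f :: "'a::euclidean_space \<Rightarrow> 'b::euclidean_space"
  assumes f: "integrable lborel f" and a: "a \<longlonglongrightarrow> 0"
  shows "(\<lambda>n. LBINT x. norm (f (x + a n) - f x)) \<longlonglongrightarrow> 0"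
  using f
proof (induction rule: integrable_induct)
  case (base A c)
  have [measurable]: "A \<in> sets borel" using base by auto
  have iA: "integrable lborel (\<lambda>x. indicator A x *\<^sub>R c)" using base by auto
  show ?case
  proof (rule translation_L1_limit[OF iA])
    fix e :: real assume e: "0 < e"
    define d where "d = e / (1 + norm c)"
    have d: "0 < d" using e by (auto simp: d_def intro!: divide_pos_pos add_pos_nonneg)
    obtain U where U: "open U" "A \<subseteq> U" "emeasure lborel (U - A) < d"
      using outer_regular_lborel[OF _ d, of A] by auto
    have [measurable]: "U \<in> sets borel" using U by auto
    have "emeasure lborel U \<le> emeasure lborel A + emeasure lborel (U - A)"
      using U by (subst plus_emeasure) (auto intro: emeasure_mono)
    also have "\<dots> < \<infinity>" using base U(3) by (simp add: less_top) (metis ennreal_less_top less_trans less_top)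
    finally have Ufin: "emeasure lborel U < \<infinity>" .
    have iU: "integrable lborel (\<lambda>x. indicator U x *\<^sub>R c)" using Ufin by auto
    have "(LBINT x. norm (indicator A x *\<^sub>R c - indicator U x *\<^sub>R c)) = (LBINT x. indicator (U - A) x * norm c)"
      by (intro Bochner_Integration.integral_cong) (use U in \<open>auto simp: indicator_def\<close>)
    also have "\<dots> = measure lborel (U - A) * norm c" by simp
    also have "\<dots> \<le> d * norm c"
      using U(3) d by (intro mult_right_mono) (auto simp: measure_def intro!: enn2real_leI)
    also have "\<dots> \<le> d * (1 + norm c)" using d by (intro mult_left_mono) auto
    also have "\<dots> = e" unfolding d_def by (simp add: add_pos_nonneg add_nonneg_eq_0_iff)
    finally have 1: "(LBINT x. norm (indicator A x *\<^sub>R c - indicator U x *\<^sub>R c)) \<le> e" .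
    have "(\<lambda>n. (LBINT x. \<bar>indicator U (x + a n) - indicator U x :: real\<bar>) * norm c) \<longlonglongrightarrow> 0 * norm c"
      by (intro tendsto_intros translation_continuous_open U Ufin a)
    then have 2: "(\<lambda>n. LBINT x. norm (indicator U (x + a n) *\<^sub>R c - indicator U x *\<^sub>R c)) \<longlonglongrightarrow> 0"
      by (simp flip: scaleR_left_diff_distrib)
    show "\<exists>g. integrable lborel g \<and> (LBINT x. norm (indicator A x *\<^sub>R c - g x)) \<le> e \<and>
         (\<lambda>n. LBINT x. norm (g (x + a n) - g x)) \<longlonglongrightarrow> 0"
      by (rule exI[of _ "\<lambda>x. indicator U x *\<^sub>R c"]) (use iU 1 2 in auto)
  qed
next
  case (add f g)
  have i: "integrable lborel (\<lambda>x. norm (f (x + a n) - f x))" "integrable lborel (\<lambda>x. norm (g (x + a n) - g x))" for n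
    using add integrable_translate_diff by auto
  have "(\<lambda>n. (LBINT x. norm (f (x + a n) - f x)) + (LBINT x. norm (g (x + a n) - g x))) \<longlonglongrightarrow> 0 + 0"
    by (intro tendsto_intros add)
  then have sum0: "(\<lambda>n. (LBINT x. norm (f (x + a n) - f x)) + (LBINT x. norm (g (x + a n) - g x))) \<longlonglongrightarrow> 0"
    by simp
  show ?case
  proof (rule tendsto_sandwich[OF _ _ tendsto_const sum0])
    show "\<forall>\<^sub>F n in sequentially. 0 \<le> (LBINT x. norm (f (x + a n) + g (x + a n) - (f x + g x)))" by simp
    show "\<forall>\<^sub>F n in sequentially. (LBINT x. norm (f (x + a n) + g (x + a n) - (f x + g x)))
      \<le> (LBINT x. norm (f (x + a n) - f x)) + (LBINT x. norm (g (x + a n) - g x))"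
    proof (intro always_eventually allI)
      fix n
      have "(LBINT x. norm (f (x + a n) + g (x + a n) - (f x + g x)))
        \<le> (LBINT x. norm (f (x + a n) - f x) + norm (g (x + a n) - g x))"
        using integrable_translate_diff[of "\<lambda>x. f x + g x" "a n"] add i[of n]
        by (intro integral_mono) (auto simp: norm_diff_triangle_ineq)
      then show "(LBINT x. norm (f (x + a n) + g (x + a n) - (f x + g x)))
        \<le> (LBINT x. norm (f (x + a n) - f x)) + (LBINT x. norm (g (x + a n) - g x))"
        using i[of n] by simp
    qed
  qed
next
  case (lim f s)
  have [measurable]: "f \<in> borel_measurable borel" "s i \<in> borel_measurable borel" for i using lim by auto
  show ?case
  proof (rule translation_L1_limit[OF lim(4)])
    fix e :: real assume e: "0 < e"
    have "(\<lambda>i. LBINT x. norm (f x - s i x)) \<longlonglongrightarrow> (LINT x|(lborel::'a measure). 0)"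
    proof (rule integral_dominated_convergence[where w="\<lambda>x. 3 * norm (f x)"])
      show "AE x in lborel. (\<lambda>i. norm (f x - s i x)) \<longlonglongrightarrow> 0"
      proof (rule AE_I2)
        fix x
        have "(\<lambda>i. norm (f x - s i x)) \<longlonglongrightarrow> norm (f x - f x)"
          by (intro tendsto_intros lim) auto
        then show "(\<lambda>i. norm (f x - s i x)) \<longlonglongrightarrow> 0" by simp
      qed
      show "AE x in lborel. norm (norm (f x - s i x)) \<le> 3 * norm (f x)" for i
      proof (rule AE_I2)
        fix x
        show "norm (norm (f x - s i x)) \<le> 3 * norm (f x)"
          using lim(3)[of x i] norm_triangle_ineq4[of "f x" "s i x"] by auto
      qed
    qed (use lim in auto)
    from LIMSEQ_D[OF this, of e] e obtain i where "(LBINT x. norm (f x - s i x)) \<le> e"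
      by (auto simp: less_imp_le) (metis abs_ge_self le_refl less_imp_le order_trans)
    then show "\<exists>g. integrable lborel g \<and> (LBINT x. norm (f x - g x)) \<le> e \<and>
         (\<lambda>n. LBINT x. norm (g (x + a n) - g x)) \<longlonglongrightarrow> 0"
      using lim by (intro exI[of _ "s i"]) auto
  qed
qed

text \<open>Truncation in space and in height leaves an integrable function bounded by k, whose
  increments satisfy |d|^2 <= 2k |d|; the L^1 result then applies to it.\<close>

lemma translation_continuous_L2:
  fixes f :: "'a::euclidean_space \<Rightarrow> 'b::euclidean_space"
  assumes f: "in_Lp 2 f" and a: "a \<longlonglongrightarrow> 0"
  shows "(\<lambda>n. pnorm 2 (\<lambda>x. f (x + a n) - f x)) \<longlonglongrightarrow> 0"
proof (rule LIMSEQ_I)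
  fix e :: real assume e: "0 < e"
  have [measurable]: "f \<in> borel_measurable borel" using f by auto
  define g where "g k x = (if norm x \<le> real k \<and> norm (f x) \<le> real k then f x else 0)" for k x
  have [measurable]: "g k \<in> borel_measurable borel" for k unfolding g_def by measurable
  have gL: "in_Lp 2 (g k)" for k by (rule in_Lp_bound[OF f]) (auto simp: g_def)
  have "(\<lambda>k. pnorm 2 (\<lambda>x. f x - g k x)) \<longlonglongrightarrow> 0"
  proof (rule pnorm_dominated[OF f])
    show "AE x in lborel. (\<lambda>k. f x - g k x) \<longlonglongrightarrow> 0"
    proof (rule AE_I2, rule tendsto_eventually)
      fix x
      obtain K where "max (norm x) (norm (f x)) \<le> real K" using real_arch_simple by blast
      then have "\<forall>k\<ge>K. f x - g k x = 0" by (auto simp: g_def)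
      then show "\<forall>\<^sub>F k in sequentially. f x - g k x = 0" by (auto simp: eventually_sequentially)
    qed
    show "AE x in lborel. norm (f x - g n x) \<le> norm (f x)" for n by (auto simp: g_def)
  qed auto
  from LIMSEQ_D[OF this, of "e/4"] e obtain k where k: "pnorm 2 (\<lambda>x. f x - g k x) < e / 4" by auto
  have gi: "integrable lborel (g k)"
  proof (rule Bochner_Integration.integrable_bound)
    show "integrable lborel (\<lambda>x::'a. indicator (cball 0 (real k)) x *\<^sub>R real k)"
      by (intro integrable_scaleR_left integrable_real_indicator) (use emeasure_bounded_finite[OF bounded_cball] in simp_all)
  qed (auto simp: g_def indicator_def)
  have "(\<lambda>n. 2 * real k * (LBINT x. norm (g k (x + a n) - g k x))) \<longlonglongrightarrow> 2 * real k * 0"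
    by (intro tendsto_intros translation_continuous_L1 gi a)
  from LIMSEQ_D[OF this, of "(e/4)^2"] e obtain N where
    N: "\<And>n. n \<ge> N \<Longrightarrow> 2 * real k * (LBINT x. norm (g k (x + a n) - g k x)) < (e/4)^2" by fastforce
  show "\<exists>no. \<forall>n\<ge>no. norm (pnorm 2 (\<lambda>x. f (x + a n) - f x) - 0) < e"
  proof (intro exI[of _ N] allI impI)
    fix n assume n: "N \<le> n"
    have "(LBINT x. norm (g k (x + a n) - g k x) ^ 2) \<le> (LBINT x. 2 * real k * norm (g k (x + a n) - g k x))"
    proof (rule integral_mono)
      show "integrable lborel (\<lambda>x. norm (g k (x + a n) - g k x) ^ 2)"
        using in_Lp_diff[OF in_Lp_translate[OF gL] gL] by auto
      show "integrable lborel (\<lambda>x. 2 * real k * norm (g k (x + a n) - g k x))"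
        using integrable_translate_diff[OF gi] by auto
      fix x
      have b: "norm (g k x) \<le> real k" for x by (auto simp: g_def)
      have "norm (g k (x + a n) - g k x) \<le> 2 * real k"
        using norm_triangle_ineq4[of "g k (x + a n)" "g k x"] b[of x] b[of "x + a n"] by linarith
      then show "norm (g k (x + a n) - g k x) ^ 2 \<le> 2 * real k * norm (g k (x + a n) - g k x)"
        by (simp add: power2_eq_square mult_right_mono)
    qed
    also have "\<dots> < (e/4)^2" using N[OF n] by simp
    finally have 1: "pnorm 2 (\<lambda>x. g k (x + a n) - g k x) \<le> e / 4"
      using e by (subst pnorm_le_iff) auto
    have 2: "pnorm 2 (\<lambda>x. f (x + a n) - g k (x + a n)) = pnorm 2 (\<lambda>x. f x - g k x)"
      using pnorm_translate[OF in_Lp_diff[OF f gL]] .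
    have "pnorm 2 (\<lambda>x. f (x + a n) - f x)
      \<le> pnorm 2 (\<lambda>x. f (x + a n) - g k (x + a n)) + pnorm 2 (\<lambda>x. g k (x + a n) - f x)"
      by (rule pnorm_triangle3) (auto intro: in_Lp_translate f gL)
    also have "pnorm 2 (\<lambda>x. g k (x + a n) - f x) \<le> pnorm 2 (\<lambda>x. g k (x + a n) - g k x) + pnorm 2 (\<lambda>x. g k x - f x)"
      by (rule pnorm_triangle3) (auto intro: in_Lp_translate f gL)
    finally have "pnorm 2 (\<lambda>x. f (x + a n) - f x) < e"
      using 1 2 k e pnorm_minus_commute[of 2 "g k" f] by linarith
    then show "norm (pnorm 2 (\<lambda>x. f (x + a n) - f x) - 0) < e" by simp
  qed
qed

section \<open>The Fourier transform on integrable functions\<close>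

lemma borel_measurable_cis [measurable (raw)]:
  "f \<in> borel_measurable M \<Longrightarrow> (\<lambda>x. cis (f x)) \<in> borel_measurable M"
  by (rule measurable_compose[of f M borel cis borel])
     (auto intro!: borel_measurable_continuous_onI continuous_intros)

section \<open>Gaussian integrals\<close>

lemma lborel_prod_integral:
  fixes u :: "'a::euclidean_space \<Rightarrow> real \<Rightarrow> 'b::{real_normed_field, banach, second_countable_topology}"
  assumes "\<And>b. b \<in> Basis \<Longrightarrow> integrable lborel (u b)"
  shows "integrable lborel (\<lambda>x::'a. \<Prod>b\<in>Basis. u b (x \<bullet> b))"
    and "(LBINT x. (\<Prod>b\<in>Basis. u b ((x::'a) \<bullet> b))) = (\<Prod>b\<in>Basis. LBINT s. u b s)"
proof -
  interpret product_sigma_finite "\<lambda>_::'a. lborel :: real measure" ..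
  have [measurable]: "u b \<in> borel_measurable borel" if "b \<in> Basis" for b using assms[OF that] by auto
  have [measurable]: "(\<lambda>x::'a. \<Prod>b\<in>Basis. u b (x \<bullet> b)) \<in> borel_measurable borel"
    by (rule borel_measurable_prod) (auto intro!: measurable_compose[OF _ borel_measurable_integrable[OF assms, simplified]])
  have [measurable]: "(\<lambda>f. \<Sum>b\<in>Basis. f b *\<^sub>R b) \<in> (\<Pi>\<^sub>M b\<in>Basis. (lborel :: real measure)) \<rightarrow>\<^sub>M (borel :: 'a measure)"
    by measurable
  have eq: "(\<Prod>b\<in>Basis. u b ((\<Sum>b\<in>Basis. f b *\<^sub>R b) \<bullet> b)) = (\<Prod>b\<in>Basis. u b (f b))" for f :: "'a \<Rightarrow> real"
    by (intro prod.cong) (auto simp: inner_sum_left inner_Basis if_distrib cong: if_cong)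
  show "integrable lborel (\<lambda>x::'a. \<Prod>b\<in>Basis. u b (x \<bullet> b))"
    by (subst lborel_eq, subst integrable_distr_eq)
       (auto simp: eq intro!: product_integrable_prod assms)
  show "(LBINT x. (\<Prod>b\<in>Basis. u b ((x::'a) \<bullet> b))) = (\<Prod>b\<in>Basis. LBINT s. u b s)"
    by (subst lborel_eq, subst integral_distr)
       (auto simp: eq intro!: product_integral_prod assms)
qed

text \<open>This is the characteristic function of the standard normal distribution, freed from the
  normalisation sqrt (2 pi) of its density.\<close>

lemma gaussian_integral_1d:
  "integrable lborel (\<lambda>s::real. cis (a * s) * exp (- s\<^sup>2 / 2))"
  "(LBINT s. cis (a * s) * exp (- s\<^sup>2 / 2)) = complex_of_real (sqrt (2 * pi) * exp (- a\<^sup>2 / 2))"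
proof -
  have m: "integrable lborel std_normal_density"
    using integrable_std_normal_moment[of 0] by simp
  have eq: "cis (a * s) * exp (- s\<^sup>2 / 2) = sqrt (2 * pi) *\<^sub>R (std_normal_density s *\<^sub>R iexp (a * s))" for s
    by (simp add: std_normal_density_def cis_conv_exp scaleR_conv_of_real field_simps flip: of_real_exp)
  have i: "integrable lborel (\<lambda>s. std_normal_density s *\<^sub>R iexp (a * s))"
    by (rule Bochner_Integration.integrable_bound[OF m]) auto
  then show "integrable lborel (\<lambda>s::real. cis (a * s) * exp (- s\<^sup>2 / 2))"
    unfolding eq by (rule integrable_scaleR_right)
  have "char std_normal_distribution a = (LBINT s. std_normal_density s *\<^sub>R iexp (a * s))"
    unfolding char_def by (subst integral_density) auto
  then have "(LBINT s. std_normal_density s *\<^sub>R iexp (a * s)) = complex_of_real (exp (- a\<^sup>2 / 2))"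
    by (simp add: char_std_normal_distribution)
  then show "(LBINT s. cis (a * s) * exp (- s\<^sup>2 / 2)) = complex_of_real (sqrt (2 * pi) * exp (- a\<^sup>2 / 2))"
    unfolding eq by (simp add: scaleR_conv_of_real)
qed

lemma cis_sum: "finite A \<Longrightarrow> cis (\<Sum>a\<in>A. f a) = (\<Prod>a\<in>A. cis (f a))"
  by (induction A rule: finite_induct) (simp_all flip: cis_mult)

lemma power2_norm_eq_sum_Basis: "(norm (x::'a::euclidean_space))\<^sup>2 = (\<Sum>b\<in>Basis. (x \<bullet> b)\<^sup>2)"
  by (subst power2_norm_eq_inner, subst euclidean_inner) (simp add: power2_eq_square)

lemma gaussian_integral:
  fixes z :: space
  shows "integrable lborel (\<lambda>\<xi>. cis (z \<bullet> \<xi>) * exp (- (norm \<xi>)\<^sup>2 / 2))"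
    "(LBINT \<xi>. cis (z \<bullet> \<xi>) * exp (- (norm \<xi>)\<^sup>2 / 2)) = complex_of_real ((2 * pi) powr (3/2) * exp (- (norm z)\<^sup>2 / 2))"
proof -
  have eq: "cis (z \<bullet> \<xi>) * exp (- (norm \<xi>)\<^sup>2 / 2) = (\<Prod>b\<in>Basis. (cis ((z \<bullet> b) * (\<xi> \<bullet> b)) * exp (- (\<xi> \<bullet> b)\<^sup>2 / 2)))" for \<xi> :: space
  proof -
    have "- (norm \<xi>)\<^sup>2 / 2 = (\<Sum>b\<in>Basis. - (\<xi> \<bullet> b)\<^sup>2 / 2)"
      by (simp add: power2_norm_eq_sum_Basis sum_negf sum_divide_distrib)
    then show ?thesis
      by (subst euclidean_inner, subst cis_sum) (simp_all add: exp_sum prod.distrib)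
  qed
  note * = lborel_prod_integral[of "\<lambda>b s. cis ((z \<bullet> b) * s) * complex_of_real (exp (- s\<^sup>2 / 2))"]
  show "integrable lborel (\<lambda>\<xi>. cis (z \<bullet> \<xi>) * exp (- (norm \<xi>)\<^sup>2 / 2))"
    unfolding eq by (rule *(1)) (rule gaussian_integral_1d)
  have "(LBINT \<xi>. cis (z \<bullet> \<xi>) * exp (- (norm \<xi>)\<^sup>2 / 2)) = (\<Prod>b\<in>(Basis::space set). complex_of_real (sqrt (2 * pi) * exp (- (z \<bullet> b)\<^sup>2 / 2)))"
    unfolding eq by (subst *(2)) (auto simp only: gaussian_integral_1d)
  also have "\<dots> = complex_of_real ((\<Prod>b\<in>(Basis::space set). sqrt (2 * pi)) * (\<Prod>b\<in>(Basis::space set). exp (- (z \<bullet> b)\<^sup>2 / 2)))"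
    by (simp add: prod.distrib)
  also have "(\<Prod>b\<in>(Basis::space set). exp (- (z \<bullet> b)\<^sup>2 / 2)) = exp (- (norm z)\<^sup>2 / 2)"
    by (simp add: power2_norm_eq_sum_Basis sum_negf sum_divide_distrib exp_sum[symmetric])
  also have "(\<Prod>b\<in>(Basis::space set). sqrt (2 * pi)) = (2 * pi) powr (3/2)"
    by (simp add: powr_half_sqrt[symmetric] powr_powr flip: powr_realpow)
  finally show "(LBINT \<xi>. cis (z \<bullet> \<xi>) * exp (- (norm \<xi>)\<^sup>2 / 2)) = complex_of_real ((2 * pi) powr (3/2) * exp (- (norm z)\<^sup>2 / 2))" .
qed

lemma lborel_integral_affine:
  fixes f :: "'a::euclidean_space \<Rightarrow> 'b::{banach, second_countable_topology}"
  assumes [measurable]: "f \<in> borel_measurable borel" and c: "0 < c"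
  shows "(LBINT x. f x) = (c ^ DIM('a)) *\<^sub>R (LBINT x. f (t + c *\<^sub>R x))"
    and "integrable lborel (\<lambda>x. f (t + c *\<^sub>R x)) \<longleftrightarrow> integrable lborel f"
proof -
  have m [measurable]: "(\<lambda>x. t + c *\<^sub>R x) \<in> lborel \<rightarrow>\<^sub>M (borel::'a measure)" by measurable
  have eq: "(lborel :: 'a measure) = density (distr lborel borel (\<lambda>x. t + c *\<^sub>R x)) (\<lambda>_. ennreal (c ^ DIM('a)))"
    using lborel_affine[of c t] c by simp
  show "(LBINT x. f x) = (c ^ DIM('a)) *\<^sub>R (LBINT x. f (t + c *\<^sub>R x))"
    by (subst eq, subst integral_density) (use c in \<open>auto simp: integral_distr\<close>)
  show "integrable lborel (\<lambda>x. f (t + c *\<^sub>R x)) \<longleftrightarrow> integrable lborel f"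
  proof -
    have "integrable lborel f \<longleftrightarrow> integrable lborel (\<lambda>x. c ^ DIM('a) *\<^sub>R f (t + c *\<^sub>R x))"
      by (subst eq, subst integrable_density) (use c in \<open>auto simp: integrable_distr_eq\<close>)
    moreover have "integrable lborel (\<lambda>x. c ^ DIM('a) *\<^sub>R f (t + c *\<^sub>R x)) \<longleftrightarrow> integrable lborel (\<lambda>x. f (t + c *\<^sub>R x))"
      using integrable_scaleR_right[of "inverse (c ^ DIM('a))" lborel "\<lambda>x. c ^ DIM('a) *\<^sub>R f (t + c *\<^sub>R x)"]
        integrable_scaleR_right[of "c ^ DIM('a)" lborel "\<lambda>x. f (t + c *\<^sub>R x)"] c by auto
    ultimately show ?thesis by simp
  qed
qed

text \<open>The factor e^3 stays on the left, as the substitution produces it; what remains on the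
  right is a Gaussian of width e, which will serve as an approximate identity.\<close>

lemma gaussian_integral_scaled:
  fixes z :: space
  assumes e: "0 < e"
  shows "integrable lborel (\<lambda>\<xi>. cis (z \<bullet> \<xi>) * exp (- (e * norm \<xi>)\<^sup>2 / 2))"
    "e ^ 3 *\<^sub>R (LBINT \<xi>. cis (z \<bullet> \<xi>) * exp (- (e * norm \<xi>)\<^sup>2 / 2)) = complex_of_real ((2 * pi) powr (3/2) * exp (- (norm z / e)\<^sup>2 / 2))"
proof -
  let ?f = "\<lambda>\<xi>::space. cis ((z /\<^sub>R e) \<bullet> \<xi>) * complex_of_real (exp (- (norm \<xi>)\<^sup>2 / 2))"
  have [measurable]: "?f \<in> borel_measurable borel" by measurable
  have eq: "?f (0 + e *\<^sub>R \<xi>) = cis (z \<bullet> \<xi>) * exp (- (e * norm \<xi>)\<^sup>2 / 2)" for \<xi>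
    using e by (simp add: mult.assoc[symmetric])
  show "integrable lborel (\<lambda>\<xi>. cis (z \<bullet> \<xi>) * exp (- (e * norm \<xi>)\<^sup>2 / 2))"
    using lborel_integral_affine(2)[of ?f e 0] gaussian_integral(1)[of "z /\<^sub>R e"] e unfolding eq by simp
  show "e ^ 3 *\<^sub>R (LBINT \<xi>. cis (z \<bullet> \<xi>) * exp (- (e * norm \<xi>)\<^sup>2 / 2)) = complex_of_real ((2 * pi) powr (3/2) * exp (- (norm z / e)\<^sup>2 / 2))"
  proof -
    have "(LBINT \<xi>. ?f \<xi>) = e ^ DIM(space) *\<^sub>R (LBINT \<xi>. ?f (0 + e *\<^sub>R \<xi>))"
      by (rule lborel_integral_affine(1)[OF _ e]) measurable
    moreover have "norm (z /\<^sub>R e) = norm z / e" using e by (simp add: divide_inverse_commute)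
    ultimately show ?thesis
      unfolding eq gaussian_integral(2) by simp
  qed
qed

text \<open>The Fourier integral of an integrable function, defined at every point, in contrast to
  \<open>fourier\<close>, which is determined only up to null sets.\<close>

definition ft :: "(space \<Rightarrow> complex) \<Rightarrow> space \<Rightarrow> complex" where
  "ft f \<xi> = ((2 * pi) powr (- 3 / 2)) *\<^sub>R (LBINT x. cis (- (x \<bullet> \<xi>)) * f x)"

lemma truncated_fourier_eq: "truncated_fourier R f = ft (\<lambda>x. indicator (cball 0 R) x *\<^sub>R f x)"
  by (rule ext) (simp add: truncated_fourier_def ft_def set_lebesgue_integral_def)

lemma integrable_cis_mult:
  fixes f :: "'a::euclidean_space \<Rightarrow> complex"
  assumes "integrable lborel f" "p \<in> borel_measurable borel"
  shows "integrable lborel (\<lambda>x. cis (p x) * f x)"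
  by (rule Bochner_Integration.integrable_bound[OF assms(1)])
     (use assms in \<open>auto simp: norm_mult\<close>)

lemma borel_measurable_ft [measurable]:
  assumes [measurable]: "f \<in> borel_measurable borel"
  shows "ft f \<in> borel_measurable borel"
  unfolding ft_def[abs_def] by measurable

lemma norm_ft_le:
  "norm (ft f \<xi>) \<le> (2 * pi) powr (- 3 / 2) * (LBINT x. norm (f x))"
proof -
  have "norm (LBINT x. cis (- (x \<bullet> \<xi>)) * f x) \<le> (LBINT x. norm (f x))"
    using integral_norm_bound[of lborel "\<lambda>x. cis (- (x \<bullet> \<xi>)) * f x"] by (simp add: norm_mult)
  then show ?thesis by (simp add: ft_def mult_left_mono)
qed

lemma ft_diff:
  assumes "integrable lborel f" "integrable lborel g"
  shows "ft (\<lambda>x. f x - g x) \<xi> = ft f \<xi> - ft g \<xi>"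
  using integrable_cis_mult[OF assms(1), of "\<lambda>x. - (x \<bullet> \<xi>)"] integrable_cis_mult[OF assms(2), of "\<lambda>x. - (x \<bullet> \<xi>)"]
  by (simp add: ft_def right_diff_distrib scaleR_diff_right)

text \<open>The sign is a parameter because the transform (s = -1) and its complex conjugate (s = 1)
  are both inserted.\<close>

lemma fourier_Fubini:
  fixes f k :: "space \<Rightarrow> complex"
  assumes f: "integrable lborel f" and k: "integrable lborel k"
  shows "(LBINT \<xi>. k \<xi> * (LBINT x. cis (s * (x \<bullet> \<xi>)) * f x))
       = (LBINT x. f x * (LBINT \<xi>. cis (s * (x \<bullet> \<xi>)) * k \<xi>))"
proof -
  have [measurable]: "f \<in> borel_measurable borel" "k \<in> borel_measurable borel" using f k by auto
  have int: "integrable (lborel \<Otimes>\<^sub>M lborel) (\<lambda>(\<xi>, x). k \<xi> * (cis (s * (x \<bullet> \<xi>)) * f x))"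
  proof (rule lborel_pair.Fubini_integrable)
    show "integrable lborel (\<lambda>x. LBINT y. norm (case (x, y) of (\<xi>, x) \<Rightarrow> k \<xi> * (cis (s * (x \<bullet> \<xi>)) * f x)))"
      using k by (simp add: norm_mult)
    show "AE x in lborel. integrable lborel (\<lambda>y. case (x, y) of (\<xi>, x) \<Rightarrow> k \<xi> * (cis (s * (x \<bullet> \<xi>)) * f x))"
      using f by (intro AE_I2) (auto intro!: integrable_mult_right integrable_cis_mult)
  qed measurable
  have "(LBINT \<xi>. k \<xi> * (LBINT x. cis (s * (x \<bullet> \<xi>)) * f x))
     = (LBINT \<xi>. LBINT x. k \<xi> * (cis (s * (x \<bullet> \<xi>)) * f x))"
    by simp
  also have "\<dots> = (LBINT x. LBINT \<xi>. k \<xi> * (cis (s * (x \<bullet> \<xi>)) * f x))"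
    using lborel_pair.Fubini_integral[OF int] by simp
  also have "\<dots> = (LBINT x. LBINT \<xi>. f x * (cis (s * (x \<bullet> \<xi>)) * k \<xi>))"
    by (simp add: mult_ac)
  finally show ?thesis by simp
qed

lemma ft_mult_formula:
  assumes f: "integrable lborel f" and k: "integrable lborel k"
  shows "(LBINT \<xi>. ft f \<xi> * k \<xi>) = (LBINT x. f x * ft k x)"
proof -
  let ?c = "(2 * pi) powr (- 3 / 2)"
  have "(LBINT \<xi>. ft f \<xi> * k \<xi>) = ?c *\<^sub>R (LBINT \<xi>. k \<xi> * (LBINT x. cis (- 1 * (x \<bullet> \<xi>)) * f x))"
    unfolding ft_def by (subst integral_scaleR_right[symmetric]) (simp add: mult_ac)
  also have "\<dots> = ?c *\<^sub>R (LBINT x. f x * (LBINT \<xi>. cis (- 1 * (x \<bullet> \<xi>)) * k \<xi>))"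
    by (simp only: fourier_Fubini[OF f k])
  also have "\<dots> = (LBINT x. f x * ft k x)"
    unfolding ft_def by (subst integral_scaleR_right[symmetric]) (simp add: inner_commute)
  finally show ?thesis .
qed

section \<open>Plancherel's theorem\<close>

abbreviation c3 :: real where "c3 \<equiv> (2 * pi) powr (- 3 / 2)"

lemma c3_mult: "c3 * (2 * pi) powr (3 / 2) = 1"
  by (simp add: powr_add[symmetric])

lemma borel_measurable_cnj [measurable (raw)]:
  "f \<in> borel_measurable M \<Longrightarrow> (\<lambda>x. cnj (f x)) \<in> borel_measurable M"
  by (rule measurable_compose[of f M borel cnj borel])
     (auto intro!: borel_measurable_continuous_onI continuous_intros)

lemma gaussian_real_integral:
  "integrable lborel (\<lambda>z::space. exp (- (norm z)\<^sup>2 / 2))"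
  "(LBINT z. exp (- (norm (z::space))\<^sup>2 / 2)) = (2 * pi) powr (3 / 2)"
proof -
  have i: "integrable lborel (\<lambda>z::space. complex_of_real (exp (- (norm z)\<^sup>2 / 2)))"
    using gaussian_integral(1)[of 0] by simp
  then show "integrable lborel (\<lambda>z::space. exp (- (norm z)\<^sup>2 / 2))"
    using complex_of_real_integrable_eq by blast
  have "(LBINT z. complex_of_real (exp (- (norm (z::space))\<^sup>2 / 2))) = complex_of_real ((2 * pi) powr (3 / 2))"
    using gaussian_integral(2)[of 0] by simp
  then show "(LBINT z. exp (- (norm (z::space))\<^sup>2 / 2)) = (2 * pi) powr (3 / 2)"
    by (simp only: integral_complex_of_real of_real_eq_iff)
qed

text \<open>A damped form of Plancherel. The multiplication formula is applied to the conjugate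
  transform times a Gaussian, which the damping makes integrable. The transform of that product is a
  Gaussian average of translates of the conjugate of f, and the substitution y = x + e z moves the
  width e into the translation.\<close>

lemma ft_gaussian_energy:
  fixes f :: "space \<Rightarrow> complex"
  assumes f1: "integrable lborel f" and f2: "in_Lp 2 f" and e: "0 < e"
  shows "(LBINT \<xi>. ft f \<xi> * (cnj (ft f \<xi>) * complex_of_real (exp (- (e * norm \<xi>)\<^sup>2 / 2))))
     = c3 *\<^sub>R (LBINT z. complex_of_real (exp (- (norm z)\<^sup>2 / 2)) * (LBINT x. f x * cnj (f (x + e *\<^sub>R z))))"
proof -
  have [measurable]: "f \<in> borel_measurable borel" using f1 by auto
  let ?G = "\<lambda>\<xi>::space. complex_of_real (exp (- (e * norm \<xi>)\<^sup>2 / 2))"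
  let ?g = "\<lambda>z::space. complex_of_real (exp (- (norm z)\<^sup>2 / 2))"
  have Gi: "integrable lborel ?G"
    using gaussian_integral_scaled(1)[OF e, of 0] by simp
  have gi: "integrable lborel ?g"
    using gaussian_integral(1)[of 0] by simp
  define B where "B = c3 * (LBINT x. norm (f x))"
  have B: "norm (ft f \<xi>) \<le> B" for \<xi> unfolding B_def by (rule norm_ft_le)
  have k: "integrable lborel (\<lambda>\<xi>. cnj (ft f \<xi>) * ?G \<xi>)"
  proof (rule Bochner_Integration.integrable_bound)
    show "integrable lborel (\<lambda>\<xi>. complex_of_real B * ?G \<xi>)" using Gi by (rule integrable_mult_right)
    have "norm (ft f \<xi>) \<le> \<bar>B\<bar>" for \<xi> using B[of \<xi>] by linarith
    then show "AE x in lborel. norm (cnj (ft f x) * ?G x) \<le> norm (complex_of_real B * ?G x)"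
      by (auto simp: norm_mult mult_right_mono)
  qed measurable
  have fc: "integrable lborel (\<lambda>x. cnj (f x))" using f1 by simp
  have cnjft: "cnj (ft f \<xi>) = c3 *\<^sub>R (LBINT y. cis (1 * (y \<bullet> \<xi>)) * cnj (f y))" for \<xi>
  proof -
    have "cnj (LBINT y. cis (- (y \<bullet> \<xi>)) * f y) = (LBINT y. cnj (cis (- (y \<bullet> \<xi>)) * f y))"
      by (rule Bochner_Integration.integral_cnj[symmetric])
    also have "\<dots> = (LBINT y. cis (1 * (y \<bullet> \<xi>)) * cnj (f y))"
      by (intro Bochner_Integration.integral_cong refl) (simp add: cis_cnj)
    finally show ?thesis unfolding ft_def by simp
  qed
  have inner: "ft (\<lambda>\<xi>. cnj (ft f \<xi>) * ?G \<xi>) x = c3 *\<^sub>R (LBINT z. cnj (f (x + e *\<^sub>R z)) * ?g z)" for x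
  proof -
    have Ki: "integrable lborel (\<lambda>\<xi>. cis (- (\<xi> \<bullet> x)) * ?G \<xi>)" by (intro integrable_cis_mult Gi) measurable
    have "(LBINT \<xi>. cis (- (\<xi> \<bullet> x)) * (cnj (ft f \<xi>) * ?G \<xi>))
       = c3 *\<^sub>R (LBINT \<xi>. (cis (- (\<xi> \<bullet> x)) * ?G \<xi>) * (LBINT y. cis (1 * (y \<bullet> \<xi>)) * cnj (f y)))"
      unfolding cnjft by (subst integral_scaleR_right[symmetric]) (simp add: mult_ac)
    also have "\<dots> = c3 *\<^sub>R (LBINT y. cnj (f y) * (LBINT \<xi>. cis (1 * (y \<bullet> \<xi>)) * (cis (- (\<xi> \<bullet> x)) * ?G \<xi>)))"
      by (simp only: fourier_Fubini[OF fc Ki])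
    also have "(\<lambda>y. LBINT \<xi>. cis (1 * (y \<bullet> \<xi>)) * (cis (- (\<xi> \<bullet> x)) * ?G \<xi>))
       = (\<lambda>y. LBINT \<xi>. cis ((y - x) \<bullet> \<xi>) * ?G \<xi>)"
      by (simp add: mult.assoc[symmetric] cis_mult inner_diff_left inner_commute[of _ x])
    also have "\<dots> = (\<lambda>y. inverse (e^3) *\<^sub>R (e ^ 3 *\<^sub>R (LBINT \<xi>. cis ((y - x) \<bullet> \<xi>) * ?G \<xi>)))"
      using e by simp
    also have "\<dots> = (\<lambda>y. inverse (e^3) *\<^sub>R complex_of_real ((2 * pi) powr (3/2) * exp (- (norm (y - x) / e)\<^sup>2 / 2)))"
      by (simp only: gaussian_integral_scaled(2)[OF e])
    also have "(LBINT y. cnj (f y) * (inverse (e^3) *\<^sub>R complex_of_real ((2 * pi) powr (3/2) * exp (- (norm (y - x) / e)\<^sup>2 / 2))))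
      = (LBINT y. ((2 * pi) powr (3/2) * inverse (e^3)) *\<^sub>R (cnj (f y) * ?g ((y - x) /\<^sub>R e)))"
    proof (intro Bochner_Integration.integral_cong refl)
      fix y
      have "norm ((y - x) /\<^sub>R e) = norm (y - x) / e" using e by (simp add: divide_inverse_commute)
      moreover have "w * (r *\<^sub>R complex_of_real (a * b)) = (a * r) *\<^sub>R (w * complex_of_real b)" for w r a b
        by (simp add: scaleR_conv_of_real)
      ultimately show "cnj (f y) * (inverse (e^3) *\<^sub>R complex_of_real ((2 * pi) powr (3/2) * exp (- (norm (y - x) / e)\<^sup>2 / 2)))
        = ((2 * pi) powr (3/2) * inverse (e^3)) *\<^sub>R (cnj (f y) * ?g ((y - x) /\<^sub>R e))" by (simp only:)
    qed
    also have "\<dots> = ((2 * pi) powr (3/2) * inverse (e^3)) *\<^sub>R (LBINT y. cnj (f y) * ?g ((y - x) /\<^sub>R e))"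
      by (rule integral_scaleR_right)
    also have "(LBINT y. cnj (f y) * ?g ((y - x) /\<^sub>R e)) = e ^ DIM(space) *\<^sub>R (LBINT z. cnj (f (x + e *\<^sub>R z)) * ?g (((x + e *\<^sub>R z) - x) /\<^sub>R e))"
      by (rule lborel_integral_affine(1)[OF _ e]) measurable
    also have "(\<lambda>z. ?g (((x + e *\<^sub>R z) - x) /\<^sub>R e)) = ?g" using e by simp
    finally show ?thesis unfolding ft_def using e c3_mult by (simp add: mult_ac)
  qed
  have "(LBINT \<xi>. ft f \<xi> * (cnj (ft f \<xi>) * ?G \<xi>)) = (LBINT x. f x * (c3 *\<^sub>R (LBINT z. cnj (f (x + e *\<^sub>R z)) * ?g z)))"
    by (subst ft_mult_formula[OF f1 k]) (simp only: inner)
  also have "\<dots> = c3 *\<^sub>R (LBINT x. LBINT z. f x * (cnj (f (x + e *\<^sub>R z)) * ?g z))"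
    by simp
  also have "(LBINT x. LBINT z. f x * (cnj (f (x + e *\<^sub>R z)) * ?g z))
     = (LBINT z. LBINT x. f x * (cnj (f (x + e *\<^sub>R z)) * ?g z))"
  proof (rule lborel_pair.Fubini_integral)
    \<comment> \<open>By Cauchy-Schwarz and translation invariance, the integral of the modulus over
      x is at most the squared L^2 norm of f times the Gaussian in z.\<close>
    have "integrable (lborel \<Otimes>\<^sub>M lborel) (\<lambda>(z, x). f x * (cnj (f (x + e *\<^sub>R z)) * ?g z))"
    proof (rule lborel_pair.Fubini_integrable)
      have ii: "integrable lborel (\<lambda>x. f x * cnj (f (x + e *\<^sub>R z)))" for z
        using in_L2_mult_integrable[OF f2, of "\<lambda>x. cnj (f (x + e *\<^sub>R z))"] in_Lp_translate[OF f2, of "e *\<^sub>R z"]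
        by (simp add: in_Lp_def)
      show "AE z in lborel. integrable lborel (\<lambda>x. case (z, x) of (z, x) \<Rightarrow> f x * (cnj (f (x + e *\<^sub>R z)) * ?g z))"
      proof (rule AE_I2)
        fix z
        show "integrable lborel (\<lambda>x. case (z, x) of (z, x) \<Rightarrow> f x * (cnj (f (x + e *\<^sub>R z)) * ?g z))"
          using integrable_mult_left[OF ii[of z], of "?g z"] by (simp only: prod.case mult.assoc)
      qed
      show "integrable lborel (\<lambda>z. LBINT x. norm (case (z, x) of (z, x) \<Rightarrow> f x * (cnj (f (x + e *\<^sub>R z)) * ?g z)))"
      proof (rule Bochner_Integration.integrable_bound)
        show "integrable lborel (\<lambda>z. (pnorm 2 f * pnorm 2 f) *\<^sub>R ?g z)" using gi by simp
        show "AE z in lborel. norm (LBINT x. norm (case (z, x) of (z, x) \<Rightarrow> f x * (cnj (f (x + e *\<^sub>R z)) * ?g z)))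
           \<le> norm ((pnorm 2 f * pnorm 2 f) *\<^sub>R ?g z)"
        proof (rule AE_I2)
          fix z
          have "(LBINT x. norm (f x * cnj (f (x + e *\<^sub>R z)))) \<le> pnorm 2 f * pnorm 2 (\<lambda>x. cnj (f (x + e *\<^sub>R z)))"
            by (rule L2_Cauchy_Schwarz[OF f2]) (use in_Lp_translate[OF f2, of "e *\<^sub>R z"] in \<open>simp add: in_Lp_def\<close>)
          also have "pnorm 2 (\<lambda>x. cnj (f (x + e *\<^sub>R z))) = pnorm 2 f"
            using pnorm_translate[OF f2, of "e *\<^sub>R z"] by (simp add: pnorm_def)
          finally have "(LBINT x. norm (f x * cnj (f (x + e *\<^sub>R z)))) * exp (- (norm z)\<^sup>2 / 2) \<le> pnorm 2 f * pnorm 2 f * exp (- (norm z)\<^sup>2 / 2)"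
            by (rule mult_right_mono) simp
          moreover have "(LBINT x. norm (case (z, x) of (z, x) \<Rightarrow> f x * (cnj (f (x + e *\<^sub>R z)) * ?g z)))
            = (LBINT x. norm (f x * cnj (f (x + e *\<^sub>R z)))) * exp (- (norm z)\<^sup>2 / 2)"
            by (subst integral_mult_left_zero[symmetric]) (simp add: norm_mult mult_ac)
          ultimately show "norm (LBINT x. norm (case (z, x) of (z, x) \<Rightarrow> f x * (cnj (f (x + e *\<^sub>R z)) * ?g z)))
           \<le> norm ((pnorm 2 f * pnorm 2 f) *\<^sub>R ?g z)" by (simp add: norm_mult)
        qed
      qed measurable
    qed measurable
    then show "integrable (lborel \<Otimes>\<^sub>M lborel) (\<lambda>(z, x). f x * (cnj (f (x + e *\<^sub>R z)) * ?g z))" .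
  qed
  also have "(LBINT z. LBINT x. f x * (cnj (f (x + e *\<^sub>R z)) * ?g z))
     = (LBINT z. ?g z * (LBINT x. f x * cnj (f (x + e *\<^sub>R z))))"
    by (subst integral_mult_right_zero[symmetric]) (simp add: mult_ac)
  finally show ?thesis .
qed

lemma L2_prod_tendsto:
  fixes f g :: "'a::euclidean_space \<Rightarrow> complex"
  assumes fn: "\<And>n. in_Lp 2 (fn n)" and gn: "\<And>n. in_Lp 2 (gn n)" and f: "in_Lp 2 f" and g: "in_Lp 2 g"
    and "((\<lambda>n. pnorm 2 (\<lambda>x. fn n x - f x)) \<longlongrightarrow> 0) F" "((\<lambda>n. pnorm 2 (\<lambda>x. gn n x - g x)) \<longlongrightarrow> 0) F"
  shows "((\<lambda>n. LBINT x. fn n x * gn n x) \<longlongrightarrow> (LBINT x. f x * g x)) F"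
proof (rule LIM_zero_cancel, rule tendsto_norm_zero_cancel)
  have "((\<lambda>n. pnorm 2 (\<lambda>x. fn n x - f x) * pnorm 2 (gn n) + pnorm 2 f * pnorm 2 (\<lambda>x. gn n x - g x)) \<longlongrightarrow> 0 * pnorm 2 g + pnorm 2 f * 0) F"
    by (intro tendsto_intros pnorm_tendsto assms) auto
  then have lim: "((\<lambda>n. pnorm 2 (\<lambda>x. fn n x - f x) * pnorm 2 (gn n) + pnorm 2 f * pnorm 2 (\<lambda>x. gn n x - g x)) \<longlongrightarrow> 0) F" by simp
  show "((\<lambda>n. norm ((LBINT x. fn n x * gn n x) - (LBINT x. f x * g x))) \<longlongrightarrow> 0) F"
  proof (rule tendsto_sandwich[OF _ _ tendsto_const lim])
    show "\<forall>\<^sub>F n in F. norm ((LBINT x. fn n x * gn n x) - (LBINT x. f x * g x))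
       \<le> pnorm 2 (\<lambda>x. fn n x - f x) * pnorm 2 (gn n) + pnorm 2 f * pnorm 2 (\<lambda>x. gn n x - g x)"
    proof (intro always_eventually allI)
      fix n
      note i = in_L2_mult_integrable[OF in_Lp_diff[OF fn f] gn, of n n] in_L2_mult_integrable[OF f in_Lp_diff[OF gn g], of n]
        in_L2_mult_integrable[OF fn gn, of n n] in_L2_mult_integrable[OF f g]
      have "(LBINT x. fn n x * gn n x) - (LBINT x. f x * g x)
        = (LBINT x. (fn n x - f x) * gn n x) + (LBINT x. f x * (gn n x - g x))"
        unfolding Bochner_Integration.integral_diff[OF i(3,4), symmetric] Bochner_Integration.integral_add[OF i(1,2), symmetric]
        by (intro Bochner_Integration.integral_cong) (auto simp: algebra_simps)
      then show "norm ((LBINT x. fn n x * gn n x) - (LBINT x. f x * g x))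
       \<le> pnorm 2 (\<lambda>x. fn n x - f x) * pnorm 2 (gn n) + pnorm 2 f * pnorm 2 (\<lambda>x. gn n x - g x)"
        using L2_Cauchy_Schwarz_integral[OF in_Lp_diff[OF fn f] gn, of n n] L2_Cauchy_Schwarz_integral[OF f in_Lp_diff[OF gn g], of n]
        by (smt (verit) norm_triangle_ineq)
    qed
  qed auto
qed

lemma in_Lp_cnj: "in_Lp p f \<Longrightarrow> in_Lp p (\<lambda>x. cnj (f x))"
  by (auto simp: in_Lp_def)

lemma pnorm_cnj: "pnorm p (\<lambda>x. cnj (f x)) = pnorm p f"
  by (simp add: pnorm_def)

text \<open>The right side of the damped identity converges because translations are continuous in
  L^2. Fatou first gives square integrability of the transform; only then can the transform itself
  dominate the damped ones and identify the norm.\<close>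

lemma plancherel_L1_L2:
  fixes f :: "space \<Rightarrow> complex"
  assumes f1: "integrable lborel f" and f2: "in_Lp 2 f"
  shows "in_Lp 2 (ft f)" "pnorm 2 (ft f) = pnorm 2 f"
proof -
  have [measurable]: "f \<in> borel_measurable borel" using f1 by auto
  define e :: "nat \<Rightarrow> real" where "e n = 1 / real (Suc n)" for n
  have e: "0 < e n" for n by (simp add: e_def)
  have e0: "e \<longlonglongrightarrow> 0" unfolding e_def by (rule LIMSEQ_Suc[OF lim_1_over_n])
  \<comment> \<open>\<open>h\<close> carries the square root of the Gaussian, hence 4 in place of 2,
    so that its squared modulus is the damped integrand.\<close>
  define h where "h n \<xi> = complex_of_real (exp (- (e n * norm \<xi>)\<^sup>2 / 4)) * ft f \<xi>" for n and \<xi> :: space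
  have [measurable]: "h n \<in> borel_measurable borel" for n unfolding h_def by measurable
  define J where "J n = c3 *\<^sub>R (LBINT z. complex_of_real (exp (- (norm z)\<^sup>2 / 2)) * (LBINT x. f x * cnj (f (x + e n *\<^sub>R z))))" for n
  let ?g = "\<lambda>z::space. complex_of_real (exp (- (norm z)\<^sup>2 / 2))"
  have gi: "integrable lborel ?g"
    using gaussian_integral(1)[of 0] by simp
  have sq: "ft f \<xi> * (cnj (ft f \<xi>) * complex_of_real (exp (- (e n * norm \<xi>)\<^sup>2 / 2))) = complex_of_real (norm (h n \<xi>) ^ 2)" for n \<xi>
  proof -
    have "exp (- (e n * norm \<xi>)\<^sup>2 / 2) = (exp (- (e n * norm \<xi>)\<^sup>2 / 4))\<^sup>2"
      by (simp add: exp_double[symmetric] power2_eq_square flip: exp_add)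
    then show ?thesis
      by (simp add: h_def norm_mult power_mult_distrib complex_norm_square mult_ac del: of_real_power flip: of_real_power)
  qed
  have hL: "in_Lp 2 (h n)" for n
  proof (rule in_LpI)
    define B where "B = c3 * (LBINT x. norm (f x))"
    have B: "norm (ft f \<xi>) \<le> B" for \<xi> unfolding B_def by (rule norm_ft_le)
    have Gi: "integrable lborel (\<lambda>\<xi>::space. complex_of_real (exp (- (e n * norm \<xi>)\<^sup>2 / 2)))"
      using gaussian_integral_scaled(1)[OF e[of n], of 0] by simp
    show "integrable lborel (\<lambda>\<xi>. norm (h n \<xi>) ^ 2)"
    proof (rule Bochner_Integration.integrable_bound)
      show "integrable lborel (\<lambda>\<xi>::space. B^2 *\<^sub>R complex_of_real (exp (- (e n * norm \<xi>)\<^sup>2 / 2)))"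
        using Gi by (rule integrable_scaleR_right)
      show "AE \<xi> in lborel. norm (norm (h n \<xi>) ^ 2) \<le> norm (B^2 *\<^sub>R complex_of_real (exp (- (e n * norm \<xi>)\<^sup>2 / 2)))"
      proof (rule AE_I2)
        fix \<xi> :: space
        have "norm (norm (h n \<xi>) ^ 2) = norm (complex_of_real (norm (h n \<xi>) ^ 2))" by (simp add: norm_power)
        also have "\<dots> = norm (ft f \<xi>) ^ 2 * exp (- (e n * norm \<xi>)\<^sup>2 / 2)"
          unfolding sq[symmetric] by (simp add: norm_mult power2_eq_square)
        also have "\<dots> \<le> B^2 * exp (- (e n * norm \<xi>)\<^sup>2 / 2)"
          by (intro mult_right_mono power_mono B) auto
        finally show "norm (norm (h n \<xi>) ^ 2) \<le> norm (B^2 *\<^sub>R complex_of_real (exp (- (e n * norm \<xi>)\<^sup>2 / 2)))"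
          by (simp add: norm_mult)
      qed
    qed measurable
  qed measurable
  have hJ: "complex_of_real (pnorm 2 (h n) ^ 2) = J n" for n
    unfolding J_def ft_gaussian_energy[OF f1 f2 e, symmetric] sq by (simp add: pnorm_power del: of_real_power)
  have "J \<longlonglongrightarrow> c3 *\<^sub>R (LBINT z. ?g z * complex_of_real (pnorm 2 f ^ 2))"
    unfolding J_def
  proof (rule tendsto_scaleR[OF tendsto_const], rule integral_dominated_convergence[where w="\<lambda>z. exp (- (norm z)\<^sup>2 / 2) * (pnorm 2 f * pnorm 2 f)"])
    show "AE z in lborel. (\<lambda>n. ?g z * (LBINT x. f x * cnj (f (x + e n *\<^sub>R z)))) \<longlonglongrightarrow> ?g z * complex_of_real (pnorm 2 f ^ 2)"
    proof (rule AE_I2)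
      fix z :: space
      have "(\<lambda>n. LBINT x. f x * cnj (f (x + e n *\<^sub>R z))) \<longlonglongrightarrow> (LBINT x. f x * cnj (f x))"
      proof (rule L2_prod_tendsto)
        have "(\<lambda>n. e n *\<^sub>R z) \<longlonglongrightarrow> 0 *\<^sub>R z" by (intro tendsto_intros e0)
        then have "(\<lambda>n. pnorm 2 (\<lambda>x. f (x + e n *\<^sub>R z) - f x)) \<longlonglongrightarrow> 0"
          by (intro translation_continuous_L2 f2) simp
        then show "(\<lambda>n. pnorm 2 (\<lambda>x. cnj (f (x + e n *\<^sub>R z)) - cnj (f x))) \<longlonglongrightarrow> 0"
          by (simp add: pnorm_cnj flip: complex_cnj_diff)
      qed (use f2 in_Lp_translate[OF f2] in \<open>auto intro: in_Lp_cnj\<close>)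
      also have "(LBINT x. f x * cnj (f x)) = complex_of_real (pnorm 2 f ^ 2)"
        by (simp add: pnorm_power complex_norm_square[symmetric] del: of_real_power flip: of_real_power)
      finally show "(\<lambda>n. ?g z * (LBINT x. f x * cnj (f (x + e n *\<^sub>R z)))) \<longlonglongrightarrow> ?g z * complex_of_real (pnorm 2 f ^ 2)"
        by (intro tendsto_intros)
    qed
    show "AE z in lborel. norm (?g z * (LBINT x. f x * cnj (f (x + e n *\<^sub>R z)))) \<le> exp (- (norm z)\<^sup>2 / 2) * (pnorm 2 f * pnorm 2 f)" for n
    proof (rule AE_I2)
      fix z :: space
      have "norm (LBINT x. f x * cnj (f (x + e n *\<^sub>R z))) \<le> pnorm 2 f * pnorm 2 (\<lambda>x. cnj (f (x + e n *\<^sub>R z)))"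
        by (intro L2_Cauchy_Schwarz_integral f2 in_Lp_cnj in_Lp_translate)
      then show "norm (?g z * (LBINT x. f x * cnj (f (x + e n *\<^sub>R z)))) \<le> exp (- (norm z)\<^sup>2 / 2) * (pnorm 2 f * pnorm 2 f)"
        by (simp add: norm_mult pnorm_cnj pnorm_translate[OF f2])
    qed
    show "integrable lborel (\<lambda>z::space. exp (- (norm z)\<^sup>2 / 2) * (pnorm 2 f * pnorm 2 f))"
      using gaussian_real_integral(1) by (rule integrable_mult_left)
  qed measurable
  also have "c3 *\<^sub>R (LBINT z. ?g z * complex_of_real (pnorm 2 f ^ 2)) = complex_of_real (c3 * ((2 * pi) powr (3 / 2)) * pnorm 2 f ^ 2)"
    using gaussian_real_integral(2) by (simp add: scaleR_conv_of_real del: of_real_power)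
  also have "\<dots> = complex_of_real (pnorm 2 f ^ 2)" by (simp only: c3_mult mult_1)
  finally have "(\<lambda>n. pnorm 2 (h n) ^ 2) \<longlonglongrightarrow> pnorm 2 f ^ 2"
    unfolding hJ[symmetric, abs_def] tendsto_of_real_iff .
  from tendsto_real_sqrt[OF this] have hlim: "(\<lambda>n. pnorm 2 (h n)) \<longlonglongrightarrow> pnorm 2 f" by simp
  have hpt: "(\<lambda>n. h n \<xi>) \<longlonglongrightarrow> ft f \<xi>" for \<xi>
  proof -
    have "(\<lambda>n. h n \<xi>) \<longlonglongrightarrow> complex_of_real (exp (- (0 * norm \<xi>)\<^sup>2 / 4)) * ft f \<xi>"
      unfolding h_def by (intro tendsto_intros e0) auto
    then show ?thesis by simp
  qed
  have ev: "\<forall>\<^sub>F n in sequentially. pnorm 2 (h n) \<le> pnorm 2 f + 1"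
    using order_tendstoD(2)[OF hlim, of "pnorm 2 f + 1"] by (auto elim: eventually_mono)
  show L: "in_Lp 2 (ft f)"
    by (rule pnorm_Fatou(1)[OF hL _ _ _ ev]) (use hpt in auto)
  have "(\<lambda>n. pnorm 2 (\<lambda>\<xi>. h n \<xi> - ft f \<xi>)) \<longlonglongrightarrow> 0"
  proof (rule pnorm_dominated[OF L])
    show "AE \<xi> in lborel. (\<lambda>n. h n \<xi> - ft f \<xi>) \<longlonglongrightarrow> 0"
      using hpt by (intro AE_I2) (simp add: LIM_zero)
    show "AE \<xi> in lborel. norm (h n \<xi> - ft f \<xi>) \<le> norm (ft f \<xi>)" for n
    proof (rule AE_I2)
      fix \<xi>
      have "h n \<xi> - ft f \<xi> = complex_of_real (exp (- (e n * norm \<xi>)\<^sup>2 / 4) - 1) * ft f \<xi>"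
        by (simp add: h_def algebra_simps)
      moreover have "\<bar>exp (- (e n * norm \<xi>)\<^sup>2 / 4) - 1\<bar> \<le> 1" by (auto simp: abs_le_iff)
      ultimately show "norm (h n \<xi> - ft f \<xi>) \<le> norm (ft f \<xi>)"
        by (simp only: norm_mult norm_of_real) (simp add: mult_left_le_one_le)
    qed
  qed auto
  from pnorm_tendsto[OF hL L _ this] hlim
  show "pnorm 2 (ft f) = pnorm 2 f" by (auto intro: LIMSEQ_unique)
qed

section \<open>The Fourier transform on square integrable functions\<close>

definition cutoff :: "real \<Rightarrow> (space \<Rightarrow> complex) \<Rightarrow> space \<Rightarrow> complex" where
  "cutoff R f x = indicator (cball 0 R) x *\<^sub>R f x"

lemma truncated_fourier_cutoff: "truncated_fourier R f = ft (cutoff R f)"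
  by (simp add: truncated_fourier_eq cutoff_def[abs_def])

lemma in_Lp_cutoff: "in_Lp p f \<Longrightarrow> in_Lp p (cutoff R f)"
  unfolding cutoff_def[abs_def] by (rule in_Lp_restrict) auto

lemma integrable_cutoff:
  assumes f: "in_Lp 2 f" shows "integrable lborel (cutoff R f)"
proof -
  have [measurable]: "cball (0::space) R \<in> sets borel" by simp
  have i: "integrable lborel (\<lambda>x::space. indicator (cball 0 R) x :: real)"
    using emeasure_bounded_finite[of "cball (0::space) R"] by (intro integrable_real_indicator) auto
  have "in_Lp 2 (\<lambda>x::space. indicator (cball 0 R) x :: complex)"
  proof (rule in_LpI)
    have "(\<lambda>x::space. norm (indicator (cball 0 R) x :: complex) ^ 2) = (\<lambda>x. indicator (cball 0 R) x)"
      by (auto simp: indicator_def)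
    then show "integrable lborel (\<lambda>x::space. norm (indicator (cball 0 R) x :: complex) ^ 2)" using i by simp
  qed measurable
  from in_L2_mult_integrable[OF this f]
  show ?thesis unfolding cutoff_def[abs_def]
    by (rule Bochner_Integration.integrable_cong[THEN iffD1, rotated 2]) (auto simp: indicator_def)
qed

lemma cutoff_tendsto:
  assumes f: "in_Lp p f" and p: "0 < p"
  shows "((\<lambda>R. pnorm p (\<lambda>x. cutoff R f x - f x)) \<longlongrightarrow> 0) at_top"
proof (rule tendsto_at_topI_sequentially)
  fix X :: "nat \<Rightarrow> real" assume X: "filterlim X at_top sequentially"
  show "(\<lambda>n. pnorm p (\<lambda>x. cutoff (X n) f x - f x)) \<longlonglongrightarrow> 0"
  proof (rule pnorm_dominated[OF f])
    show "(\<lambda>x. cutoff (X n) f x - f x) \<in> borel_measurable borel" for n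
      using in_Lp_diff[OF in_Lp_cutoff[OF f] f] by auto
    show "AE x in lborel. (\<lambda>n. cutoff (X n) f x - f x) \<longlonglongrightarrow> 0"
    proof (rule AE_I2, rule tendsto_eventually)
      fix x :: space
      have "\<forall>\<^sub>F n in sequentially. norm x \<le> X n" using X by (simp add: filterlim_at_top)
      then show "\<forall>\<^sub>F n in sequentially. cutoff (X n) f x - f x = 0"
        by eventually_elim (simp add: cutoff_def)
    qed
  qed (use p in \<open>auto simp: cutoff_def indicator_def\<close>)
qed

lemma nn_integral_pnorm2:
  assumes "in_Lp 2 f"
  shows "(\<integral>\<^sup>+ x. ennreal ((norm (f x))\<^sup>2) \<partial>lborel) = ennreal (pnorm 2 f ^ 2)"
  using assms by (subst nn_integral_eq_integral) (auto simp: pnorm_power)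

lemma in_Lp_ft_cutoff: "in_Lp 2 f \<Longrightarrow> in_Lp 2 (ft (cutoff R f))"
  by (intro plancherel_L1_L2 integrable_cutoff in_Lp_cutoff)

lemma is_fourier_iff:
  assumes f: "in_Lp 2 f"
  shows "is_fourier f g \<longleftrightarrow> in_Lp 2 g \<and> ((\<lambda>R. pnorm 2 (\<lambda>\<xi>. ft (cutoff R f) \<xi> - g \<xi>)) \<longlongrightarrow> 0) at_top"
proof (cases "in_Lp 2 g")
  case True
  have eq: "(\<integral>\<^sup>+ \<xi>. ennreal ((norm (g \<xi> - truncated_fourier R f \<xi>))\<^sup>2) \<partial>lborel)
     = ennreal (pnorm 2 (\<lambda>\<xi>. ft (cutoff R f) \<xi> - g \<xi>) ^ 2)" for R
    by (subst nn_integral_pnorm2) (auto intro!: in_Lp_diff True in_Lp_ft_cutoff f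
        simp: truncated_fourier_cutoff pnorm_minus_commute[of 2 g])
  have "((\<lambda>R. ennreal (pnorm 2 (\<lambda>\<xi>. ft (cutoff R f) \<xi> - g \<xi>) ^ 2)) \<longlongrightarrow> ennreal 0) at_top
     \<longleftrightarrow> ((\<lambda>R. pnorm 2 (\<lambda>\<xi>. ft (cutoff R f) \<xi> - g \<xi>) ^ 2) \<longlongrightarrow> 0) at_top"
    by (rule tendsto_ennreal_iff) auto
  also have "\<dots> \<longleftrightarrow> ((\<lambda>R. pnorm 2 (\<lambda>\<xi>. ft (cutoff R f) \<xi> - g \<xi>)) \<longlongrightarrow> 0) at_top"
    using tendsto_real_sqrt[of "\<lambda>R. pnorm 2 (\<lambda>\<xi>. ft (cutoff R f) \<xi> - g \<xi>) ^ 2" 0 at_top]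
      tendsto_power[of "\<lambda>R. pnorm 2 (\<lambda>\<xi>. ft (cutoff R f) \<xi> - g \<xi>)" 0 at_top 2] by auto
  finally show ?thesis unfolding is_fourier_def in_L2_iff eq using True by simp
qed (auto simp: is_fourier_def in_L2_iff)

lemma pnorm_ft_diff:
  assumes "integrable lborel f" "in_Lp 2 f" "integrable lborel g" "in_Lp 2 g"
  shows "pnorm 2 (\<lambda>\<xi>. ft f \<xi> - ft g \<xi>) = pnorm 2 (\<lambda>x. f x - g x)"
  using plancherel_L1_L2(2)[of "\<lambda>x. f x - g x"] assms
  by (simp add: ft_diff[OF assms(1,3), abs_def] in_Lp_diff)

text \<open>By Plancherel the transforms of the truncations form a Cauchy family, and L^2 is
  complete.\<close>

lemma fourier_exists:
  assumes f: "in_Lp 2 f"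
  shows "\<exists>g. is_fourier f g"
proof -
  let ?d = "\<lambda>R. pnorm 2 (\<lambda>x. cutoff R f x - f x)"
  have d0: "(?d \<longlongrightarrow> 0) at_top" by (rule cutoff_tendsto[OF f]) simp
  have dist: "pnorm 2 (\<lambda>\<xi>. ft (cutoff R f) \<xi> - ft (cutoff S f) \<xi>) \<le> ?d R + ?d S" for R S
    using pnorm_triangle3[OF in_Lp_cutoff[OF f] f in_Lp_cutoff[OF f], of R S]
    by (simp add: pnorm_ft_diff in_Lp_cutoff integrable_cutoff f pnorm_minus_commute[of 2 f])
  have dn: "(\<lambda>n. ?d (real n)) \<longlonglongrightarrow> 0" by (rule filterlim_compose[OF d0 filterlim_real_sequentially])
  have "\<exists>g. in_Lp 2 g \<and> (\<lambda>n. pnorm 2 (\<lambda>\<xi>. ft (cutoff (real n) f) \<xi> - g \<xi>)) \<longlonglongrightarrow> 0"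
  proof (rule L2_complete)
    fix e :: real assume e: "0 < e"
    from LIMSEQ_D[OF dn, of "e/2"] e obtain N where N: "\<And>n. n \<ge> N \<Longrightarrow> ?d (real n) < e / 2" by auto
    show "\<exists>N. \<forall>m\<ge>N. \<forall>n\<ge>N. pnorm 2 (\<lambda>\<xi>. ft (cutoff (real m) f) \<xi> - ft (cutoff (real n) f) \<xi>) \<le> e"
    proof (intro exI[of _ N] allI impI)
      fix m n assume "N \<le> m" "N \<le> n"
      with N[of m] N[of n] dist[of "real m" "real n"]
      show "pnorm 2 (\<lambda>\<xi>. ft (cutoff (real m) f) \<xi> - ft (cutoff (real n) f) \<xi>) \<le> e" by linarith
    qed
  qed (rule in_Lp_ft_cutoff[OF f])
  then obtain g where g: "in_Lp 2 g" "(\<lambda>n. pnorm 2 (\<lambda>\<xi>. ft (cutoff (real n) f) \<xi> - g \<xi>)) \<longlonglongrightarrow> 0" by auto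
  \<comment> \<open>Completeness gave a limit along integer radii; letting n tend to infinity in the
    distance between radii R and n covers all real radii.\<close>
  have "pnorm 2 (\<lambda>\<xi>. ft (cutoff R f) \<xi> - g \<xi>) \<le> ?d R" for R
  proof (rule tendsto_le[OF sequentially_bot])
    have "(\<lambda>n. ?d R + ?d (real n) + pnorm 2 (\<lambda>\<xi>. ft (cutoff (real n) f) \<xi> - g \<xi>)) \<longlonglongrightarrow> ?d R + 0 + 0"
      by (intro tendsto_intros dn g)
    then show "(\<lambda>n. ?d R + ?d (real n) + pnorm 2 (\<lambda>\<xi>. ft (cutoff (real n) f) \<xi> - g \<xi>)) \<longlonglongrightarrow> ?d R" by simp
    show "\<forall>\<^sub>F n in sequentially. pnorm 2 (\<lambda>\<xi>. ft (cutoff R f) \<xi> - g \<xi>) \<le> ?d R + ?d (real n) + pnorm 2 (\<lambda>\<xi>. ft (cutoff (real n) f) \<xi> - g \<xi>)"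
    proof (intro always_eventually allI)
      fix n
      show "pnorm 2 (\<lambda>\<xi>. ft (cutoff R f) \<xi> - g \<xi>) \<le> ?d R + ?d (real n) + pnorm 2 (\<lambda>\<xi>. ft (cutoff (real n) f) \<xi> - g \<xi>)"
        using pnorm_triangle3[OF in_Lp_ft_cutoff[OF f] in_Lp_ft_cutoff[OF f] g(1), of R "real n"] dist[of R "real n"]
        by linarith
    qed
  qed (rule tendsto_const)
  then have "((\<lambda>R. pnorm 2 (\<lambda>\<xi>. ft (cutoff R f) \<xi> - g \<xi>)) \<longlongrightarrow> 0) at_top"
    by (intro tendsto_sandwich[OF _ _ tendsto_const d0]) auto
  with g(1) show ?thesis unfolding is_fourier_iff[OF f] by blast
qed

lemma is_fourier_fourier: "in_Lp 2 f \<Longrightarrow> is_fourier f (fourier f)"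
  unfolding fourier_def by (rule someI_ex[OF fourier_exists])

lemma in_Lp_fourier: "in_Lp 2 f \<Longrightarrow> in_Lp 2 (fourier f)"
  using is_fourier_fourier is_fourier_iff by blast

lemma fourier_tendsto:
  "in_Lp 2 f \<Longrightarrow> ((\<lambda>R. pnorm 2 (\<lambda>\<xi>. ft (cutoff R f) \<xi> - fourier f \<xi>)) \<longlongrightarrow> 0) at_top"
  using is_fourier_fourier is_fourier_iff by blast

lemma pnorm_tendsto_diff:
  assumes "\<And>n. in_Lp p (f n)" "in_Lp p f'" "\<And>n. in_Lp p (g n)" "in_Lp p g'" "0 < p"
    "((\<lambda>n. pnorm p (\<lambda>x. f n x - f' x)) \<longlongrightarrow> 0) F" "((\<lambda>n. pnorm p (\<lambda>x. g n x - g' x)) \<longlongrightarrow> 0) F"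
  shows "((\<lambda>n. pnorm p (\<lambda>x. (f n x - g n x) - (f' x - g' x))) \<longlongrightarrow> 0) F"
proof (rule tendsto_sandwich[OF _ _ tendsto_const])
  show "((\<lambda>n. pnorm p (\<lambda>x. f n x - f' x) + pnorm p (\<lambda>x. g n x - g' x)) \<longlongrightarrow> 0) F"
    using tendsto_add[OF assms(6,7)] by simp
  show "\<forall>\<^sub>F n in F. pnorm p (\<lambda>x. f n x - g n x - (f' x - g' x)) \<le> pnorm p (\<lambda>x. f n x - f' x) + pnorm p (\<lambda>x. g n x - g' x)"
  proof (intro always_eventually allI)
    fix n
    have "pnorm p (\<lambda>x. (f n x - f' x) - (g n x - g' x)) \<le> pnorm p (\<lambda>x. f n x - f' x) + pnorm p (\<lambda>x. g n x - g' x)"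
      by (intro pnorm_triangle_diff in_Lp_diff assms)
    moreover have "(\<lambda>x. (f n x - f' x) - (g n x - g' x)) = (\<lambda>x. f n x - g n x - (f' x - g' x))" by (simp add: algebra_simps)
    ultimately show "pnorm p (\<lambda>x. f n x - g n x - (f' x - g' x)) \<le> pnorm p (\<lambda>x. f n x - f' x) + pnorm p (\<lambda>x. g n x - g' x)" by simp
  qed
qed auto

text \<open>With an integrable function on one side, this isometry shows that any L^2 approximation
  by functions in L^1 and L^2, not just truncation to balls, computes \<open>fourier\<close>, and
  that \<open>fourier\<close> agrees with \<open>ft\<close> on such functions.\<close>

lemma plancherel_ft_fourier:
  assumes h1: "integrable lborel h" and h2: "in_Lp 2 h" and f: "in_Lp 2 f"
  shows "pnorm 2 (\<lambda>\<xi>. ft h \<xi> - fourier f \<xi>) = pnorm 2 (\<lambda>x. h x - f x)"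
proof (rule tendsto_unique[of at_top])
  note L = plancherel_L1_L2[OF h1 h2] in_Lp_ft_cutoff[OF f] in_Lp_fourier[OF f] in_Lp_cutoff[OF f]
  show "((\<lambda>R. pnorm 2 (\<lambda>\<xi>. ft h \<xi> - ft (cutoff R f) \<xi>)) \<longlongrightarrow> pnorm 2 (\<lambda>\<xi>. ft h \<xi> - fourier f \<xi>)) at_top"
    by (rule pnorm_tendsto) (use fourier_tendsto[OF f] in \<open>auto intro!: in_Lp_diff L simp: pnorm_minus_commute[of 2 "fourier f"]\<close>)
  show "((\<lambda>R. pnorm 2 (\<lambda>\<xi>. ft h \<xi> - ft (cutoff R f) \<xi>)) \<longlongrightarrow> pnorm 2 (\<lambda>x. h x - f x)) at_top"
    unfolding pnorm_ft_diff[OF h1 h2 integrable_cutoff[OF f] in_Lp_cutoff[OF f]]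
    by (rule pnorm_tendsto) (use cutoff_tendsto[OF f] in \<open>auto intro!: in_Lp_diff L h2 f simp: pnorm_minus_commute[of 2 f]\<close>)
qed auto

lemma fourier_approx:
  assumes "\<And>n. integrable lborel (h n)" "\<And>n. in_Lp 2 (h n)" "in_Lp 2 f"
    "((\<lambda>n. pnorm 2 (\<lambda>x. h n x - f x)) \<longlongrightarrow> 0) F"
  shows "((\<lambda>n. pnorm 2 (\<lambda>\<xi>. ft (h n) \<xi> - fourier f \<xi>)) \<longlongrightarrow> 0) F"
  using assms(4) by (simp add: plancherel_ft_fourier assms)

lemma fourier_eq_ft:
  assumes h1: "integrable lborel h" and h2: "in_Lp 2 h"
  shows "AE \<xi> in lborel. fourier h \<xi> = ft h \<xi>"
  using pnorm_eq_0D[of 2 "\<lambda>\<xi>. ft h \<xi> - fourier h \<xi>"] plancherel_ft_fourier[OF h1 h2 h2]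
    plancherel_L1_L2[OF h1 h2] in_Lp_fourier[OF h2]
  by (auto simp: in_Lp_diff)

text \<open>Only almost everywhere: \<open>fourier\<close> picks its representative separately for
  each of the three arguments.\<close>

lemma fourier_diff:
  assumes f: "in_Lp 2 f" and g: "in_Lp 2 g"
  shows "AE \<xi> in lborel. fourier (\<lambda>x. f x - g x) \<xi> = fourier f \<xi> - fourier g \<xi>"
proof (rule pnorm_lim_unique)
  let ?h = "\<lambda>R x. cutoff R f x - cutoff R g x"
  have h: "integrable lborel (?h R)" "in_Lp 2 (?h R)" for R
    by (auto intro!: in_Lp_diff in_Lp_cutoff integrable_cutoff f g)
  show "((\<lambda>R. pnorm 2 (\<lambda>\<xi>. ft (?h R) \<xi> - fourier (\<lambda>x. f x - g x) \<xi>)) \<longlongrightarrow> 0) at_top"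
    by (intro fourier_approx h in_Lp_diff f g pnorm_tendsto_diff in_Lp_cutoff cutoff_tendsto) auto
  show "((\<lambda>R. pnorm 2 (\<lambda>\<xi>. ft (?h R) \<xi> - (fourier f \<xi> - fourier g \<xi>))) \<longlongrightarrow> 0) at_top"
    unfolding ft_diff[OF integrable_cutoff[OF f] integrable_cutoff[OF g]]
    by (intro pnorm_tendsto_diff in_Lp_ft_cutoff in_Lp_fourier fourier_tendsto f g) auto
  show "in_Lp 2 (ft (?h R))" for R by (intro plancherel_L1_L2 h)
qed (auto intro!: in_Lp_diff in_Lp_fourier f g)

lemma plancherel:
  assumes f: "in_Lp 2 f"
  shows "pnorm 2 (fourier f) = pnorm 2 f"
proof (rule tendsto_unique[of at_top])
  show "((\<lambda>R. pnorm 2 (ft (cutoff R f))) \<longlongrightarrow> pnorm 2 (fourier f)) at_top"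
    by (rule pnorm_tendsto) (auto intro!: in_Lp_ft_cutoff in_Lp_fourier fourier_tendsto f)
  show "((\<lambda>R. pnorm 2 (ft (cutoff R f))) \<longlongrightarrow> pnorm 2 f) at_top"
    unfolding plancherel_L1_L2(2)[OF integrable_cutoff[OF f] in_Lp_cutoff[OF f]]
    by (rule pnorm_tendsto) (auto intro!: in_Lp_cutoff cutoff_tendsto f)
qed auto

lemma fourier_mult_formula:
  assumes f: "in_Lp 2 f" and g: "in_Lp 2 g"
  shows "(LBINT \<xi>. fourier f \<xi> * g \<xi>) = (LBINT x. f x * fourier g x)"
proof (rule tendsto_unique[of at_top])
  show "((\<lambda>R. LBINT \<xi>. ft (cutoff R f) \<xi> * cutoff R g \<xi>) \<longlongrightarrow> (LBINT \<xi>. fourier f \<xi> * g \<xi>)) at_top"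
    by (rule L2_prod_tendsto) (auto intro!: in_Lp_ft_cutoff in_Lp_fourier fourier_tendsto f g in_Lp_cutoff cutoff_tendsto)
  have eq: "(LBINT \<xi>. ft (cutoff R f) \<xi> * cutoff R g \<xi>) = (LBINT x. cutoff R f x * ft (cutoff R g) x)" for R
    by (rule ft_mult_formula) (intro integrable_cutoff f g)+
  show "((\<lambda>R. LBINT \<xi>. ft (cutoff R f) \<xi> * cutoff R g \<xi>) \<longlongrightarrow> (LBINT x. f x * fourier g x)) at_top"
    unfolding eq
    by (rule L2_prod_tendsto) (auto intro!: in_Lp_ft_cutoff in_Lp_fourier fourier_tendsto f g in_Lp_cutoff cutoff_tendsto)
qed auto

lemma cutoff_reflect: "cutoff R (\<lambda>x. f (- x)) = (\<lambda>x. cutoff R f (- x))"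
  by (rule ext) (auto simp: cutoff_def indicator_def)

lemma ft_reflect:
  assumes [measurable]: "f \<in> borel_measurable borel"
  shows "ft (\<lambda>x. f (- x)) \<xi> = ft f (- \<xi>)"
  using lborel_integral_uminus(1)[of "\<lambda>x. cis (- (x \<bullet> - \<xi>)) * f x"] by (simp add: ft_def)

lemma fourier_reflect:
  assumes f: "in_Lp 2 f"
  shows "AE \<xi> in lborel. fourier (\<lambda>x. f (- x)) \<xi> = fourier f (- \<xi>)"
proof (rule pnorm_lim_unique)
  note r = in_Lp_reflect[OF f]
  show "((\<lambda>R. pnorm 2 (\<lambda>\<xi>. ft (cutoff R (\<lambda>x. f (- x))) \<xi> - fourier (\<lambda>x. f (- x)) \<xi>)) \<longlongrightarrow> 0) at_top"
    by (rule fourier_tendsto[OF r])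
  have "pnorm 2 (\<lambda>\<xi>. ft (cutoff R (\<lambda>x. f (- x))) \<xi> - fourier f (- \<xi>)) = pnorm 2 (\<lambda>\<xi>. ft (cutoff R f) \<xi> - fourier f \<xi>)" for R
    using pnorm_reflect[OF in_Lp_diff[OF in_Lp_ft_cutoff[OF f] in_Lp_fourier[OF f]], of R]
      ft_reflect[of "cutoff R f"] in_Lp_cutoff[OF f, of R]
    by (auto simp: cutoff_reflect)
  then show "((\<lambda>R. pnorm 2 (\<lambda>\<xi>. ft (cutoff R (\<lambda>x. f (- x))) \<xi> - fourier f (- \<xi>))) \<longlongrightarrow> 0) at_top"
    using fourier_tendsto[OF f] by simp
  show "in_Lp 2 (ft (cutoff R (\<lambda>x. f (- x))))" for R by (rule in_Lp_ft_cutoff[OF r])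
qed (auto intro!: in_Lp_fourier in_Lp_reflect f)

lemma ft_cnj: "ft (\<lambda>x. cnj (f x)) \<xi> = cnj (ft f (- \<xi>))"
proof -
  have "cnj (LBINT x. cis (- (x \<bullet> - \<xi>)) * f x) = (LBINT x. cnj (cis (- (x \<bullet> - \<xi>)) * f x))"
    by (rule Bochner_Integration.integral_cnj[symmetric])
  then show ?thesis by (simp add: ft_def cis_cnj)
qed

lemma fourier_cnj:
  assumes f: "in_Lp 2 f"
  shows "AE \<xi> in lborel. fourier (\<lambda>x. cnj (f x)) \<xi> = cnj (fourier f (- \<xi>))"
proof (rule pnorm_lim_unique)
  note r = in_Lp_cnj[OF f]
  show "((\<lambda>R. pnorm 2 (\<lambda>\<xi>. ft (cutoff R (\<lambda>x. cnj (f x))) \<xi> - fourier (\<lambda>x. cnj (f x)) \<xi>)) \<longlongrightarrow> 0) at_top"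
    by (rule fourier_tendsto[OF r])
  have c: "cutoff R (\<lambda>x. cnj (f x)) = (\<lambda>x. cnj (cutoff R f x))" for R
    by (rule ext) (simp add: cutoff_def)
  have "pnorm 2 (\<lambda>\<xi>. ft (cutoff R (\<lambda>x. cnj (f x))) \<xi> - cnj (fourier f (- \<xi>))) = pnorm 2 (\<lambda>\<xi>. ft (cutoff R f) \<xi> - fourier f \<xi>)" for R
  proof -
    have "pnorm 2 (\<lambda>\<xi>. ft (cutoff R (\<lambda>x. cnj (f x))) \<xi> - cnj (fourier f (- \<xi>))) = pnorm 2 (\<lambda>\<xi>. cnj (ft (cutoff R f) (- \<xi>) - fourier f (- \<xi>)))"
      by (simp add: c ft_cnj)
    also have "\<dots> = pnorm 2 (\<lambda>\<xi>. ft (cutoff R f) (- \<xi>) - fourier f (- \<xi>))" by (rule pnorm_cnj)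
    also have "\<dots> = pnorm 2 (\<lambda>\<xi>. ft (cutoff R f) \<xi> - fourier f \<xi>)"
      by (rule pnorm_reflect[OF in_Lp_diff[OF in_Lp_ft_cutoff[OF f] in_Lp_fourier[OF f]]])
    finally show ?thesis .
  qed
  then show "((\<lambda>R. pnorm 2 (\<lambda>\<xi>. ft (cutoff R (\<lambda>x. cnj (f x))) \<xi> - cnj (fourier f (- \<xi>)))) \<longlongrightarrow> 0) at_top"
    using fourier_tendsto[OF f] by simp
  show "in_Lp 2 (ft (cutoff R (\<lambda>x. cnj (f x))))" for R by (rule in_Lp_ft_cutoff[OF r])
qed (auto intro!: in_Lp_fourier in_Lp_reflect in_Lp_cnj f)

lemma in_Lp_inverse_fourier: "in_Lp 2 f \<Longrightarrow> in_Lp 2 (inverse_fourier f)"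
  using in_Lp_reflect[OF in_Lp_fourier] by (simp add: inverse_fourier_def[abs_def])

lemma pnorm_inverse_fourier: "in_Lp 2 f \<Longrightarrow> pnorm 2 (inverse_fourier f) = pnorm 2 f"
  using pnorm_reflect[OF in_Lp_fourier] by (simp add: inverse_fourier_def[abs_def] plancherel)

section \<open>Fourier inversion\<close>

text \<open>$\|\mathcal F^*\mathcal F f - f\|^2 = \|\mathcal F^*\mathcal F f\|^2 + \|f\|^2
  - 2\,\mathrm{Re}\,\langle \mathcal F^*\mathcal F f, f\rangle$, and all three terms are known.\<close>

theorem inverse_fourier_fourier:
  assumes f: "in_Lp 2 f"
  shows "AE x in lborel. inverse_fourier (fourier f) x = f x"
proof -
  define u where "u = inverse_fourier (fourier f)"
  have F: "in_Lp 2 (fourier f)" by (rule in_Lp_fourier[OF f])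
  have u: "in_Lp 2 u" unfolding u_def by (rule in_Lp_inverse_fourier[OF F])
  have nu: "pnorm 2 u = pnorm 2 f" unfolding u_def by (simp add: pnorm_inverse_fourier F plancherel f)
  \<comment> \<open>Chosen so that the transform of \<open>h\<close> is the conjugate of that of f;
    the multiplication formula then produces the integral of |\<open>fourier f\<close>|^2.\<close>
  define h where "h x = cnj (f (- x))" for x
  have h: "in_Lp 2 h" unfolding h_def[abs_def] by (intro in_Lp_cnj in_Lp_reflect f)
  have m [measurable]: "f \<in> borel_measurable borel" "u \<in> borel_measurable borel" "h \<in> borel_measurable borel"
    "fourier (fourier f) \<in> borel_measurable borel" "fourier f \<in> borel_measurable borel" "fourier h \<in> borel_measurable borel"
    using f u h in_Lp_fourier[OF F] F in_Lp_fourier[OF h] by auto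
  have "AE \<xi> in lborel. fourier h \<xi> = cnj (fourier (\<lambda>x. f (- x)) (- \<xi>))"
    using fourier_cnj[OF in_Lp_reflect[OF f]] by (simp add: h_def[abs_def])
  moreover have "AE \<xi> in lborel. fourier (\<lambda>x. f (- x)) (- \<xi>) = fourier f (- (- \<xi>))"
    using lborel_AE_uminus[OF fourier_reflect[OF f]] by simp
  ultimately have Fh: "AE \<xi> in lborel. fourier h \<xi> = cnj (fourier f \<xi>)" by eventually_elim simp
  have "(LBINT x. u x * cnj (f x)) = (LBINT x. fourier (fourier f) x * h x)"
    using lborel_integral_uminus(1)[of "\<lambda>x. u x * cnj (f x)"] by (simp add: u_def h_def inverse_fourier_def)
  also have "\<dots> = (LBINT x. fourier f x * fourier h x)" by (rule fourier_mult_formula[OF F h])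
  also have "\<dots> = (LBINT x. complex_of_real (norm (fourier f x) ^ 2))"
  proof (rule integral_cong_AE)
    show "AE x in lborel. fourier f x * fourier h x = complex_of_real (norm (fourier f x) ^ 2)"
      using Fh by eventually_elim (simp add: complex_norm_square[symmetric] del: of_real_power flip: of_real_power)
  qed measurable
  also have "\<dots> = complex_of_real (pnorm 2 f ^ 2)"
    by (simp only: integral_complex_of_real) (simp add: pnorm_power[symmetric] plancherel f)
  finally have inner: "(LBINT x. u x * cnj (f x)) = complex_of_real (pnorm 2 f ^ 2)" .
  have i: "integrable lborel (\<lambda>x. u x * cnj (f x))" by (intro in_L2_mult_integrable u in_Lp_cnj f)
  have "pnorm 2 (\<lambda>x. u x - f x) ^ 2 = (LBINT x. norm (u x) ^ 2 + norm (f x) ^ 2 - 2 * Re (u x * cnj (f x)))"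
    by (subst pnorm_power, simp, intro Bochner_Integration.integral_cong refl)
       (simp add: cmod_power2, simp add: power2_eq_square algebra_simps)
  also have "\<dots> = (LBINT x. norm (u x) ^ 2) + (LBINT x. norm (f x) ^ 2) - 2 * Re (LBINT x. u x * cnj (f x))"
  proof -
    have "integrable lborel (\<lambda>x. Re (u x * cnj (f x)))" using i by (rule integrable_Re)
    then show ?thesis using f u integral_Re[OF i] by (simp add: in_LpD(2) del: times_complex.simps)
  qed
  also have "\<dots> = 0" by (simp add: inner pnorm_power[symmetric] nu)
  finally have "pnorm 2 (\<lambda>x. u x - f x) = 0" by simp
  from pnorm_eq_0D[OF in_Lp_diff[OF u f] _ this] show ?thesis by (simp add: u_def)
qed

theorem fourier_inverse_fourier:
  assumes f: "in_Lp 2 f"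
  shows "AE x in lborel. fourier (inverse_fourier f) x = f x"
proof -
  have "AE x in lborel. fourier (\<lambda>x. fourier f (- x)) x = fourier (fourier f) (- x)"
    by (rule fourier_reflect[OF in_Lp_fourier[OF f]])
  moreover have "AE x in lborel. inverse_fourier (fourier f) x = f x" by (rule inverse_fourier_fourier[OF f])
  ultimately show ?thesis
    unfolding inverse_fourier_def[abs_def] by eventually_elim simp
qed

lemma inverse_fourier_diff:
  assumes f: "in_Lp 2 f" and g: "in_Lp 2 g"
  shows "AE \<xi> in lborel. inverse_fourier (\<lambda>x. f x - g x) \<xi> = inverse_fourier f \<xi> - inverse_fourier g \<xi>"
  using lborel_AE_uminus[OF fourier_diff[OF f g]] by (simp add: inverse_fourier_def)

lemma inverse_fourier_eq_ft:
  assumes "integrable lborel h" "in_Lp 2 h"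
  shows "AE x in lborel. inverse_fourier h x = ft h (- x)"
  using lborel_AE_uminus[OF fourier_eq_ft[OF assms]] by (simp add: inverse_fourier_def)

section \<open>The Schroedinger group\<close>

lemma in_Lp_cis_mult:
  assumes "in_Lp p f" "q \<in> borel_measurable borel"
  shows "in_Lp p (\<lambda>\<xi>. cis (q \<xi>) * f \<xi>)"
proof -
  have [measurable]: "f \<in> borel_measurable borel" "q \<in> borel_measurable borel" using assms by auto
  show ?thesis by (rule in_Lp_bound[OF assms(1)]) (measurable, simp add: norm_mult)
qed

lemma in_Lp_phase:
  assumes "in_Lp p f" shows "in_Lp p (\<lambda>\<xi>::space. cis (- t * (norm \<xi>)\<^sup>2) * f \<xi>)"
  by (rule in_Lp_cis_mult[OF assms]) measurable

lemma in_Lp_schrodinger: "in_Lp 2 f \<Longrightarrow> in_Lp 2 (schrodinger t f)"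
  unfolding schrodinger_def by (intro in_Lp_inverse_fourier in_Lp_phase in_Lp_fourier)

lemma fourier_schrodinger:
  assumes f: "in_Lp 2 f"
  shows "AE \<xi> in lborel. fourier (schrodinger t f) \<xi> = cis (- t * (norm \<xi>)\<^sup>2) * fourier f \<xi>"
  unfolding schrodinger_def by (intro fourier_inverse_fourier in_Lp_phase in_Lp_fourier f)

text \<open>An essential supremum over time gives no direct information about time 0; this
  continuity carries it from nearby times.\<close>

lemma schrodinger_continuous_0:
  assumes f: "in_Lp 2 f" and s: "s \<longlonglongrightarrow> 0"
  shows "(\<lambda>n. pnorm 2 (\<lambda>x. schrodinger (s n) f x - f x)) \<longlonglongrightarrow> 0"
proof -
  note F = in_Lp_fourier[OF f]
  have [measurable]: "fourier f \<in> borel_measurable borel" using F by auto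
  let ?D = "\<lambda>n \<xi>. cis (- s n * (norm \<xi>)\<^sup>2) * fourier f \<xi> - fourier f \<xi>"
  have "pnorm 2 (\<lambda>x. schrodinger (s n) f x - f x) = pnorm 2 (?D n)" for n
  proof -
    have "pnorm 2 (\<lambda>x. schrodinger (s n) f x - f x) = pnorm 2 (inverse_fourier (?D n))"
    proof (rule pnorm_AE_cong)
      show "AE x in lborel. schrodinger (s n) f x - f x = inverse_fourier (?D n) x"
        using inverse_fourier_diff[OF in_Lp_phase[OF F, of "s n"] F] inverse_fourier_fourier[OF f]
        unfolding schrodinger_def by eventually_elim simp
      show "(\<lambda>x. schrodinger (s n) f x - f x) \<in> borel_measurable borel"
        using in_Lp_diff[OF in_Lp_schrodinger[OF f] f] by auto
      show "inverse_fourier (?D n) \<in> borel_measurable borel"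
        using in_Lp_inverse_fourier[OF in_Lp_diff[OF in_Lp_phase[OF F] F]] by auto
    qed
    also have "\<dots> = pnorm 2 (?D n)" by (rule pnorm_inverse_fourier[OF in_Lp_diff[OF in_Lp_phase[OF F] F]])
    finally show ?thesis .
  qed
  moreover have "(\<lambda>n. pnorm 2 (?D n)) \<longlonglongrightarrow> 0"
  proof (rule pnorm_dominated[where h="\<lambda>\<xi>. 2 *\<^sub>R fourier f \<xi>"])
    show "in_Lp 2 (\<lambda>\<xi>. 2 *\<^sub>R fourier f \<xi>)" by (rule in_Lp_scaleR[OF F])
    show "AE \<xi> in lborel. norm (?D n \<xi>) \<le> norm (2 *\<^sub>R fourier f \<xi>)" for n
    proof (rule AE_I2)
      fix \<xi>
      have "norm (?D n \<xi>) \<le> norm (cis (- s n * (norm \<xi>)\<^sup>2) * fourier f \<xi>) + norm (fourier f \<xi>)" by (rule norm_triangle_ineq4)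
      then show "norm (?D n \<xi>) \<le> norm (2 *\<^sub>R fourier f \<xi>)" by (simp add: norm_mult)
    qed
    show "AE \<xi> in lborel. (\<lambda>n. ?D n \<xi>) \<longlonglongrightarrow> 0"
    proof (rule AE_I2)
      fix \<xi> :: space
      have "(\<lambda>n. cis (- s n * (norm \<xi>)\<^sup>2)) \<longlonglongrightarrow> cis (- 0 * (norm \<xi>)\<^sup>2)"
        by (intro isCont_tendsto_compose[where g=cis] tendsto_intros s) (auto simp: cis_conv_exp[abs_def] intro!: continuous_intros)
      then have "(\<lambda>n. ?D n \<xi>) \<longlonglongrightarrow> cis (- 0 * (norm \<xi>)\<^sup>2) * fourier f \<xi> - fourier f \<xi>"
        by (intro tendsto_diff tendsto_mult tendsto_const)
      then show "(\<lambda>n. ?D n \<xi>) \<longlonglongrightarrow> 0" by simp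
    qed
  qed auto
  ultimately show ?thesis by simp
qed

section \<open>Test functions and uniqueness of the weak gradient\<close>

text \<open>One-dimensional counterpart of \<open>C_times\<close>. With the derivative quantified
  existentially, closure under products and affine maps is an induction on the order.\<close>

primrec smooth1 :: "nat \<Rightarrow> (real \<Rightarrow> complex) \<Rightarrow> bool" where
  "smooth1 0 u \<longleftrightarrow> continuous_on UNIV u"
| "smooth1 (Suc k) u \<longleftrightarrow> (\<exists>u'. (\<forall>x. (u has_vector_derivative u' x) (at x)) \<and> smooth1 k u')"

lemma smooth1_SucI:
  assumes "\<And>x. (u has_vector_derivative u' x) (at x)" "smooth1 k u'"
  shows "smooth1 (Suc k) u"
  using assms by auto

lemma smooth1_SucD: "smooth1 (Suc k) u \<Longrightarrow> smooth1 k u"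
proof (induction k arbitrary: u)
  case 0
  then show ?case
    by (auto intro!: continuous_at_imp_continuous_on dest: has_vector_derivative_continuous)
qed fastforce

lemma smooth1_0: "smooth1 k u \<Longrightarrow> continuous_on UNIV u"
  by (induction k) (use smooth1_SucD in auto)

lemma smooth1_const: "smooth1 k (\<lambda>_. c)"
proof (induction k arbitrary: c)
  case (Suc k)
  show ?case by (rule smooth1_SucI[OF has_vector_derivative_const Suc.IH])
qed (auto intro: continuous_intros)

lemma smooth1_add: "smooth1 k u \<Longrightarrow> smooth1 k v \<Longrightarrow> smooth1 k (\<lambda>x. u x + v x)"
proof (induction k arbitrary: u v)
  case (Suc k)
  then obtain u' v' where *: "\<And>x. (u has_vector_derivative u' x) (at x)" "smooth1 k u'"
    "\<And>x. (v has_vector_derivative v' x) (at x)" "smooth1 k v'" by auto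
  show ?case
    by (rule smooth1_SucI[of _ "\<lambda>x. u' x + v' x"]) (intro Suc.IH * has_vector_derivative_add)+
qed (auto intro: continuous_intros)

lemma smooth1_mult: "smooth1 k u \<Longrightarrow> smooth1 k v \<Longrightarrow> smooth1 k (\<lambda>x. u x * v x)"
proof (induction k arbitrary: u v)
  case (Suc k)
  then obtain u' v' where *: "\<And>x. (u has_vector_derivative u' x) (at x)" "smooth1 k u'"
    "\<And>x. (v has_vector_derivative v' x) (at x)" "smooth1 k v'" by auto
  have "smooth1 k (\<lambda>x. u x * v' x + u' x * v x)"
    by (rule smooth1_add[OF Suc.IH[OF smooth1_SucD[OF Suc.prems(1)] *(4)] Suc.IH[OF *(2) smooth1_SucD[OF Suc.prems(2)]]])
  moreover have "((\<lambda>x. u x * v x) has_vector_derivative (u x * v' x + u' x * v x)) (at x)" for x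
    using has_vector_derivative_mult[OF *(1)[of x] *(3)[of x]] .
  ultimately show ?case by (rule smooth1_SucI[rotated])
qed (auto intro: continuous_intros)

lemma smooth1_affine: "smooth1 k u \<Longrightarrow> smooth1 k (\<lambda>x. u (a * x + b))"
proof (induction k arbitrary: u)
  case 0
  then show ?case by (auto intro!: continuous_on_compose2[of UNIV u] continuous_intros)
next
  case (Suc k)
  then obtain u' where *: "\<And>x. (u has_vector_derivative u' x) (at x)" "smooth1 k u'" by auto
  have "((\<lambda>x. u (a * x + b)) has_vector_derivative (of_real a * u' (a * x + b))) (at x)" for x
  proof -
    have "((\<lambda>x. a * x + b) has_vector_derivative a) (at x)"
      by (auto intro!: derivative_eq_intros simp: has_real_derivative_iff_has_vector_derivative[symmetric])
    from vector_diff_chain_at[OF this *(1)] show ?thesis by (simp add: o_def scaleR_conv_of_real)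
  qed
  moreover have "smooth1 k (\<lambda>x. of_real a * u' (a * x + b))"
    by (intro smooth1_mult smooth1_const Suc.IH *)
  ultimately show ?case by (rule smooth1_SucI)
qed

lemma cis_vector_derivative: "((\<lambda>s. cis (a * s)) has_vector_derivative \<i> * of_real a * cis (a * s)) (at s)"
proof -
  have "((\<lambda>z. exp (\<i> * of_real a * z)) has_field_derivative \<i> * of_real a * exp (\<i> * of_real a * of_real s)) (at (of_real s))"
    by (auto intro!: derivative_eq_intros)
  from has_vector_derivative_real_field[OF this] show ?thesis by (simp add: cis_conv_exp mult_ac)
qed

lemma smooth1_cis: "smooth1 k (\<lambda>s. c * cis (a * s))"
proof (induction k arbitrary: c)
  case 0 show ?case by (auto intro!: continuous_intros)
next
  case (Suc k)
  have "((\<lambda>s. c * cis (a * s)) has_vector_derivative (c * (\<i> * of_real a)) * cis (a * s)) (at s)" for s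
    using has_vector_derivative_mult_right[OF cis_vector_derivative, of c a s] by (simp add: mult_ac)
  then show ?case by (rule smooth1_SucI[OF _ Suc.IH])
qed

text \<open>The usual flat function is the case n = 0. The powers of 1/x are included to make the
  span of the family closed under differentiation, so that smoothness of all members follows by one
  induction.\<close>

definition flat_exp :: "nat \<Rightarrow> real \<Rightarrow> real" where
  "flat_exp n x = (if 0 < x then (1 / x) ^ n * exp (- (1 / x)) else 0)"

lemma flat_exp_limit: "((\<lambda>x. (1 / x) ^ n * exp (- (1 / x :: real))) \<longlongrightarrow> 0) (at_right 0)"
proof -
  have "((\<lambda>y. y ^ n / exp y :: real) \<longlongrightarrow> 0) at_top" by (rule tendsto_power_div_exp_0)
  from filterlim_compose[OF this filterlim_inverse_at_top_right]
  show ?thesis by (simp add: exp_minus field_simps)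
qed

lemma flat_exp_derivative:
  "(flat_exp n has_real_derivative flat_exp (n + 2) x - real n * flat_exp (n + 1) x) (at x)"
proof -
  consider "0 < x" | "x < 0" | "x = 0" by linarith
  then show ?thesis
  proof cases
    case 1
    have d1: "((\<lambda>x. 1 / x) has_real_derivative - ((1 / x) ^ 2)) (at x)"
      using 1 by (auto intro!: derivative_eq_intros simp: power2_eq_square divide_simps)
    have eq: "real n * (- (z ^ 2) * z ^ (n - Suc 0)) * E + (E * - (- (z ^ 2))) * z ^ n = z ^ (n + 2) * E - real n * (z ^ (n + 1) * E)"
      for z E :: real by (cases n) (simp_all add: power2_eq_square algebra_simps)
    have "((\<lambda>x. (1 / x) ^ n * exp (- (1 / x))) has_real_derivative flat_exp (n + 2) x - real n * flat_exp (n + 1) x) (at x)"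
      by (rule DERIV_cong[OF DERIV_mult[OF DERIV_power[OF d1] DERIV_fun_exp[OF DERIV_minus[OF d1]]]])
         (use 1 eq[of "1 / x" "exp (- (1 / x))"] in \<open>simp add: flat_exp_def\<close>)
    then show ?thesis
      by (rule DERIV_cong_ev[THEN iffD1, rotated 3])
         (use 1 eventually_gt_at_top in \<open>auto simp: flat_exp_def eventually_nhds intro!: exI[of _ "{0<..}"]\<close>)
  next
    case 2
    have "((\<lambda>x. 0) has_real_derivative 0) (at x)" by simp
    then have "(flat_exp n has_real_derivative 0) (at x)"
      by (rule DERIV_cong_ev[THEN iffD1, rotated 3])
         (use 2 in \<open>auto simp: flat_exp_def eventually_nhds intro!: exI[of _ "{..<0}"]\<close>)
    then show ?thesis using 2 by (simp add: flat_exp_def)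
  next
    case 3
    have "((\<lambda>h. flat_exp n h / h) \<longlongrightarrow> 0) (at 0)"
    proof (rule filterlim_split_at)
      show "((\<lambda>h. flat_exp n h / h) \<longlongrightarrow> 0) (at_left 0)"
        by (rule tendsto_eventually) (auto simp: flat_exp_def eventually_at_filter)
      show "((\<lambda>h. flat_exp n h / h) \<longlongrightarrow> 0) (at_right 0)"
      \<comment> \<open>The difference quotient at 0 is the flat function with one more power of
        1/x, which also tends to 0.\<close>
      proof (rule Lim_transform_eventually[OF flat_exp_limit[of "Suc n"]])
        show "\<forall>\<^sub>F h in at_right 0. (1 / h) ^ Suc n * exp (- (1 / h)) = flat_exp n h / h"
          by (auto simp: flat_exp_def eventually_at_filter)
      qed
    qed
    then show ?thesis unfolding 3 DERIV_def by (simp add: flat_exp_def)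
  qed
qed

lemma smooth1_flat_exp: "smooth1 k (\<lambda>x. complex_of_real (flat_exp n x))"
proof (induction k arbitrary: n)
  case 0
  have "isCont (flat_exp n) x" for x using DERIV_isCont[OF flat_exp_derivative] .
  then have "continuous_on UNIV (flat_exp n)" by (simp add: continuous_at_imp_continuous_on)
  then show ?case by (auto intro!: continuous_intros)
next
  case (Suc k)
  have "((\<lambda>x. complex_of_real (flat_exp n x)) has_vector_derivative
      complex_of_real (flat_exp (n + 2) x) + (- of_nat n) * complex_of_real (flat_exp (n + 1) x)) (at x)" for x
    using has_vector_derivative_of_real[of "flat_exp n" "flat_exp (n + 2) x - real n * flat_exp (n + 1) x" "at x"]
      flat_exp_derivative[of n x] by (simp add: has_real_derivative_iff_has_vector_derivative)
  moreover have "smooth1 k (\<lambda>x. complex_of_real (flat_exp (n + 2) x) + (- of_nat n) * complex_of_real (flat_exp (n + 1) x))"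
    by (intro smooth1_add smooth1_mult smooth1_const Suc.IH)
  ultimately show ?case by (rule smooth1_SucI)
qed

lemma flat_exp_bounds: "0 \<le> flat_exp n x" "flat_exp 0 x \<le> 1" "flat_exp 2 x \<le> 2"
proof -
  show "0 \<le> flat_exp n x" "flat_exp 0 x \<le> 1" by (auto simp: flat_exp_def)
  show "flat_exp 2 x \<le> 2"
  proof (cases "0 < x")
    case True
    have "1 + (1/x) + (1/x)^2 / 2 \<le> exp (1 / x)" using exp_lower_Taylor_quadratic[of "1/x"] True by simp
    then have "(1/x)^2 \<le> 2 * exp (1 / x)" using True by (smt (verit) divide_nonneg_nonneg field_sum_of_halves)
    then show ?thesis using True by (simp add: flat_exp_def exp_minus field_simps)
  qed (simp add: flat_exp_def)
qed

section \<open>Tensor products as test functions\<close>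

definition tensor :: "(3 \<Rightarrow> real \<Rightarrow> complex) \<Rightarrow> space \<Rightarrow> complex" where
  "tensor u x = (\<Prod>i\<in>UNIV. u i (x $ i))"

lemma tensor_derivative:
  assumes "\<And>i x. (u i has_vector_derivative u' i x) (at x)"
  shows "(tensor u has_derivative (\<lambda>h. \<Sum>i\<in>UNIV. (h $ i *\<^sub>R u' i (x $ i)) * (\<Prod>j\<in>UNIV - {i}. u j (x $ j)))) (at x)"
  unfolding tensor_def[abs_def]
proof (rule has_derivative_prod)
  fix i
  have "((\<lambda>x::space. x $ i) has_derivative (\<lambda>h. h $ i)) (at x)"
    by (rule bounded_linear_imp_has_derivative) (rule bounded_linear_vec_nth)
  from has_derivative_compose[OF this assms[unfolded has_vector_derivative_def]]
  show "((\<lambda>x. u i (x $ i)) has_derivative (\<lambda>h. h $ i *\<^sub>R u' i (x $ i))) (at x)" .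
qed

lemma partial_deriv_eq:
  assumes "(f has_derivative D) (at x)"
  shows "partial_deriv i f x = D (axis i 1)"
  using frechet_derivative_at[OF assms] by (simp add: partial_deriv_def)

lemma partial_deriv_tensor:
  assumes "\<And>i x. (u i has_vector_derivative u' i x) (at x)"
  shows "partial_deriv j (tensor u) = tensor (u(j := u' j))"
proof
  fix x
  have "partial_deriv j (tensor u) x = (\<Sum>i\<in>UNIV. (axis j (1::real) $ i *\<^sub>R u' i (x $ i)) * (\<Prod>k\<in>UNIV - {i}. u k (x $ k)))"
    using partial_deriv_eq[OF tensor_derivative[of u u', OF assms]] by simp
  also have "\<dots> = (\<Sum>i\<in>UNIV. if i = j then u' j (x $ j) * (\<Prod>k\<in>UNIV - {j}. u k (x $ k)) else 0)"
    by (intro sum.cong) (auto simp: axis_def)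
  also have "\<dots> = u' j (x $ j) * (\<Prod>k\<in>UNIV - {j}. u k (x $ k))" by simp
  also have "\<dots> = tensor (u(j := u' j)) x"
    unfolding tensor_def by (subst prod.remove[of UNIV j]) (auto intro!: prod.cong)
  finally show "partial_deriv j (tensor u) x = tensor (u(j := u' j)) x" .
qed

text \<open>A partial derivative of a tensor product is again a tensor product, with one factor
  replaced, so the induction never leaves the class.\<close>

lemma C_times_tensor:
  assumes "\<And>i. smooth1 k (u i)"
  shows "C_times k (tensor u)"
  using assms
proof (induction k arbitrary: u)
  case 0
  have "continuous_on UNIV (\<lambda>x::space. u i (x $ i))" for i
    using 0[of i] by (auto intro!: continuous_on_compose2[of UNIV "u i"] continuous_intros)
  then show ?case unfolding tensor_def[abs_def] by (auto intro!: continuous_intros)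
next
  case (Suc k)
  then have "\<forall>i. \<exists>u'. (\<forall>x. (u i has_vector_derivative u' x) (at x)) \<and> smooth1 k u'" by auto
  then obtain u' where u': "\<And>i x. (u i has_vector_derivative u' i x) (at x)" "\<And>i. smooth1 k (u' i)" by metis
  have "tensor u differentiable (at x)" for x
    using tensor_derivative[of u u', OF u'(1)] unfolding differentiable_def by blast
  moreover have "C_times k (partial_deriv j (tensor u))" for j
    unfolding partial_deriv_tensor[of u u', OF u'(1)]
    by (rule Suc.IH) (use u'(2) Suc.prems smooth1_SucD in auto)
  ultimately show ?case by simp
qed

lemma test_function_tensor:
  assumes "\<And>i k. smooth1 k (u i)" "\<And>i s. R < \<bar>s\<bar> \<Longrightarrow> u i s = 0"
  shows "test_function (tensor u)"
  unfolding test_function_def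
proof (intro conjI allI exI[of _ "cbox (\<chi> i. - R) (\<chi> i. R)"] impI)
  fix x :: space assume "x \<notin> cbox (\<chi> i. - R) (\<chi> i. R)"
  then obtain i where "\<not> (- R \<le> x $ i \<and> x $ i \<le> R)" by (auto simp: mem_box_cart)
  then have "u i (x $ i) = 0" by (intro assms(2)) auto
  then show "tensor u x = 0" unfolding tensor_def by (intro prod_zero) auto
qed (auto intro: C_times_tensor assms)

lemma borel_measurable_test_function: "test_function \<eta> \<Longrightarrow> \<eta> \<in> borel_measurable borel"
  unfolding test_function_def by (intro borel_measurable_continuous_onI) (metis C_times.simps(1))

section \<open>The fundamental lemma of the calculus of variations\<close>

text \<open>The functions $\prod_i e^{-1/(k(x_i-a_i))}\, e^{-1/(k(b_i-x_i))}$, $k \to \infty$, increase to the indicator of the open box.\<close>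

lemma weak_zero_box:
  fixes w :: "space \<Rightarrow> complex"
  assumes loc: "\<And>K. compact K \<Longrightarrow> set_integrable lborel K w"
    and zero: "\<And>\<eta>. test_function \<eta> \<Longrightarrow> (LBINT x. w x * \<eta> x) = 0"
    and [measurable]: "w \<in> borel_measurable borel"
  shows "(LBINT x. indicator (box a b) x *\<^sub>R w x) = 0"
proof -
  define u where "u n i s = complex_of_real (flat_exp 0 (real (Suc n) * s + (- real (Suc n) * a $ i)))
     * complex_of_real (flat_exp 0 ((- real (Suc n)) * s + real (Suc n) * b $ i))" for n and i :: 3 and s
  define R where "R = Max (range (\<lambda>i. max \<bar>a $ i\<bar> \<bar>b $ i\<bar>))"
  have R: "\<bar>a $ i\<bar> \<le> R" "\<bar>b $ i\<bar> \<le> R" for i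
    unfolding R_def by (meson Max_ge finite_imageI finite_class.finite_UNIV max.bounded_iff rangeI)+
  have nz: "a $ i < s \<and> s < b $ i" if "u n i s \<noteq> 0" for n i s
  proof -
    have "0 < real (Suc n) * s + (- real (Suc n) * a $ i)" "0 < (- real (Suc n)) * s + real (Suc n) * b $ i"
      using that by (auto simp: u_def flat_exp_def split: if_splits)
    then have "0 < real (Suc n) * (s - a $ i)" "0 < real (Suc n) * (b $ i - s)" by (simp_all add: algebra_simps)
    then show ?thesis by (simp add: zero_less_mult_iff)
  qed
  have test: "test_function (tensor (u n))" for n
  proof (rule test_function_tensor[of _ R])
    show "smooth1 k (u n i)" for i k unfolding u_def
      by (intro smooth1_mult smooth1_affine[of k "\<lambda>x. complex_of_real (flat_exp 0 x)"] smooth1_flat_exp)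
    show "u n i s = 0" if "R < \<bar>s\<bar>" for i s
      using nz[of n i s] R[of i] that by force
  qed
  have supp: "norm (tensor (u n) x) \<le> indicator (cbox a b) x" for n x
  proof (cases "x \<in> cbox a b")
    case True
    have "norm (u n i s) \<le> 1" for i s
      unfolding u_def norm_mult norm_of_real by (intro mult_le_one) (auto simp: abs_le_iff flat_exp_bounds intro: order_trans[OF _ flat_exp_bounds(1)])
    then have "norm (tensor (u n) x) \<le> 1" unfolding tensor_def prod_norm[symmetric] by (intro prod_le_1) auto
    then show ?thesis using True by simp
  next
    case False
    then obtain i where "\<not> (a $ i \<le> x $ i \<and> x $ i \<le> b $ i)" by (auto simp: mem_box_cart)
    then have "\<not> (a $ i < x $ i \<and> x $ i < b $ i)" by auto
    then have "u n i (x $ i) = 0" using nz by blast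
    then have "tensor (u n) x = 0" unfolding tensor_def by (intro prod_zero) auto
    then show ?thesis by simp
  qed
  have [measurable]: "tensor (u n) \<in> borel_measurable borel" for n by (rule borel_measurable_test_function[OF test])
  have "(\<lambda>n. LBINT x. w x * tensor (u n) x) \<longlonglongrightarrow> (LBINT x. indicator (box a b) x *\<^sub>R w x)"
  proof (rule integral_dominated_convergence[where w="\<lambda>x. norm (indicator (cbox a b) x *\<^sub>R w x)"])
    show "integrable lborel (\<lambda>x. norm (indicator (cbox a b) x *\<^sub>R w x))"
      by (rule integrable_norm[OF loc[OF compact_cbox, unfolded set_integrable_def]])
    show "AE x in lborel. norm (w x * tensor (u n) x) \<le> norm (indicator (cbox a b) x *\<^sub>R w x)" for n
    proof (rule AE_I2)
      fix x
      show "norm (w x * tensor (u n) x) \<le> norm (indicator (cbox a b) x *\<^sub>R w x)"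
        using mult_left_mono[OF supp[of n x] norm_ge_zero[of "w x"]] by (simp add: norm_mult mult.commute)
    qed
    show "AE x in lborel. (\<lambda>n. w x * tensor (u n) x) \<longlonglongrightarrow> indicator (box a b) x *\<^sub>R w x"
    proof (rule AE_I2)
      fix x
      have "(\<lambda>n. tensor (u n) x) \<longlonglongrightarrow> indicator (box a b) x"
      proof (cases "x \<in> box a b")
        case True
        have fl: "(\<lambda>n. flat_exp 0 (real (Suc n) * c)) \<longlonglongrightarrow> 1" if "0 < c" for c
        proof -
          have "(\<lambda>n. exp (- ((1 / real (Suc n)) * (1 / c)))) \<longlonglongrightarrow> exp (- (0 * (1 / c)))"
            by (intro tendsto_intros LIMSEQ_Suc[OF lim_1_over_n])
          then show ?thesis using that by (simp add: flat_exp_def)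
        qed
        have "(\<lambda>n. u n i (x $ i)) \<longlonglongrightarrow> 1" for i
        proof -
          have "0 < x $ i - a $ i" "0 < b $ i - x $ i" using True by (auto simp: mem_box_cart)
          then have "(\<lambda>n. complex_of_real (flat_exp 0 (real (Suc n) * (x $ i - a $ i))) * complex_of_real (flat_exp 0 (real (Suc n) * (b $ i - x $ i)))) \<longlonglongrightarrow> complex_of_real 1 * complex_of_real 1"
            by (intro tendsto_mult tendsto_of_real fl)
          then show ?thesis by (simp add: u_def algebra_simps)
        qed
        then have "(\<lambda>n. tensor (u n) x) \<longlonglongrightarrow> (\<Prod>i\<in>(UNIV::3 set). 1)"
          unfolding tensor_def by (intro tendsto_prod)
        then show ?thesis using True by simp
      next
        case False
        then obtain i where "\<not> (a $ i < x $ i \<and> x $ i < b $ i)" by (auto simp: mem_box_cart)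
        then have "u n i (x $ i) = 0" for n using nz by blast
        then have "tensor (u n) x = 0" for n unfolding tensor_def by (intro prod_zero) auto
        then show ?thesis using False by simp
      qed
      then have "(\<lambda>n. w x * tensor (u n) x) \<longlonglongrightarrow> w x * indicator (box a b) x" by (intro tendsto_intros)
      then show "(\<lambda>n. w x * tensor (u n) x) \<longlonglongrightarrow> indicator (box a b) x *\<^sub>R w x"
        by (cases "x \<in> box a b") simp_all
    qed
  qed measurable
  then have "(\<lambda>n. 0) \<longlonglongrightarrow> (LBINT x. indicator (box a b) x *\<^sub>R w x)"
    by (simp add: zero[OF test])
  then show ?thesis by (simp add: LIMSEQ_const_iff)
qed

text \<open>The positive and the negative part of v are densities of two measures that agree on
  boxes. Boxes are stable under intersection and generate the Borel sets, so the measures agree, and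
  hence their densities almost everywhere.\<close>

lemma zero_on_boxes_imp_AE_zero:
  fixes v :: "'a::euclidean_space \<Rightarrow> real"
  assumes v: "integrable lborel v" and zero: "\<And>a b. (LBINT x. indicator (box a b) x * v x) = 0"
  shows "AE x in lborel. v x = 0"
proof -
  have [measurable]: "v \<in> borel_measurable borel" using v by auto
  let ?p = "\<lambda>x. ennreal (v x)" and ?m = "\<lambda>x. ennreal (- v x)"
  have box: "emeasure (density lborel ?p) (box a b) = emeasure (density lborel ?m) (box a b)"
     and fin: "emeasure (density lborel ?p) (box a b) \<noteq> \<infinity>" for a b
  proof -
    have i: "integrable lborel (\<lambda>x. indicator (box a b) x * v x)"
      by (rule Bochner_Integration.integrable_bound[OF v]) (auto simp: indicator_def)
    have ip: "integrable lborel (\<lambda>x. indicator (box a b) x * max 0 (v x))" "integrable lborel (\<lambda>x. indicator (box a b) x * max 0 (- v x))"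
      by (rule Bochner_Integration.integrable_bound[OF v]; auto simp: indicator_def)+
    have e: "emeasure (density lborel ?p) (box a b) = ennreal (LBINT x. indicator (box a b) x * max 0 (v x))"
       "emeasure (density lborel ?m) (box a b) = ennreal (LBINT x. indicator (box a b) x * max 0 (- v x))"
    proof -
      show "emeasure (density lborel ?p) (box a b) = ennreal (LBINT x. indicator (box a b) x * max 0 (v x))"
        by (subst emeasure_density, simp, simp, subst nn_integral_eq_integral[symmetric, OF ip(1)])
           (auto intro!: nn_integral_cong simp: indicator_def max_def ennreal_neg)
      show "emeasure (density lborel ?m) (box a b) = ennreal (LBINT x. indicator (box a b) x * max 0 (- v x))"
        by (subst emeasure_density, simp, simp, subst nn_integral_eq_integral[symmetric, OF ip(2)])
           (auto intro!: nn_integral_cong simp: indicator_def max_def ennreal_neg)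
    qed
    have "(LBINT x. indicator (box a b) x * max 0 (v x) - indicator (box a b) x * max 0 (- v x)) = (LBINT x. indicator (box a b) x * v x)"
      by (intro Bochner_Integration.integral_cong) (auto simp: indicator_def)
    also have "\<dots> = 0" by (rule zero)
    finally have "(LBINT x. indicator (box a b) x * max 0 (v x) - indicator (box a b) x * max 0 (- v x)) = 0" .
    then have "(LBINT x. indicator (box a b) x * max 0 (v x)) = (LBINT x. indicator (box a b) x * max 0 (- v x))"
      using ip by simp
    with e show "emeasure (density lborel ?p) (box a b) = emeasure (density lborel ?m) (box a b)" by simp
    show "emeasure (density lborel ?p) (box a b) \<noteq> \<infinity>" by (simp add: e)
  qed
  have "density lborel ?p = density lborel ?m"
  proof (rule measure_eqI_generator_eq[where E="range (\<lambda>(a, b). box a b)" and \<Omega>=UNIV and A="\<lambda>n. box (- (real n *\<^sub>R One)) (real n *\<^sub>R One)"])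
    show "Int_stable (range (\<lambda>(a, b). box a b :: 'a set))"
      unfolding Int_stable_def
    proof (clarsimp simp del: image_eqI)
      fix a b c d :: 'a
      show "box a b \<inter> box c d \<in> range (\<lambda>(a, b). box a b)"
        unfolding box_Int_box by (rule range_eqI[of _ _ "(_, _)"]) simp
    qed
    show "(\<Union>i. box (- (real i *\<^sub>R One)) (real i *\<^sub>R One)) = (UNIV :: 'a set)"
      using UN_box_eq_UNIV by auto
  qed (auto simp: borel_eq_box box fin[unfolded box infinity_ennreal_def])
  then have "AE x in lborel. ?p x = ?m x"
    by (intro sigma_finite_measure.density_unique[OF sigma_finite_lborel]) auto
  then show ?thesis
  proof eventually_elim
    case (elim x)
    then show ?case by (cases "0 \<le> v x") (auto simp: ennreal_neg ennreal_eq_0_iff)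
  qed
qed

text \<open>Restricted to a bounded box, w is integrable, and since the intersection of two boxes is
  a box, its integrals over all boxes vanish. Real and imaginary parts are treated separately, and
  countably many boxes cover the space.\<close>

theorem weak_zero_imp_AE_zero:
  fixes w :: "space \<Rightarrow> complex"
  assumes loc: "\<And>K. compact K \<Longrightarrow> set_integrable lborel K w"
    and zero: "\<And>\<eta>. test_function \<eta> \<Longrightarrow> (LBINT x. w x * \<eta> x) = 0"
    and [measurable]: "w \<in> borel_measurable borel"
  shows "AE x in lborel. w x = 0"
proof -
  have "AE x in lborel. indicator (box (- (real n *\<^sub>R One)) (real n *\<^sub>R One)) x *\<^sub>R w x = 0" for n
  proof -
    let ?B = "box (- (real n *\<^sub>R One)) (real n *\<^sub>R One) :: space set"
    have iw: "integrable lborel (\<lambda>x. indicator ?B x *\<^sub>R w x)"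
      using set_integrable_subset[OF loc[OF compact_cbox] _ box_subset_cbox] by (simp add: set_integrable_def)
    have z: "(LBINT x. indicator (box a b) x *\<^sub>R (indicator ?B x *\<^sub>R w x)) = 0" for a b
    proof -
      obtain c d where "box a b \<inter> ?B = box c d" unfolding box_Int_box by blast
      then have "(\<lambda>x. indicator (box a b) x *\<^sub>R (indicator ?B x *\<^sub>R w x)) = (\<lambda>x. indicator (box c d) x *\<^sub>R w x)"
        unfolding \<open>box a b \<inter> ?B = box c d\<close>[symmetric] indicator_inter_arith by simp
      then show ?thesis using weak_zero_box[OF loc zero] by simp
    qed
    have i2: "integrable lborel (\<lambda>x. indicator (box a b) x *\<^sub>R (indicator ?B x *\<^sub>R w x))" for a b
      by (rule Bochner_Integration.integrable_bound[OF iw]) (auto simp: indicator_def)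
    have "AE x in lborel. Re (indicator ?B x *\<^sub>R w x) = 0"
    proof (rule zero_on_boxes_imp_AE_zero)
      show "(LBINT x. indicator (box a b) x * Re (indicator ?B x *\<^sub>R w x)) = 0" for a b
        using integral_Re[OF i2[of a b]] z[of a b] by (simp add: mult.assoc)
    qed (rule integrable_Re[OF iw])
    moreover have "AE x in lborel. Im (indicator ?B x *\<^sub>R w x) = 0"
    proof (rule zero_on_boxes_imp_AE_zero)
      show "(LBINT x. indicator (box a b) x * Im (indicator ?B x *\<^sub>R w x)) = 0" for a b
        using integral_Im[OF i2[of a b]] z[of a b] by (simp add: mult.assoc)
    qed (rule integrable_Im[OF iw])
    ultimately show ?thesis by eventually_elim (simp add: complex_eq_iff)
  qed
  then have "AE x in lborel. \<forall>n. indicator (box (- (real n *\<^sub>R One)) (real n *\<^sub>R One)) x *\<^sub>R w x = 0"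
    by (subst AE_all_countable) blast
  then show ?thesis
  proof eventually_elim
    case (elim x)
    obtain n where "x \<in> box (- (real n *\<^sub>R One)) (real n *\<^sub>R One)" using UN_box_eq_UNIV by blast
    then show ?case using elim[rule_format, of n] by simp
  qed
qed

lemma set_integrable_nth:
  fixes g :: "space \<Rightarrow> complex ^ 3"
  assumes "set_integrable lborel K g"
  shows "set_integrable lborel K (\<lambda>x. g x $ i)"
  using integrable_bounded_linear[OF bounded_linear_vec_nth assms[unfolded set_integrable_def], of i]
  by (simp add: set_integrable_def)

lemma compact_UNIV_measurable:
  fixes w :: "space \<Rightarrow> 'b::{banach, second_countable_topology}"
  assumes "\<And>K. compact K \<Longrightarrow> set_integrable lborel K w"
  shows "w \<in> borel_measurable borel"
proof (rule borel_measurable_LIMSEQ_metric)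
  show "(\<lambda>x. indicator (cball 0 (real n)) x *\<^sub>R w x) \<in> borel_measurable borel" for n
    using assms[of "cball 0 (real n)"] by (auto simp: set_integrable_def)
  show "(\<lambda>n. indicator (cball 0 (real n)) x *\<^sub>R w x) \<longlonglongrightarrow> w x" for x
  proof (rule tendsto_eventually)
    obtain N where "norm x \<le> real N" using real_arch_simple by blast
    then show "\<forall>\<^sub>F n in sequentially. indicator (cball 0 (real n)) x *\<^sub>R w x = w x"
      by (auto simp: eventually_sequentially indicator_def intro!: exI[of _ N])
  qed
qed

lemma integrable_mult_test_function:
  fixes w :: "space \<Rightarrow> complex"
  assumes loc: "\<And>K. compact K \<Longrightarrow> set_integrable lborel K w" and t: "test_function \<eta>"
  shows "integrable lborel (\<lambda>x. w x * \<eta> x)"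
proof -
  obtain K where K: "compact K" "\<And>x. x \<notin> K \<Longrightarrow> \<eta> x = 0" using t by (auto simp: test_function_def)
  have [measurable]: "w \<in> borel_measurable borel" by (rule compact_UNIV_measurable[OF loc])
  note [measurable] = borel_measurable_test_function[OF t]
  have "continuous_on UNIV \<eta>" using t by (auto simp: test_function_def dest: spec[of _ 0])
  then have "bounded (\<eta> ` K)" using K(1) by (metis compact_continuous_image compact_imp_bounded continuous_on_subset subset_UNIV)
  then obtain B where B: "\<And>x. x \<in> K \<Longrightarrow> norm (\<eta> x) \<le> B" by (auto simp: bounded_iff)
  show ?thesis
  proof (rule Bochner_Integration.integrable_bound)
    show "integrable lborel (\<lambda>x. B *\<^sub>R (indicator K x *\<^sub>R w x))"
      using integrable_scaleR_right[OF loc[OF K(1), unfolded set_integrable_def]] .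
    show "AE x in lborel. norm (w x * \<eta> x) \<le> norm (B *\<^sub>R (indicator K x *\<^sub>R w x))"
    proof (rule AE_I2)
      fix x
      have "norm (\<eta> x) \<le> \<bar>B\<bar>" if "x \<in> K" using B[OF that] by linarith
      then show "norm (w x * \<eta> x) \<le> norm (B *\<^sub>R (indicator K x *\<^sub>R w x))"
        by (cases "x \<in> K") (auto simp: norm_mult K(2) mult.commute[of "norm (w x)"] intro: mult_right_mono)
    qed
  qed measurable
qed

text \<open>This makes \<open>weak_gradient\<close> well defined almost everywhere, whatever
  \<open>SOME\<close> returns.\<close>

lemma weak_gradient_unique:
  assumes "is_weak_gradient f g" "is_weak_gradient f g'"
  shows "AE x in lborel. g x = g' x"
proof -
  have "AE x in lborel. g x $ i - g' x $ i = 0" for i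
  proof (rule weak_zero_imp_AE_zero)
    have loc: "set_integrable lborel K (\<lambda>x. g x $ i)" "set_integrable lborel K (\<lambda>x. g' x $ i)" if "compact K" for K
      using assms that by (auto simp: is_weak_gradient_def intro: set_integrable_nth)
    then show "set_integrable lborel K (\<lambda>x. g x $ i - g' x $ i)" if "compact K" for K
      using that by (intro set_integral_diff) auto
    have [measurable]: "(\<lambda>x. g x $ i) \<in> borel_measurable borel" "(\<lambda>x. g' x $ i) \<in> borel_measurable borel"
      by (rule compact_UNIV_measurable, rule loc, assumption)+
    show "(\<lambda>x. g x $ i - g' x $ i) \<in> borel_measurable borel" by measurable
    fix \<eta> assume t: "test_function \<eta>"
    have "(LBINT x. (g x $ i - g' x $ i) * \<eta> x) = (LBINT x. g x $ i * \<eta> x) - (LBINT x. g' x $ i * \<eta> x)"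
      unfolding left_diff_distrib
      by (rule Bochner_Integration.integral_diff) (rule integrable_mult_test_function[OF _ t], rule loc, assumption)+
    also have "\<dots> = 0"
    proof -
      have "(LBINT x. f x * partial_deriv i \<eta> x) = - (LBINT x. g x $ i * \<eta> x)"
        "(LBINT x. f x * partial_deriv i \<eta> x) = - (LBINT x. g' x $ i * \<eta> x)"
        using assms t by (simp_all add: is_weak_gradient_def)
      then show ?thesis by simp
    qed
    finally show "(LBINT x. (g x $ i - g' x $ i) * \<eta> x) = 0" .
  qed
  then have "AE x in lborel. \<forall>i. g x $ i - g' x $ i = 0" by (simp add: AE_all_countable)
  then show ?thesis by eventually_elim (simp add: vec_eq_iff)
qed

section \<open>The weak gradient on the Fourier side\<close>

lemma norm_power2_vec3: "(norm (v :: 'a::real_normed_vector ^ 3))\<^sup>2 = (\<Sum>i\<in>UNIV. (norm (v $ i))\<^sup>2)"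
  by (simp add: norm_vec_def L2_set_def sum_nonneg)

lemma in_Lp_nth:
  fixes g :: "space \<Rightarrow> complex ^ 3"
  assumes "in_Lp 2 g" shows "in_Lp 2 (\<lambda>x. g x $ i)"
proof -
  have "(\<lambda>x. g x $ i) \<in> borel_measurable borel"
    by (rule measurable_compose[OF in_LpD(1)[OF assms], of "\<lambda>v. v $ i"]) (intro borel_measurable_continuous_onI continuous_intros)
  then show ?thesis by (rule in_Lp_bound[OF assms]) (rule AE_I2, rule Finite_Cartesian_Product.norm_nth_le)
qed

lemma borel_measurable_vec3:
  fixes g :: "3 \<Rightarrow> space \<Rightarrow> complex"
  assumes "\<And>i. g i \<in> borel_measurable borel"
  shows "(\<lambda>x. \<chi> i. g i x) \<in> borel_measurable borel"
proof -
  have "(\<lambda>x. \<Sum>i\<in>UNIV. axis i (g i x)) \<in> borel_measurable borel"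
  proof (rule borel_measurable_sum)
    fix i
    have "linear (\<lambda>z::complex. axis i z :: complex ^ 3)"
      by (rule linearI) (auto simp: axis_def vec_eq_iff)
    then have "continuous_on UNIV (\<lambda>z::complex. axis i z :: complex ^ 3)" by (rule linear_continuous_on[OF linear_linear[THEN iffD2]])
    from measurable_compose[OF assms borel_measurable_continuous_onI[OF this]]
    show "(\<lambda>x. axis i (g i x)) \<in> borel_measurable borel" .
  qed
  moreover have "(\<lambda>x. \<Sum>i\<in>UNIV. axis i (g i x)) = (\<lambda>x. \<chi> i. g i x)"
    by (auto simp: fun_eq_iff vec_eq_iff axis_def)
  ultimately show ?thesis by simp
qed

lemma integrable_norm_vec3:
  fixes g :: "space \<Rightarrow> complex ^ 3"
  assumes g: "g \<in> borel_measurable borel" and gi: "\<And>i. in_Lp 2 (\<lambda>x. g x $ i)"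
  shows "in_Lp 2 g" "pnorm 2 g ^ 2 = (\<Sum>i\<in>UNIV. pnorm 2 (\<lambda>x. g x $ i) ^ 2)"
proof -
  show "in_Lp 2 g" by (rule in_LpI[OF g]) (simp add: norm_power2_vec3 in_LpD(2)[OF gi])
  show "pnorm 2 g ^ 2 = (\<Sum>i\<in>UNIV. pnorm 2 (\<lambda>x. g x $ i) ^ 2)"
    by (simp add: pnorm_power norm_power2_vec3 in_LpD(2)[OF gi])
qed

lemma L2_set_integrable_compact:
  fixes f :: "space \<Rightarrow> 'b::euclidean_space"
  assumes f: "in_Lp 2 f" and K: "compact K"
  shows "set_integrable lborel K f"
  unfolding set_integrable_def
proof (rule Bochner_Integration.integrable_bound)
  have [measurable]: "K \<in> sets borel" "f \<in> borel_measurable borel"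
    using borel_closed[OF compact_imp_closed[OF K]] f by auto
  have iK: "integrable lborel (indicator K :: space \<Rightarrow> real)"
    using emeasure_bounded_finite[OF compact_imp_bounded[OF K]] by (intro integrable_real_indicator) auto
  show "integrable lborel (\<lambda>x. indicator K x + norm (f x) ^ 2)"
    by (intro Bochner_Integration.integrable_add iK in_LpD(2)[OF f])
  show "AE x in lborel. norm (indicat_real K x *\<^sub>R f x) \<le> norm (indicat_real K x + norm (f x) ^ 2)"
  proof (rule AE_I2)
    fix x
    have "norm (f x) \<le> 1 + norm (f x) ^ 2"
      using sum_squares_bound[of "norm (f x)" 1] norm_ge_zero[of "f x"] by (smt (verit) one_power2 mult_cancel_left2 zero_le_power2 mult.commute)
    then show "norm (indicat_real K x *\<^sub>R f x) \<le> norm (indicat_real K x + norm (f x) ^ 2)"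
      by (auto simp: indicator_def)
  qed
  show "(\<lambda>x. indicat_real K x *\<^sub>R f x) \<in> borel_measurable lborel" by measurable
qed

section \<open>Smooth windows of growing size\<close>

definition bump :: "real \<Rightarrow> complex" where
  "bump s = exp 2 * (complex_of_real (flat_exp 0 (1 * s + 1)) * complex_of_real (flat_exp 0 ((- 1) * s + 1)))"

definition bump' :: "real \<Rightarrow> complex" where
  "bump' s = exp 2 * (complex_of_real (flat_exp 0 (1 * s + 1)) * (- complex_of_real (flat_exp 2 ((- 1) * s + 1)))
     + complex_of_real (flat_exp 2 (1 * s + 1)) * complex_of_real (flat_exp 0 ((- 1) * s + 1)))"

lemma bump_smooth: "smooth1 k bump"
  unfolding bump_def[abs_def]
  by (intro smooth1_mult smooth1_const smooth1_affine[of k "\<lambda>x. complex_of_real (flat_exp 0 x)"] smooth1_flat_exp)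

lemma flat_exp_affine_derivative:
  "((\<lambda>s. complex_of_real (flat_exp 0 (a * s + b))) has_vector_derivative of_real a * complex_of_real (flat_exp 2 (a * s + b))) (at s)"
proof -
  have "((\<lambda>s. flat_exp 0 (a * s + b)) has_real_derivative flat_exp 2 (a * s + b) * a) (at s)"
  proof -
    have "((\<lambda>s. a * s + b) has_real_derivative a) (at s)" by (auto intro!: derivative_eq_intros)
    from DERIV_chain2[where f="flat_exp 0" and g="\<lambda>s. a * s + b", OF flat_exp_derivative this]
    show ?thesis by (simp add: numeral_2_eq_2)
  qed
  from has_vector_derivative_of_real[OF this]
  show ?thesis by (simp add: mult.commute)
qed

lemma bump_derivative: "(bump has_vector_derivative bump' s) (at s)"
  unfolding bump_def[abs_def] bump'_def
  using has_vector_derivative_mult_right[OF has_vector_derivative_mult[OF flat_exp_affine_derivative[of 1 1 s] flat_exp_affine_derivative[of "-1" 1 s]], of "exp 2"]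
  by simp

text \<open>The reason for the factor \<open>exp 2\<close>: at 0 both flat factors equal exp
  (-1).\<close>

lemma bump_0: "bump 0 = 1"
  by (simp add: bump_def flat_exp_def exp_minus flip: exp_double exp_of_real)
     (simp add: power2_eq_square field_simps flip: exp_add exp_of_real)

lemma bump_bounds: "norm (bump s) \<le> exp 2" "norm (bump' s) \<le> 4 * exp 2"
proof -
  have e: "norm (exp 2 :: complex) = exp 2" by simp
  have f: "\<bar>flat_exp 0 x\<bar> \<le> 1" "\<bar>flat_exp 2 x\<bar> \<le> 2" for x
    using flat_exp_bounds(1)[of 0 x] flat_exp_bounds(1)[of 2 x] flat_exp_bounds(2,3)[of x] by auto
  have "norm (bump s) = exp 2 * (\<bar>flat_exp 0 (1 * s + 1)\<bar> * \<bar>flat_exp 0 ((- 1) * s + 1)\<bar>)"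
    unfolding bump_def norm_mult e norm_of_real ..
  also have "\<dots> \<le> exp 2 * (1 * 1)" by (intro mult_left_mono mult_mono f) auto
  finally show "norm (bump s) \<le> exp 2" by simp
  have "norm (bump' s) \<le> exp 2 * (\<bar>flat_exp 0 (1 * s + 1)\<bar> * \<bar>flat_exp 2 ((- 1) * s + 1)\<bar> + \<bar>flat_exp 2 (1 * s + 1)\<bar> * \<bar>flat_exp 0 ((- 1) * s + 1)\<bar>)"
    unfolding bump'_def norm_mult e
    by (rule mult_left_mono[OF order_trans[OF norm_triangle_ineq]]) (simp_all only: norm_mult norm_minus_cancel norm_of_real order_refl exp_ge_zero)
  also have "\<dots> \<le> exp 2 * (1 * 2 + 2 * 1)" by (intro mult_left_mono add_mono mult_mono f) auto
  finally show "norm (bump' s) \<le> 4 * exp 2" by simp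
qed

lemma bump_support: "1 < \<bar>s\<bar> \<Longrightarrow> bump s = 0" "1 < \<bar>s\<bar> \<Longrightarrow> bump' s = 0"
  by (auto simp: bump_def bump'_def flat_exp_def abs_if split: if_splits)

definition window :: "nat \<Rightarrow> space \<Rightarrow> complex" where
  "window n = tensor (\<lambda>i s. bump (s / real (Suc n)))"

text \<open>The partial derivative of \<open>window n\<close> in direction j. The chain rule
  contributes a factor 1/(n+1), which makes the terms containing it vanish in the limit.\<close>

definition window' :: "3 \<Rightarrow> nat \<Rightarrow> space \<Rightarrow> complex" where
  "window' j n = tensor (\<lambda>i s. if i = j then bump' (s / real (Suc n)) / of_nat (Suc n) else bump (s / real (Suc n)))"

lemma cis_inner_tensor: "cis (- (x \<bullet> \<xi>)) = tensor (\<lambda>i s. cis (- \<xi> $ i * s)) x"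
proof -
  have "- (x \<bullet> \<xi>) = (\<Sum>i\<in>UNIV. - \<xi> $ i * x $ i)"
    by (simp add: inner_vec_def sum_negf mult.commute)
  then show ?thesis unfolding tensor_def by (simp only: cis_sum finite_class.finite_UNIV)
qed

lemma tensor_mult: "tensor u x * tensor v x = tensor (\<lambda>i s. u i s * v i s) x"
  by (simp add: tensor_def prod.distrib)

lemma window_support:
  assumes "real (Suc n) * 2 < norm x" shows "window n x = 0" "window' j n x = 0"
proof -
  \<comment> \<open>If all three coordinates were at most n + 1 in modulus, the norm would be at
    most sqrt 3 times n + 1, and 2 bounds sqrt 3.\<close>
  have "\<exists>i. real (Suc n) < \<bar>x $ i\<bar>"
  proof (rule ccontr)
    assume "\<nexists>i. real (Suc n) < \<bar>x $ i\<bar>"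
    then have le: "\<bar>x $ i\<bar> \<le> real (Suc n)" for i by (simp add: not_less)
    have "(norm x)\<^sup>2 = (\<Sum>i\<in>UNIV. \<bar>x $ i\<bar>\<^sup>2)" by (simp add: norm_power2_vec3)
    also have "\<dots> \<le> (\<Sum>i\<in>(UNIV::3 set). (real (Suc n))\<^sup>2)" by (intro sum_mono power_mono le) auto
    also have "\<dots> \<le> (real (Suc n) * 2)\<^sup>2" by (simp add: power_mult_distrib del: of_nat_Suc)
    finally have "norm x \<le> real (Suc n) * 2" by (rule power2_le_imp_le) simp
    with assms show False by simp
  qed
  then obtain i where "1 < \<bar>x $ i / real (Suc n)\<bar>" by (auto simp: field_simps)
  note b = bump_support[OF this]
  have "\<exists>i\<in>UNIV. bump (x $ i / real (Suc n)) = 0"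
    "\<exists>i\<in>UNIV. (if i = j then bump' (x $ i / real (Suc n)) / of_nat (Suc n) else bump (x $ i / real (Suc n))) = 0"
    using b by (auto simp del: of_nat_Suc intro!: bexI[of _ i])
  then show "window n x = 0" "window' j n x = 0"
    unfolding window_def window'_def tensor_def by (auto intro: prod_zero)
qed

lemma window_bounds: "norm (window n x) \<le> (exp 2) ^ 3" "norm (window' j n x) \<le> 4 * (exp 2) ^ 3 / real (Suc n)"
proof -
  show "norm (window n x) \<le> (exp 2) ^ 3"
    unfolding window_def tensor_def prod_norm[symmetric]
    using prod_mono[of UNIV "\<lambda>i::3. norm (bump (x $ i / real (Suc n)))" "\<lambda>_. exp 2"] bump_bounds(1) by simp
  have "norm (window' j n x) \<le> (\<Prod>i\<in>UNIV. if i = j then 4 * exp 2 / real (Suc n) else exp 2)"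
    unfolding window'_def tensor_def prod_norm[symmetric]
    by (intro prod_mono) (auto simp: norm_divide bump_bounds simp del: of_nat_Suc intro!: divide_right_mono)
  also have "\<dots> = 4 * exp 2 / real (Suc n) * (\<Prod>i\<in>UNIV - {j}. exp 2)"
    by (subst prod.remove[of _ j]) (auto intro!: prod.cong)
  also have "\<dots> = 4 * (exp 2) ^ 3 / real (Suc n)" by (simp add: card_Diff_singleton power3_eq_cube power2_eq_square)
  finally show "norm (window' j n x) \<le> 4 * (exp 2) ^ 3 / real (Suc n)" .
qed

lemma window_tendsto: "(\<lambda>n. window n x) \<longlonglongrightarrow> 1"
proof -
  have c: "isCont bump s" for s
    using has_vector_derivative_continuous[OF bump_derivative] by simp
  have "(\<lambda>n. bump (x $ i / real (Suc n))) \<longlonglongrightarrow> bump 0" for i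
    by (rule isCont_tendsto_compose[OF c]) (rule LIMSEQ_Suc[OF lim_const_over_n])
  then have "(\<lambda>n. \<Prod>i\<in>UNIV. bump (x $ i / real (Suc n))) \<longlonglongrightarrow> (\<Prod>i\<in>(UNIV::3 set). 1)"
    by (intro tendsto_prod) (simp add: bump_0)
  then show ?thesis by (simp add: window_def tensor_def)
qed

lemma window_scaled_derivative:
  "((\<lambda>s. bump (s / real (Suc n))) has_vector_derivative bump' (s / real (Suc n)) / of_nat (Suc n)) (at s)"
proof -
  have "((\<lambda>s. s / real (Suc n)) has_vector_derivative 1 / real (Suc n)) (at s)"
    by (auto intro!: derivative_eq_intros simp: has_real_derivative_iff_has_vector_derivative[symmetric])
  from vector_diff_chain_at[OF this bump_derivative] show ?thesis
    by (simp add: o_def scaleR_conv_of_real)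
qed

lemma window_measurable [measurable]: "window n \<in> borel_measurable borel" "window' j n \<in> borel_measurable borel"
proof -
  have "continuous_on UNIV (tensor u)" if "\<And>i. continuous_on UNIV (u i)" for u
    using C_times_tensor[of 0 u] that by simp
  moreover have "continuous_on UNIV bump" using smooth1_0[OF bump_smooth] .
  moreover have "continuous_on UNIV bump'"
  proof -
    have "isCont (flat_exp n) s" for n s using DERIV_isCont[OF flat_exp_derivative] .
    then have "continuous_on UNIV (flat_exp n)" for n by (simp add: continuous_at_imp_continuous_on)
    then have "continuous_on UNIV (\<lambda>s. flat_exp n (a * s + b))" for n a b
      by (rule continuous_on_compose2) (auto intro!: continuous_intros)
    then show ?thesis
      unfolding bump'_def[abs_def]
      by (intro continuous_on_mult continuous_on_add continuous_on_minus continuous_on_const continuous_on_of_real)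
  qed
  ultimately have b: "continuous_on UNIV (\<lambda>s. bump (s / real (Suc n)))" "continuous_on UNIV (\<lambda>s. bump' (s / real (Suc n)) / of_nat (Suc n))"
    and t: "\<And>u. (\<And>i. continuous_on UNIV (u i)) \<Longrightarrow> continuous_on UNIV (tensor u)"
    by (auto intro!: continuous_on_divide continuous_intros intro: continuous_on_compose2[of UNIV bump] continuous_on_compose2[of UNIV bump'] simp del: of_nat_Suc)
  have c: "continuous_on UNIV (\<lambda>s. if i = j then bump' (s / real (Suc n)) / of_nat (Suc n) else bump (s / real (Suc n)))" for i
    using b by (cases "i = j") (simp_all del: of_nat_Suc)
  show "window n \<in> borel_measurable borel" "window' j n \<in> borel_measurable borel"
    unfolding window_def window'_def by (rule borel_measurable_continuous_onI, rule t, rule b c)+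
qed

text \<open>The test function is the character $e^{-ix\cdot\xi}$ times a window, so that the weak formulation
  becomes an identity between Fourier integrals.\<close>

lemma test_function_character_window:
  "test_function (\<lambda>x. cis (- (x \<bullet> \<xi>)) * window n x)"
  "partial_deriv j (\<lambda>x. cis (- (x \<bullet> \<xi>)) * window n x) x
     = - \<i> * of_real (\<xi> $ j) * (cis (- (x \<bullet> \<xi>)) * window n x) + cis (- (x \<bullet> \<xi>)) * window' j n x"
proof -
  define u where "u i s = cis (- \<xi> $ i * s) * bump (s / real (Suc n))" for i :: 3 and s
  define u' where "u' i s = (- \<i> * of_real (\<xi> $ i)) * (cis (- \<xi> $ i * s) * bump (s / real (Suc n)))
     + cis (- \<xi> $ i * s) * (bump' (s / real (Suc n)) / of_nat (Suc n))" for i :: 3 and s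
  have eq: "(\<lambda>x. cis (- (x \<bullet> \<xi>)) * window n x) = tensor u"
    unfolding cis_inner_tensor window_def tensor_mult u_def ..
  have der: "(u i has_vector_derivative u' i s) (at s)" for i s
    using has_vector_derivative_mult[OF cis_vector_derivative[of "- \<xi> $ i" s] window_scaled_derivative[of n s]]
    unfolding u_def[abs_def] u'_def by (simp add: algebra_simps)
  show "test_function (\<lambda>x. cis (- (x \<bullet> \<xi>)) * window n x)"
    unfolding eq
  proof (rule test_function_tensor[of _ "real (Suc n)"])
    show "smooth1 k (u i)" for i k unfolding u_def[abs_def]
      using smooth1_mult[OF smooth1_cis[of k 1 "- \<xi> $ i"] smooth1_affine[OF bump_smooth, of k "1 / real (Suc n)" 0]] by simp
    show "u i s = 0" if "real (Suc n) < \<bar>s\<bar>" for i s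
      using that by (simp add: u_def bump_support field_simps)
  qed
  have "partial_deriv j (tensor u) x = tensor (u(j := u' j)) x"
    by (simp only: partial_deriv_tensor[of u u', OF der])
  also have "\<dots> = u' j (x $ j) * (\<Prod>k\<in>UNIV - {j}. u k (x $ k))"
    unfolding tensor_def by (subst prod.remove[of UNIV j]) (auto intro!: prod.cong)
  also have "\<dots> = (- \<i> * of_real (\<xi> $ j)) * (u j (x $ j) * (\<Prod>k\<in>UNIV - {j}. u k (x $ k)))
     + cis (- \<xi> $ j * x $ j) * (bump' (x $ j / real (Suc n)) / of_nat (Suc n)) * (\<Prod>k\<in>UNIV - {j}. u k (x $ k))"
    unfolding u'_def u_def[of j] by (simp only: distrib_right mult.assoc)
  also have "u j (x $ j) * (\<Prod>k\<in>UNIV - {j}. u k (x $ k)) = tensor u x"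
    unfolding tensor_def by (subst prod.remove[of UNIV j]) auto
  also have "cis (- \<xi> $ j * x $ j) * (bump' (x $ j / real (Suc n)) / of_nat (Suc n)) * (\<Prod>k\<in>UNIV - {j}. u k (x $ k))
     = cis (- (x \<bullet> \<xi>)) * window' j n x"
    unfolding cis_inner_tensor window'_def tensor_mult
    unfolding tensor_def by (subst prod.remove[of UNIV j]) (auto intro!: prod.cong simp: u_def)
  finally show "partial_deriv j (\<lambda>x. cis (- (x \<bullet> \<xi>)) * window n x) x
     = - \<i> * of_real (\<xi> $ j) * (cis (- (x \<bullet> \<xi>)) * window n x) + cis (- (x \<bullet> \<xi>)) * window' j n x"
    unfolding eq[symmetric] .
qed

lemma window_mult:
  assumes f: "in_Lp 2 f"
  shows "in_Lp 2 (\<lambda>x. f x * window n x)" "integrable lborel (\<lambda>x. f x * window n x)"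
    "in_Lp 2 (\<lambda>x. f x * window' j n x)" "integrable lborel (\<lambda>x. f x * window' j n x)"
proof -
  have [measurable]: "f \<in> borel_measurable borel" using f by auto
  define B :: real where "B = 4 * (exp 2) ^ 3"
  have B: "norm (window n x) \<le> B" "norm (window' j n x) \<le> B" for x
  proof -
    show "norm (window n x) \<le> B" unfolding B_def using window_bounds(1)[of n x] by (smt (verit) zero_le_power exp_ge_zero)
    have "4 * (exp 2) ^ 3 / real (Suc n) \<le> 4 * (exp (2::real)) ^ 3" by (simp add: divide_le_eq)
    then show "norm (window' j n x) \<le> B" unfolding B_def using window_bounds(2)[of j n x] by linarith
  qed
  have "0 \<le> B" by (simp add: B_def)
  have *: "in_Lp 2 (\<lambda>x. f x * v x)" "integrable lborel (\<lambda>x. f x * v x)"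
    if [measurable]: "v \<in> borel_measurable borel" and v: "\<And>x. norm (v x) \<le> B" "\<And>x. real (Suc n) * 2 < norm x \<Longrightarrow> v x = 0" for v
  proof -
    have fv: "norm (f x * v x) \<le> norm (B *\<^sub>R f x)" for x
      using mult_left_mono[OF v(1)[of x] norm_ge_zero[of "f x"]] \<open>0 \<le> B\<close> by (simp add: norm_mult mult.commute)
    show "in_Lp 2 (\<lambda>x. f x * v x)"
      by (rule in_Lp_bound[OF in_Lp_scaleR[OF f, of B]]) (use fv in auto)
    show "integrable lborel (\<lambda>x. f x * v x)"
    proof (rule Bochner_Integration.integrable_bound)
      show "integrable lborel (\<lambda>x. B *\<^sub>R cutoff (real (Suc n) * 2) f x)"
        using integrable_cutoff[OF f] by simp
      show "AE x in lborel. norm (f x * v x) \<le> norm (B *\<^sub>R cutoff (real (Suc n) * 2) f x)"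
        using fv v(2) by (intro AE_I2) (auto simp: cutoff_def indicator_def not_le)
    qed measurable
  qed
  show "in_Lp 2 (\<lambda>x. f x * window n x)" "integrable lborel (\<lambda>x. f x * window n x)"
    "in_Lp 2 (\<lambda>x. f x * window' j n x)" "integrable lborel (\<lambda>x. f x * window' j n x)"
    by (rule *; use B window_support in \<open>simp add: window_measurable\<close>)+
qed

lemma window_mult_tendsto:
  assumes f: "in_Lp 2 f"
  shows "(\<lambda>n. pnorm 2 (\<lambda>x. f x * window n x - f x)) \<longlonglongrightarrow> 0" "(\<lambda>n. pnorm 2 (\<lambda>x. f x * window' j n x)) \<longlonglongrightarrow> 0"
proof -
  have [measurable]: "f \<in> borel_measurable borel" using f by auto
  define B :: real where "B = 4 * (exp 2) ^ 3"
  have B0: "0 \<le> B" by (simp add: B_def)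
  have B: "norm (window n x) \<le> B" "norm (window' j n x) \<le> B / real (Suc n)" for n x
    using window_bounds(1)[of n x] window_bounds(2)[of j n x] zero_le_power[OF exp_ge_zero[of "2::real"], of 3] unfolding B_def by linarith+
  show "(\<lambda>n. pnorm 2 (\<lambda>x. f x * window n x - f x)) \<longlonglongrightarrow> 0"
  proof (rule pnorm_dominated[OF in_Lp_scaleR[OF f, of "B + 1"]])
    show "AE x in lborel. norm (f x * window n x - f x) \<le> norm ((B + 1) *\<^sub>R f x)" for n
    proof (rule AE_I2)
      fix x
      have "norm (f x * window n x - f x) \<le> norm (f x) * norm (window n x) + norm (f x)"
        using norm_triangle_ineq4[of "f x * window n x" "f x"] by (simp add: norm_mult)
      also have "\<dots> \<le> norm (f x) * B + norm (f x)" by (intro add_right_mono mult_left_mono B) auto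
      also have "\<dots> = norm ((B + 1) *\<^sub>R f x)" unfolding norm_scaleR using B0 by (simp add: algebra_simps)
      finally show "norm (f x * window n x - f x) \<le> norm ((B + 1) *\<^sub>R f x)" .
    qed
    show "AE x in lborel. (\<lambda>n. f x * window n x - f x) \<longlonglongrightarrow> 0"
    proof (rule AE_I2)
      fix x
      have "(\<lambda>n. f x * window n x - f x) \<longlonglongrightarrow> f x * 1 - f x" by (intro tendsto_diff tendsto_mult tendsto_const window_tendsto)
      then show "(\<lambda>n. f x * window n x - f x) \<longlonglongrightarrow> 0" by simp
    qed
  qed auto
  show "(\<lambda>n. pnorm 2 (\<lambda>x. f x * window' j n x)) \<longlonglongrightarrow> 0"
  proof (rule tendsto_sandwich[OF _ _ tendsto_const])
    have "(\<lambda>n. B / real (Suc n) * pnorm 2 f) \<longlonglongrightarrow> 0 * pnorm 2 f"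
      by (intro tendsto_mult tendsto_const LIMSEQ_Suc[OF lim_const_over_n])
    then show "(\<lambda>n. \<bar>B / real (Suc n)\<bar> * pnorm 2 f) \<longlonglongrightarrow> 0" using B0 by simp
    show "\<forall>\<^sub>F n in sequentially. pnorm 2 (\<lambda>x. f x * window' j n x) \<le> \<bar>B / real (Suc n)\<bar> * pnorm 2 f"
    proof (intro always_eventually allI)
      fix n
      have "norm (f x * window' j n x) \<le> norm ((B / real (Suc n)) *\<^sub>R f x)" for x
        using mult_left_mono[OF B(2)[of n x] norm_ge_zero[of "f x"]] B0 by (simp add: norm_mult mult.commute)
      then have "pnorm 2 (\<lambda>x. f x * window' j n x) \<le> pnorm 2 (\<lambda>x. (B / real (Suc n)) *\<^sub>R f x)"
        by (intro pnorm_bound in_Lp_scaleR f) auto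
      then show "pnorm 2 (\<lambda>x. f x * window' j n x) \<le> \<bar>B / real (Suc n)\<bar> * pnorm 2 f"
        by (simp only: pnorm_scaleR pos2)
    qed
  qed auto
qed

text \<open>Testing with a character times a window gives, for each n, an exact identity at every
  frequency between three Fourier integrals. As n grows, two of them converge in L^2 to the
  transforms in question and the one with the differentiated window tends to 0.\<close>

theorem fourier_weak_gradient:
  assumes f: "in_Lp 2 f" and g: "is_weak_gradient f g" "in_Lp 2 g"
  shows "AE \<xi> in lborel. fourier (\<lambda>x. g x $ j) \<xi> = \<i> * of_real (\<xi> $ j) * fourier f \<xi>"
proof -
  have gj: "in_Lp 2 (\<lambda>x. g x $ j)" by (rule in_Lp_nth[OF g(2)])
  let ?F = "\<lambda>n. ft (\<lambda>x. f x * window n x)" and ?G = "\<lambda>n. ft (\<lambda>x. g x $ j * window n x)"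
    and ?H = "\<lambda>n. ft (\<lambda>x. f x * window' j n x)"
  have key: "\<i> * of_real (\<xi> $ j) * ?F n \<xi> = ?G n \<xi> + ?H n \<xi>" for n \<xi>
  proof -
    note t = test_function_character_window(1)[of \<xi> n] test_function_character_window(2)[of j \<xi> n]
    have i: "integrable lborel (\<lambda>x. cis (- (x \<bullet> \<xi>)) * (f x * window n x))"
       "integrable lborel (\<lambda>x. cis (- (x \<bullet> \<xi>)) * (f x * window' j n x))"
      by (intro integrable_cis_mult window_mult f; measurable)+
    have "(LBINT x. f x * partial_deriv j (\<lambda>x. cis (- (x \<bullet> \<xi>)) * window n x) x)
        = - (LBINT x. g x $ j * (cis (- (x \<bullet> \<xi>)) * window n x))"
      using g(1) t(1) unfolding is_weak_gradient_def by blast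
    also have "(LBINT x. f x * partial_deriv j (\<lambda>x. cis (- (x \<bullet> \<xi>)) * window n x) x)
       = (LBINT x. - \<i> * of_real (\<xi> $ j) * (cis (- (x \<bullet> \<xi>)) * (f x * window n x)) + cis (- (x \<bullet> \<xi>)) * (f x * window' j n x))"
      unfolding t(2) by (intro Bochner_Integration.integral_cong refl) (simp add: algebra_simps)
    also have "\<dots> = - \<i> * of_real (\<xi> $ j) * (LBINT x. cis (- (x \<bullet> \<xi>)) * (f x * window n x)) + (LBINT x. cis (- (x \<bullet> \<xi>)) * (f x * window' j n x))"
      by (subst Bochner_Integration.integral_add) (simp_all only: integrable_mult_right i integral_mult_right_zero)
    also have "(LBINT x. g x $ j * (cis (- (x \<bullet> \<xi>)) * window n x)) = (LBINT x. cis (- (x \<bullet> \<xi>)) * (g x $ j * window n x))"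
      by (intro Bochner_Integration.integral_cong refl) (simp add: algebra_simps)
    finally have "\<i> * of_real (\<xi> $ j) * (LBINT x. cis (- (x \<bullet> \<xi>)) * (f x * window n x))
      = (LBINT x. cis (- (x \<bullet> \<xi>)) * (g x $ j * window n x)) + (LBINT x. cis (- (x \<bullet> \<xi>)) * (f x * window' j n x))"
      by (simp add: algebra_simps add_eq_0_iff)
    then show ?thesis unfolding ft_def by (simp flip: scaleR_right_distrib)
  qed
  have F: "in_Lp 2 (?F n)" "in_Lp 2 (?G n)" "in_Lp 2 (?H n)" for n
    by (intro plancherel_L1_L2 window_mult f gj)+
  have limF: "(\<lambda>n. pnorm 2 (\<lambda>\<xi>. ?F n \<xi> - fourier f \<xi>)) \<longlonglongrightarrow> 0" by (intro fourier_approx window_mult window_mult_tendsto f)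
  have limG: "(\<lambda>n. pnorm 2 (\<lambda>\<xi>. ?G n \<xi> - fourier (\<lambda>x. g x $ j) \<xi>)) \<longlonglongrightarrow> 0" by (intro fourier_approx window_mult window_mult_tendsto gj)
  have limH: "(\<lambda>n. pnorm 2 (\<lambda>\<xi>. ?H n \<xi> - 0)) \<longlonglongrightarrow> 0"
    using window_mult_tendsto(2)[OF f, of j] by (simp add: plancherel_L1_L2(2) window_mult f)
  \<comment> \<open>Multiplication by a frequency coordinate is unbounded on L^2, so the limit is
    taken pointwise, along nested subsequences that serve all three terms.\<close>
  obtain r where r: "strict_mono r" "AE \<xi> in lborel. (\<lambda>n. ?F (r n) \<xi>) \<longlonglongrightarrow> fourier f \<xi>"
    using pnorm_AE_subseq[OF F(1) in_Lp_fourier[OF f] _ limF] by auto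
  obtain s where s: "strict_mono s" "AE \<xi> in lborel. (\<lambda>n. ?G (r (s n)) \<xi>) \<longlonglongrightarrow> fourier (\<lambda>x. g x $ j) \<xi>"
    using pnorm_AE_subseq[OF F(2) in_Lp_fourier[OF gj] _ LIMSEQ_subseq_LIMSEQ[OF limG r(1), unfolded o_def]] by auto
  obtain q where q: "strict_mono q" "AE \<xi> in lborel. (\<lambda>n. ?H (r (s (q n))) \<xi>) \<longlonglongrightarrow> 0"
    using pnorm_AE_subseq[OF F(3) in_Lp_zero _ LIMSEQ_subseq_LIMSEQ[OF LIMSEQ_subseq_LIMSEQ[OF limH r(1)] s(1), unfolded o_def]] by auto
  from r(2) s(2) q(2) show ?thesis
  proof eventually_elim
    case (elim \<xi>)
    have 1: "(\<lambda>n. \<i> * of_real (\<xi> $ j) * ?F (r (s (q n))) \<xi>) \<longlonglongrightarrow> \<i> * of_real (\<xi> $ j) * fourier f \<xi>"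
      using LIMSEQ_subseq_LIMSEQ[OF elim(1) strict_mono_o[OF s(1) q(1)]] by (intro tendsto_mult tendsto_const) (simp add: o_def)
    have 2: "(\<lambda>n. ?G (r (s (q n))) \<xi> + ?H (r (s (q n))) \<xi>) \<longlonglongrightarrow> fourier (\<lambda>x. g x $ j) \<xi> + 0"
      using LIMSEQ_subseq_LIMSEQ[OF elim(2) q(1)] by (intro tendsto_add elim(3)) (simp add: o_def)
    from LIMSEQ_unique[OF 1[unfolded key] 2] show ?case by simp
  qed
qed

section \<open>Integration by parts against characters\<close>

lemma integrable_indicator_cball:
  "integrable lborel (indicator (cball (0::space) r) :: space \<Rightarrow> real)"
  using emeasure_bounded_finite[of "cball (0::space) r"] by (intro integrable_real_indicator) auto

text \<open>Difference quotients have integral 0 by translation invariance; the mean value bound and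
  the compact support dominate them on the way to the derivative.\<close>

lemma integral_partial_deriv_zero:
  fixes f :: "space \<Rightarrow> complex"
  assumes der: "\<And>x. (f has_derivative D x) (at x)"
    and cont: "continuous_on UNIV (\<lambda>x. D x (axis j 1))"
    and supp': "\<forall>x. R < norm x \<longrightarrow> f x = 0"
  shows "(LBINT x. D x (axis j 1)) = 0"
proof -
  have supp: "f x = 0" if "R < norm x" for x using supp' that by blast
  let ?e = "axis j (1::real) :: space"
  have e: "norm ?e = 1" by simp
  have fc: "continuous_on UNIV f" using der by (meson continuous_at_imp_continuous_on has_derivative_continuous)
  have [measurable]: "f \<in> borel_measurable borel" using fc by (rule borel_measurable_continuous_onI)
  have [measurable]: "(\<lambda>x. D x ?e) \<in> borel_measurable borel" using cont by (rule borel_measurable_continuous_onI)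
  \<comment> \<open>Quotients with step at most 1 vanish outside radius R + 1, and inside it they
    involve derivatives at points of norm at most R + 2.\<close>
  obtain B where B: "\<And>x. norm x \<le> R + 2 \<Longrightarrow> norm (D x ?e) \<le> B" and B0: "0 \<le> B"
  proof -
    have "bounded ((\<lambda>x. D x ?e) ` cball 0 (R + 2))"
      by (intro compact_imp_bounded compact_continuous_image continuous_on_subset[OF cont]) auto
    then obtain B where "\<forall>x\<in>cball 0 (R + 2). norm (D x ?e) \<le> B" by (auto simp: bounded_iff)
    then show ?thesis by (intro that[of "max 0 B"]) (auto simp: le_max_iff_disj)
  qed
  obtain C where C: "\<And>x. norm x \<le> R \<Longrightarrow> norm (f x) \<le> C"
  proof -
    have "bounded (f ` cball 0 R)"
      by (intro compact_imp_bounded compact_continuous_image continuous_on_subset[OF fc]) auto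
    then obtain C where "\<forall>x\<in>cball 0 R. norm (f x) \<le> C" by (auto simp: bounded_iff)
    then show ?thesis by (intro that[of C]) auto
  qed
  note ball = integrable_indicator_cball
  have fi: "integrable lborel f"
  proof (rule Bochner_Integration.integrable_bound)
    show "integrable lborel (\<lambda>x::space. C *\<^sub>R indicator (cball 0 R) x :: real)" by (intro integrable_scaleR_right ball)
    show "AE x in lborel. norm (f x) \<le> norm (C *\<^sub>R indicator (cball 0 R) x :: real)"
    proof (rule AE_I2)
      fix x
      show "norm (f x) \<le> norm (C *\<^sub>R indicator (cball 0 R) x :: real)"
        using C[of x] supp[of x] by (cases "norm x \<le> R") auto
    qed
  qed measurable
  define h where "h n = 1 / real (Suc n)" for n
  have h: "0 < h n" "h n \<le> 1" for n by (auto simp: h_def)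
  have h0: "h \<longlonglongrightarrow> 0" unfolding h_def by (rule LIMSEQ_Suc[OF lim_1_over_n])
  define q where "q n x = (f (x + h n *\<^sub>R ?e) - f x) /\<^sub>R h n" for n x
  have [measurable]: "q n \<in> borel_measurable borel" for n unfolding q_def by measurable
  have "(\<lambda>n. LBINT x. q n x) \<longlonglongrightarrow> (LBINT x. D x ?e)"
  proof (rule integral_dominated_convergence[where w="\<lambda>x. B *\<^sub>R indicator (cball 0 (R + 1)) x"])
    show "integrable lborel (\<lambda>x::space. B *\<^sub>R indicator (cball 0 (R + 1)) x :: real)" by (intro integrable_scaleR_right ball)
    show "AE x in lborel. (\<lambda>n. q n x) \<longlonglongrightarrow> D x ?e"
    proof (rule AE_I2)
      fix x
      have lin: "bounded_linear (D x)" using has_derivative_bounded_linear[OF der] .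
      have "((\<lambda>y. norm (f (x + y) - f x - D x y) / norm y) \<longlongrightarrow> 0) (at 0)"
        using der[of x] by (simp add: has_derivative_at)
      moreover have "filterlim (\<lambda>n. h n *\<^sub>R ?e) (at 0) sequentially"
      proof (rule filterlim_atI)
        have "(\<lambda>n. h n *\<^sub>R ?e) \<longlonglongrightarrow> 0 *\<^sub>R ?e" by (intro tendsto_scaleR h0 tendsto_const)
        then show "(\<lambda>n. h n *\<^sub>R ?e) \<longlonglongrightarrow> 0" by simp
        show "\<forall>\<^sub>F n in sequentially. h n *\<^sub>R ?e \<noteq> 0" using h(1) by (intro always_eventually allI) (metis e less_irrefl norm_zero scaleR_eq_0_iff zero_neq_one)
      qed
      ultimately have lim: "(\<lambda>n. norm (f (x + h n *\<^sub>R ?e) - f x - D x (h n *\<^sub>R ?e)) / norm (h n *\<^sub>R ?e)) \<longlonglongrightarrow> 0"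
        by (rule filterlim_compose)
      have "norm (f (x + h n *\<^sub>R ?e) - f x - D x (h n *\<^sub>R ?e)) / norm (h n *\<^sub>R ?e) = norm (q n x - D x ?e)" for n
      proof -
        have "q n x - D x ?e = (f (x + h n *\<^sub>R ?e) - f x - D x (h n *\<^sub>R ?e)) /\<^sub>R h n"
          using h(1)[of n] by (simp add: q_def linear_scale[OF bounded_linear.linear[OF lin]] scaleR_diff_right)
        then show ?thesis using h(1)[of n] by (simp add: divide_inverse_commute)
      qed
      then show "(\<lambda>n. q n x) \<longlonglongrightarrow> D x ?e" using lim by (simp add: tendsto_norm_zero_iff LIM_zero_iff)
    qed
    show "AE x in lborel. norm (q n x) \<le> B *\<^sub>R indicator (cball 0 (R + 1)) x" for n
    proof (rule AE_I2)
      fix x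
      have hn: "norm (h n *\<^sub>R ?e) \<le> 1" using h[of n] by simp
      show "norm (q n x) \<le> B *\<^sub>R indicator (cball 0 (R + 1)) x"
      proof (cases "norm x \<le> R + 1")
        case False
        then have "R < norm (x + h n *\<^sub>R ?e)" using hn norm_triangle_ineq2[of x "- (h n *\<^sub>R ?e)"] by simp
        then show ?thesis using False supp[of x] supp[of "x + h n *\<^sub>R ?e"] by (simp add: q_def)
      next
        case True
        have "norm (f (x + h n *\<^sub>R ?e) - f (x + 0 *\<^sub>R ?e)) \<le> B * norm (h n - 0)"
        proof (rule differentiable_bound[where S="{0..h n}" and f="\<lambda>s. f (x + s *\<^sub>R ?e)" and f'="\<lambda>s t. D (x + s *\<^sub>R ?e) (t *\<^sub>R ?e)"])
          fix s assume s: "s \<in> {0..h n}"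
          have "((\<lambda>s. x + s *\<^sub>R ?e) has_derivative (\<lambda>t. t *\<^sub>R ?e)) (at s within {0..h n})"
            by (auto intro!: derivative_eq_intros)
          from has_derivative_compose[OF this der]
          show "((\<lambda>s. f (x + s *\<^sub>R ?e)) has_derivative (\<lambda>t. D (x + s *\<^sub>R ?e) (t *\<^sub>R ?e))) (at s within {0..h n})" .
          have "norm (x + s *\<^sub>R ?e) \<le> R + 2"
            using norm_triangle_ineq[of x "s *\<^sub>R ?e"] s h(2)[of n] True by simp
          then have Db: "norm (D (x + s *\<^sub>R ?e) ?e) \<le> B" by (rule B)
          have "D (x + s *\<^sub>R ?e) (t *\<^sub>R ?e) = t *\<^sub>R D (x + s *\<^sub>R ?e) ?e" for t
            by (rule linear_scale[OF bounded_linear.linear[OF has_derivative_bounded_linear[OF der]]])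
          then show "onorm (\<lambda>t. D (x + s *\<^sub>R ?e) (t *\<^sub>R ?e)) \<le> B"
            using mult_right_mono[OF Db abs_ge_zero] by (intro onorm_bound B0) (simp add: mult.commute)
        qed (use h(1)[of n] in auto)
        moreover have "norm (q n x) = norm (f (x + h n *\<^sub>R ?e) - f x) / h n"
          using h(1)[of n] by (simp add: q_def divide_inverse_commute)
        ultimately have "norm (q n x) \<le> B" using h(1)[of n] by (simp add: pos_divide_le_eq)
        then show ?thesis using True by simp
      qed
    qed
  qed measurable
  moreover have "(LBINT x. q n x) = 0" for n
    unfolding q_def using fi lborel_integral_translate[of f "h n *\<^sub>R ?e"] by simp
  ultimately show ?thesis by (simp add: LIMSEQ_const_iff)
qed

lemma test_functionD:
  assumes "test_function \<eta>"
  shows "(\<eta> has_derivative frechet_derivative \<eta> (at x)) (at x)" "continuous_on UNIV (partial_deriv j \<eta>)"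
    "continuous_on UNIV \<eta>" "\<exists>R. \<forall>x. R < norm x \<longrightarrow> \<eta> x = 0"
proof -
  have "C_times (Suc 0) \<eta>" "C_times 0 \<eta>" using assms unfolding test_function_def by blast+
  then show "(\<eta> has_derivative frechet_derivative \<eta> (at x)) (at x)" "continuous_on UNIV (partial_deriv j \<eta>)" "continuous_on UNIV \<eta>"
    by (auto simp: frechet_derivative_works[symmetric])
  obtain K where K: "compact K" "\<And>x. x \<notin> K \<Longrightarrow> \<eta> x = 0" using assms by (auto simp: test_function_def)
  obtain R where "\<And>x. x \<in> K \<Longrightarrow> norm x \<le> R" using compact_imp_bounded[OF K(1)] by (auto simp: bounded_iff)
  then have "\<forall>x. R < norm x \<longrightarrow> \<eta> x = 0" using K(2) by force
  then show "\<exists>R. \<forall>x. R < norm x \<longrightarrow> \<eta> x = 0" by blast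
qed

lemma partial_deriv_zero_outside:
  assumes "\<forall>x. R < norm x \<longrightarrow> \<eta> x = 0" "R < norm x"
  shows "partial_deriv j \<eta> x = 0"
proof -
  have "((\<lambda>x. 0) has_derivative (\<lambda>_. 0)) (at x)" by simp
  then have "(\<eta> has_derivative (\<lambda>_. 0)) (at x)"
  proof (rule has_derivative_transform_within_open)
    show "open (- cball (0::space) R)" by (rule open_Compl) simp
  qed (use assms in auto)
  from partial_deriv_eq[OF this] show ?thesis .
qed

lemma continuous_compact_support_L1_L2:
  fixes f :: "space \<Rightarrow> complex"
  assumes c: "continuous_on UNIV f" and supp: "\<forall>x. R < norm x \<longrightarrow> f x = 0"
  shows "integrable lborel f" "in_Lp 2 f"
proof -
  have [measurable]: "f \<in> borel_measurable borel" using c by (rule borel_measurable_continuous_onI)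
  have "bounded (f ` cball 0 R)"
    by (intro compact_imp_bounded compact_continuous_image continuous_on_subset[OF c]) auto
  then obtain C where "\<forall>x\<in>cball 0 R. norm (f x) \<le> C" by (auto simp: bounded_iff)
  then have C: "norm (f x) \<le> C" if "norm x \<le> R" for x using that by simp
  note ball = integrable_indicator_cball
  have le: "norm (f x) \<le> norm (C *\<^sub>R indicator (cball 0 R) x :: real)" for x
    using C[of x] supp by (cases "norm x \<le> R") auto
  show "integrable lborel f"
    by (rule Bochner_Integration.integrable_bound[of _ "\<lambda>x::space. C *\<^sub>R indicator (cball 0 R) x :: real"])
       (use le in \<open>auto intro!: ball\<close>)
  have 1: "in_Lp 2 (indicator (cball (0::space) R) :: space \<Rightarrow> real)"
  proof (rule in_LpI)
    have "(\<lambda>x::space. norm (indicator (cball 0 R) x :: real) ^ 2) = indicator (cball 0 R)"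
      by (auto simp: indicator_def)
    then show "integrable lborel (\<lambda>x::space. norm (indicator (cball 0 R) x :: real) ^ 2)" using ball by simp
  qed (rule borel_measurable_indicator, simp)
  show "in_Lp 2 f" by (rule in_Lp_bound[OF in_Lp_scaleR[OF 1, of C]], measurable, rule AE_I2, rule le)
qed

text \<open>Stated at \<open>- \<xi>\<close>, where the Fourier integral is that of the inverse
  transform.\<close>

lemma integration_by_parts_character:
  assumes t: "test_function \<eta>"
  shows "ft (partial_deriv j \<eta>) (- \<xi>) = - \<i> * of_real (\<xi> $ j) * ft \<eta> (- \<xi>)"
proof -
  obtain R where R: "\<forall>x. R < norm x \<longrightarrow> \<eta> x = 0" using test_functionD(4)[OF t] by auto
  have pR: "\<forall>x. R < norm x \<longrightarrow> partial_deriv j \<eta> x = 0" using partial_deriv_zero_outside[OF R] by blast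
  note i = continuous_compact_support_L1_L2(1)[OF test_functionD(3)[OF t] R] continuous_compact_support_L1_L2(1)[OF test_functionD(2)[OF t] pR]
  define D where "D x h = cis (x \<bullet> \<xi>) * frechet_derivative \<eta> (at x) h + ((h \<bullet> \<xi>) *\<^sub>R (\<i> * cis (x \<bullet> \<xi>))) * \<eta> x" for x h
  have dc: "((\<lambda>x. cis (x \<bullet> \<xi>)) has_derivative (\<lambda>h. (h \<bullet> \<xi>) *\<^sub>R (\<i> * cis (x \<bullet> \<xi>)))) (at x)" for x
  proof -
    have 1: "((\<lambda>x. x \<bullet> \<xi>) has_derivative (\<lambda>h. h \<bullet> \<xi>)) (at x)" by (auto intro!: derivative_eq_intros)
    have 2: "(cis has_derivative (\<lambda>t. t *\<^sub>R (\<i> * cis s))) (at s)" for s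
      using cis_vector_derivative[of 1 s] by (simp add: has_vector_derivative_def)
    from has_derivative_compose[OF 1 2] show ?thesis .
  qed
  have De: "D x (axis j 1) = cis (x \<bullet> \<xi>) * partial_deriv j \<eta> x + \<i> * of_real (\<xi> $ j) * (cis (x \<bullet> \<xi>) * \<eta> x)" for x
    by (simp add: D_def partial_deriv_def inner_axis' scaleR_conv_of_real)
  have "(LBINT x. D x (axis j 1)) = 0"
  proof (rule integral_partial_deriv_zero[where f="\<lambda>x. cis (x \<bullet> \<xi>) * \<eta> x"])
    show "((\<lambda>x. cis (x \<bullet> \<xi>) * \<eta> x) has_derivative D x) (at x)" for x
      unfolding D_def[abs_def] by (rule has_derivative_mult[OF dc test_functionD(1)[OF t]])
    have "continuous_on UNIV (\<lambda>x::space. cis (x \<bullet> \<xi>))" by (intro continuous_intros)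
    then show "continuous_on UNIV (\<lambda>x. D x (axis j 1))"
      unfolding De by (intro continuous_on_add continuous_on_mult continuous_on_const test_functionD(2,3)[OF t])
    show "\<forall>x. R < norm x \<longrightarrow> cis (x \<bullet> \<xi>) * \<eta> x = 0" using R by simp
  qed
  also have "(LBINT x. D x (axis j 1)) = (LBINT x. cis (x \<bullet> \<xi>) * partial_deriv j \<eta> x) + \<i> * of_real (\<xi> $ j) * (LBINT x. cis (x \<bullet> \<xi>) * \<eta> x)"
    unfolding De
    by (subst Bochner_Integration.integral_add)
       (auto intro!: integrable_cis_mult i integrable_mult_right)
  finally have "(LBINT x. cis (x \<bullet> \<xi>) * partial_deriv j \<eta> x) = - (\<i> * of_real (\<xi> $ j) * (LBINT x. cis (x \<bullet> \<xi>) * \<eta> x))"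
    by (simp add: add_eq_0_iff2)
  then show ?thesis by (simp add: ft_def)
qed

lemma inverse_fourier_mult_formula:
  assumes f: "in_Lp 2 f" and g: "in_Lp 2 g"
  shows "(LBINT x. inverse_fourier f x * g x) = (LBINT \<xi>. f \<xi> * inverse_fourier g \<xi>)"
proof -
  have m [measurable]: "f \<in> borel_measurable borel" "g \<in> borel_measurable borel" "fourier f \<in> borel_measurable borel"
    "fourier g \<in> borel_measurable borel" "fourier (\<lambda>x. g (- x)) \<in> borel_measurable borel"
    using f g in_Lp_fourier[OF f] in_Lp_fourier[OF g] in_Lp_fourier[OF in_Lp_reflect[OF g]] by auto
  have "(LBINT x. inverse_fourier f x * g x) = (LBINT x. fourier f x * g (- x))"
    using lborel_integral_uminus(1)[of "\<lambda>x. fourier f x * g (- x)"] by (simp add: inverse_fourier_def)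
  also have "\<dots> = (LBINT x. f x * fourier (\<lambda>x. g (- x)) x)"
    by (rule fourier_mult_formula[OF f in_Lp_reflect[OF g]])
  also have "\<dots> = (LBINT x. f x * inverse_fourier g x)"
    unfolding inverse_fourier_def
    by (rule integral_cong_AE) (measurable, measurable, use fourier_reflect[OF g] in auto)
  finally show ?thesis .
qed

text \<open>Converse to \<open>fourier_weak_gradient\<close>: the transform is moved onto the test
  function, for which integration by parts is classical, and then moved back.\<close>

lemma weak_gradient_of_fourier:
  assumes f: "in_Lp 2 f" and Ff: "\<And>j. in_Lp 2 (\<lambda>\<xi>. \<i> * of_real (\<xi> $ j) * fourier f \<xi>)"
  shows "is_weak_gradient f (\<lambda>x. \<chi> j. inverse_fourier (\<lambda>\<xi>. \<i> * of_real (\<xi> $ j) * fourier f \<xi>) x)" (is "is_weak_gradient f ?g")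
    "in_Lp 2 (\<lambda>x. \<chi> j. inverse_fourier (\<lambda>\<xi>. \<i> * of_real (\<xi> $ j) * fourier f \<xi>) x)"
proof -
  note F = in_Lp_fourier[OF f]
  have gj: "in_Lp 2 (inverse_fourier (\<lambda>\<xi>. \<i> * of_real (\<xi> $ j) * fourier f \<xi>))" for j
    by (rule in_Lp_inverse_fourier[OF Ff])
  have gm: "?g \<in> borel_measurable borel"
    by (rule borel_measurable_vec3) (use gj in auto)
  show g: "in_Lp 2 ?g" by (rule integrable_norm_vec3(1)[OF gm]) (use gj in simp)
  have parts: "(LBINT x. f x * partial_deriv j \<eta> x) = - (LBINT x. ?g x $ j * \<eta> x)" if t: "test_function \<eta>" for \<eta> j
  proof -
    obtain R where R: "\<forall>x. R < norm x \<longrightarrow> \<eta> x = 0" using test_functionD(4)[OF t] by auto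
    have pR: "\<forall>x. R < norm x \<longrightarrow> partial_deriv j \<eta> x = 0" using partial_deriv_zero_outside[OF R] by blast
    note L = continuous_compact_support_L1_L2[OF test_functionD(3)[OF t] R]
    note pL = continuous_compact_support_L1_L2[OF test_functionD(2)[OF t] pR]
    have m [measurable]: "f \<in> borel_measurable borel" "fourier f \<in> borel_measurable borel"
      "inverse_fourier (fourier f) \<in> borel_measurable borel" "partial_deriv j \<eta> \<in> borel_measurable borel"
      "\<eta> \<in> borel_measurable borel" "inverse_fourier \<eta> \<in> borel_measurable borel" "inverse_fourier (partial_deriv j \<eta>) \<in> borel_measurable borel"
      using f F in_Lp_inverse_fourier[OF F] L pL in_Lp_inverse_fourier[OF L(2)] in_Lp_inverse_fourier[OF pL(2)] by auto
    have "(LBINT x. f x * partial_deriv j \<eta> x) = (LBINT x. inverse_fourier (fourier f) x * partial_deriv j \<eta> x)"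
      by (rule integral_cong_AE) (measurable, measurable, use inverse_fourier_fourier[OF f] in \<open>auto elim!: eventually_mono\<close>)
    also have "\<dots> = (LBINT \<xi>. fourier f \<xi> * inverse_fourier (partial_deriv j \<eta>) \<xi>)"
      by (rule inverse_fourier_mult_formula[OF F pL(2)])
    also have "\<dots> = (LBINT \<xi>. - (\<i> * of_real (\<xi> $ j) * fourier f \<xi> * inverse_fourier \<eta> \<xi>))"
    proof (rule integral_cong_AE)
      show "(\<lambda>\<xi>. - (\<i> * of_real (\<xi> $ j) * fourier f \<xi> * inverse_fourier \<eta> \<xi>)) \<in> borel_measurable lborel"
        using in_L2_mult_integrable[OF Ff in_Lp_inverse_fourier[OF L(2)]] by auto
      show "AE \<xi> in lborel. fourier f \<xi> * inverse_fourier (partial_deriv j \<eta>) \<xi> = - (\<i> * of_real (\<xi> $ j) * fourier f \<xi> * inverse_fourier \<eta> \<xi>)"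
        using inverse_fourier_eq_ft[OF L] inverse_fourier_eq_ft[OF pL]
        by eventually_elim (simp add: integration_by_parts_character[OF t])
    qed measurable
    also have "\<dots> = - (LBINT \<xi>. (\<i> * of_real (\<xi> $ j) * fourier f \<xi>) * inverse_fourier \<eta> \<xi>)" by simp
    also have "(LBINT \<xi>. (\<i> * of_real (\<xi> $ j) * fourier f \<xi>) * inverse_fourier \<eta> \<xi>)
       = (LBINT x. inverse_fourier (\<lambda>\<xi>. \<i> * of_real (\<xi> $ j) * fourier f \<xi>) x * \<eta> x)"
      by (rule inverse_fourier_mult_formula[OF Ff L(2), symmetric])
    finally show ?thesis by simp
  qed
  show "is_weak_gradient f ?g"
    unfolding is_weak_gradient_def using L2_set_integrable_compact[OF f] L2_set_integrable_compact[OF g] gm parts by simp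
qed

text \<open>A scalar stand-in for the gradient on the Fourier side: its modulus is that of the
  vector i xi times the transform, so Plancherel gives it the L^2 norm of the weak gradient.\<close>

definition fgrad :: "(space \<Rightarrow> complex) \<Rightarrow> space \<Rightarrow> complex" where
  "fgrad f \<xi> = norm \<xi> *\<^sub>R fourier f \<xi>"

lemma fgrad_components:
  assumes f: "in_Lp 2 f"
  shows "in_Lp 2 (fgrad f) \<longleftrightarrow> (\<forall>j. in_Lp 2 (\<lambda>\<xi>. \<i> * of_real (\<xi> $ j) * fourier f \<xi>))"
    "in_Lp 2 (fgrad f) \<Longrightarrow> pnorm 2 (fgrad f) ^ 2 = (\<Sum>j\<in>UNIV. pnorm 2 (\<lambda>\<xi>. \<i> * of_real (\<xi> $ j) * fourier f \<xi>) ^ 2)"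
proof -
  have [measurable]: "fourier f \<in> borel_measurable borel" using in_Lp_fourier[OF f] by auto
  have nth [measurable]: "(\<lambda>\<xi>::space. \<xi> $ j) \<in> borel_measurable borel" for j
    by (intro borel_measurable_continuous_onI continuous_intros)
  let ?V = "\<lambda>\<xi>. \<chi> j. \<i> * of_real (\<xi> $ j) * fourier f \<xi>"
  have Vm: "?V \<in> borel_measurable borel" by (rule borel_measurable_vec3) measurable
  have nV: "norm (?V \<xi>) = norm (fgrad f \<xi>)" for \<xi>
  proof (rule power2_eq_imp_eq)
    show "(norm (?V \<xi>))\<^sup>2 = (norm (fgrad f \<xi>))\<^sup>2"
      by (simp add: norm_power2_vec3[of "?V \<xi>"] fgrad_def norm_mult power_mult_distrib norm_power2_vec3[of \<xi>] sum_distrib_right)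
  qed auto
  have fm [measurable]: "fgrad f \<in> borel_measurable borel" unfolding fgrad_def[abs_def] by measurable
  have eq: "in_Lp 2 ?V \<longleftrightarrow> in_Lp 2 (fgrad f)" "pnorm 2 ?V = pnorm 2 (fgrad f)"
    using Vm fm by (simp_all add: in_Lp_def pnorm_def nV)
  show iff: "in_Lp 2 (fgrad f) \<longleftrightarrow> (\<forall>j. in_Lp 2 (\<lambda>\<xi>. \<i> * of_real (\<xi> $ j) * fourier f \<xi>))"
    unfolding eq(1)[symmetric] using in_Lp_nth[of ?V] integrable_norm_vec3(1)[OF Vm] by auto
  show "pnorm 2 (fgrad f) ^ 2 = (\<Sum>j\<in>UNIV. pnorm 2 (\<lambda>\<xi>. \<i> * of_real (\<xi> $ j) * fourier f \<xi>) ^ 2)" if "in_Lp 2 (fgrad f)"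
    using integrable_norm_vec3(2)[OF Vm] that unfolding iff eq(2) by simp
qed

text \<open>The form in which membership in H^1 enters the estimates below.\<close>

theorem in_H1_iff_fourier: "in_H1 f \<longleftrightarrow> in_Lp 2 f \<and> in_Lp 2 (fgrad f)"
proof
  assume "in_H1 f"
  then obtain g where f: "in_Lp 2 f" and g: "is_weak_gradient f g" "in_Lp 2 g" by (auto simp: in_H1_def in_L2_iff)
  have "in_Lp 2 (\<lambda>\<xi>. \<i> * of_real (\<xi> $ j) * fourier f \<xi>)" for j
  proof (rule in_Lp_AE_cong)
    show "in_Lp 2 (fourier (\<lambda>x. g x $ j))" by (intro in_Lp_fourier in_Lp_nth g)
    show "AE \<xi> in lborel. \<i> * of_real (\<xi> $ j) * fourier f \<xi> = fourier (\<lambda>x. g x $ j) \<xi>"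
      using fourier_weak_gradient[OF f g, of j] by auto
    have [measurable]: "fourier f \<in> borel_measurable borel" using in_Lp_fourier[OF f] by auto
    have [measurable]: "(\<lambda>\<xi>::space. \<xi> $ j) \<in> borel_measurable borel"
      by (intro borel_measurable_continuous_onI continuous_intros)
    show "(\<lambda>\<xi>. \<i> * of_real (\<xi> $ j) * fourier f \<xi>) \<in> borel_measurable borel" by measurable
  qed
  with f show "in_Lp 2 f \<and> in_Lp 2 (fgrad f)" by (simp add: fgrad_components)
next
  assume "in_Lp 2 f \<and> in_Lp 2 (fgrad f)"
  then show "in_H1 f"
    using weak_gradient_of_fourier[of f] fgrad_components(1)[of f] unfolding in_H1_def in_L2_iff by blast
qed

theorem integral_weak_gradient:
  assumes "in_H1 f"
  shows "(LBINT x. (norm (weak_gradient f x))\<^sup>2) = pnorm 2 (fgrad f) ^ 2"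
proof -
  obtain g where f: "in_Lp 2 f" and g: "is_weak_gradient f g" "in_Lp 2 g" using assms by (auto simp: in_H1_def in_L2_iff)
  have w: "is_weak_gradient f (weak_gradient f)" unfolding weak_gradient_def by (rule someI[of _ g]) (rule g(1))
  have m: "weak_gradient f \<in> borel_measurable borel" "g \<in> borel_measurable borel" using w g by (auto simp: is_weak_gradient_def)
  have "(LBINT x. (norm (weak_gradient f x))\<^sup>2) = pnorm 2 (weak_gradient f) ^ 2" by (simp add: pnorm_power)
  \<comment> \<open>Uniqueness replaces the representative picked by \<open>SOME\<close> with the
    one known to be in L^2.\<close>
  also have "pnorm 2 (weak_gradient f) = pnorm 2 g" by (rule pnorm_AE_cong[OF weak_gradient_unique[OF w g(1)] m])
  also have "pnorm 2 g ^ 2 = (\<Sum>j\<in>UNIV. pnorm 2 (\<lambda>x. g x $ j) ^ 2)"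
    by (rule integrable_norm_vec3(2)[OF m(2) in_Lp_nth[OF g(2)]])
  also have "\<dots> = (\<Sum>j\<in>UNIV. pnorm 2 (\<lambda>\<xi>. \<i> * of_real (\<xi> $ j) * fourier f \<xi>) ^ 2)"
  proof (intro sum.cong refl)
    fix j
    have "pnorm 2 (\<lambda>x. g x $ j) = pnorm 2 (fourier (\<lambda>x. g x $ j))" by (rule plancherel[OF in_Lp_nth[OF g(2)], symmetric])
    also have "\<dots> = pnorm 2 (\<lambda>\<xi>. \<i> * of_real (\<xi> $ j) * fourier f \<xi>)"
    proof (rule pnorm_AE_cong[OF fourier_weak_gradient[OF f g]])
      show "fourier (\<lambda>x. g x $ j) \<in> borel_measurable borel" using in_Lp_fourier[OF in_Lp_nth[OF g(2)]] by auto
      have "in_Lp 2 (fgrad f)" using assms by (simp add: in_H1_iff_fourier)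
      then show "(\<lambda>\<xi>. \<i> * of_real (\<xi> $ j) * fourier f \<xi>) \<in> borel_measurable borel" using fgrad_components(1)[OF f] by auto
    qed
    finally show "pnorm 2 (\<lambda>x. g x $ j) ^ 2 = pnorm 2 (\<lambda>\<xi>. \<i> * of_real (\<xi> $ j) * fourier f \<xi>) ^ 2" by simp
  qed
  also have "\<dots> = pnorm 2 (fgrad f) ^ 2" using assms by (intro fgrad_components(2)[symmetric]) (simp_all add: in_H1_iff_fourier)
  finally show ?thesis .
qed

lemma Hdot_norm_1: "(Hdot_norm 1 f)\<^sup>2 = pnorm 2 (fgrad f) ^ 2"
proof -
  have "norm \<xi> powr (2 * 1) * (norm (fourier f \<xi>))\<^sup>2 = norm (fgrad f \<xi>) ^ 2" for \<xi>
    by (cases "\<xi> = 0") (simp_all add: fgrad_def power_mult_distrib)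
  then show ?thesis by (simp add: Hdot_norm_def pnorm_power)
qed

lemma in_H1_schrodinger:
  assumes "in_H1 f" shows "in_H1 (schrodinger t f)"
    and "pnorm 2 (fgrad (schrodinger t f)) = pnorm 2 (fgrad f)"
proof -
  have f: "in_Lp 2 f" and F: "in_Lp 2 (fgrad f)" using assms by (auto simp: in_H1_iff_fourier)
  note s = in_Lp_schrodinger[OF f, of t]
  have [measurable]: "fourier (schrodinger t f) \<in> borel_measurable borel" "fourier f \<in> borel_measurable borel"
    using in_Lp_fourier[OF s] in_Lp_fourier[OF f] by auto
  have m: "fgrad (schrodinger t f) \<in> borel_measurable borel" "fgrad f \<in> borel_measurable borel"
    unfolding fgrad_def[abs_def] by measurable
  have n: "AE \<xi> in lborel. norm (fgrad (schrodinger t f) \<xi>) = norm (fgrad f \<xi>)"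
    using fourier_schrodinger[OF f, of t] by eventually_elim (simp add: fgrad_def norm_mult)
  have "in_Lp 2 (fgrad (schrodinger t f))"
    by (rule in_Lp_bound[OF F m(1)]) (use n in auto)
  then show "in_H1 (schrodinger t f)" using s by (simp add: in_H1_iff_fourier)
  have "pnorm 2 (\<lambda>\<xi>. norm (fgrad (schrodinger t f) \<xi>)) = pnorm 2 (\<lambda>\<xi>. norm (fgrad f \<xi>))"
    by (rule pnorm_AE_cong[OF n]) (use m in auto)
  then show "pnorm 2 (fgrad (schrodinger t f)) = pnorm 2 (fgrad f)" by simp
qed

lemma energy_eq:
  assumes "in_H1 f"
  shows "energy f = 1 / 2 * (Hdot_norm 1 f)\<^sup>2 - 1 / 4 * pnorm 4 f ^ 4"
  by (simp add: energy_def integral_weak_gradient[OF assms] Hdot_norm_1 pnorm_power)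

section \<open>The Sobolev inequality\<close>

lemma nn_integral_monomial_Icc:
  assumes "0 \<le> a"
  shows "(\<integral>\<^sup>+s. (if 0 \<le> s \<and> s \<le> a then ennreal (real (Suc n) * s ^ n) else 0) \<partial>lborel) = ennreal (a ^ Suc n)"
proof -
  have "(\<integral>\<^sup>+s. (if 0 \<le> s \<and> s \<le> a then ennreal (real (Suc n) * s ^ n) else 0) \<partial>lborel)
     = (\<integral>\<^sup>+s. ennreal (real (Suc n) * s ^ n) * indicator {0..a} s \<partial>lborel)"
    by (intro nn_integral_cong) (auto simp: indicator_def)
  also have "\<dots> = ennreal (a ^ Suc n - 0 ^ Suc n)"
  proof (rule nn_integral_FTC_Icc)
    show "DERIV (\<lambda>s. s ^ Suc n) x :> real (Suc n) * x ^ n" for x :: real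
      using DERIV_pow[of "Suc n" x] by simp
  qed (use assms in auto)
  finally show ?thesis by simp
qed

lemma inverse_square_layer:
  assumes "0 < a"
  shows "(\<integral>\<^sup>+s. (if a \<le> s then ennreal (2 / s ^ 3) else 0) \<partial>lborel) = ennreal (1 / a\<^sup>2)"
proof -
  have "(\<integral>\<^sup>+s. (if a \<le> s then ennreal (2 / s ^ 3) else 0) \<partial>lborel) = (\<integral>\<^sup>+s. ennreal (2 / s ^ 3) * indicator {a..} s \<partial>lborel)"
    by (intro nn_integral_cong) (auto simp: indicator_def)
  also have "\<dots> = ennreal (0 - (- (1 / a\<^sup>2)))"
  proof (rule nn_integral_FTC_atLeast)
    show "DERIV (\<lambda>s. - (1 / s\<^sup>2)) x :> 2 / x ^ 3" if "a \<le> x" for x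
      using that assms by (auto intro!: derivative_eq_intros simp: power2_eq_square power3_eq_cube field_simps)
    show "0 \<le> 2 / x ^ 3" if "a \<le> x" for x using that assms by simp
    have "((\<lambda>s::real. inverse (s\<^sup>2)) \<longlongrightarrow> 0) at_top"
      by (intro tendsto_inverse_0_at_top filterlim_pow_at_top filterlim_ident) auto
    from tendsto_minus[OF this] show "((\<lambda>s::real. - (1 / s\<^sup>2)) \<longlongrightarrow> 0) at_top" by (simp add: inverse_eq_divide)
  qed measurable
  finally show ?thesis by simp
qed

text \<open>With this constant, \<open>sobK * R\<close> is the value 4 pi R of the integral of
  1/|xi|^2 over the ball of radius R: two volumes of the unit ball come from the layers s <= R, one
  from those beyond R.\<close>

definition sobK :: real where "sobK = 3 * unit_ball_vol 3"

lemma sobK_pos: "0 < sobK" by (simp add: sobK_def)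

text \<open>By layer cake, $|\xi|^{-2} = \int_{|\xi|}^\infty 2 s^{-3}\,ds$.\<close>

lemma inverse_square_integral:
  assumes R: "0 < R"
  shows "(\<integral>\<^sup>+\<xi>. (if norm (\<xi>::space) \<le> R then ennreal (1 / (norm \<xi>)\<^sup>2) else 0) \<partial>lborel) \<le> ennreal (sobK * R)"
proof -
  let ?v = "unit_ball_vol 3"
  have "(\<integral>\<^sup>+\<xi>. (if norm (\<xi>::space) \<le> R then ennreal (1 / (norm \<xi>)\<^sup>2) else 0) \<partial>lborel)
     = (\<integral>\<^sup>+\<xi>. \<integral>\<^sup>+s. (if norm (\<xi>::space) \<le> R \<and> norm \<xi> \<le> s \<and> 0 < s then ennreal (2 / s ^ 3) else 0) \<partial>lborel \<partial>lborel)"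
  \<comment> \<open>The origin is excluded: there the left integrand is 0, by the convention on
    division by 0, while the layer integral is infinite.\<close>
  proof (rule nn_integral_cong_AE, use AE_lborel_singleton[of 0] in eventually_elim)
    case (elim \<xi>)
    then have "0 < norm \<xi>" by simp
    show ?case
    proof (cases "norm \<xi> \<le> R")
      case True
      then have "(norm \<xi> \<le> R \<and> norm \<xi> \<le> s \<and> 0 < s) \<longleftrightarrow> norm \<xi> \<le> s" for s
        using \<open>0 < norm \<xi>\<close> by linarith
      then show ?thesis using True inverse_square_layer[OF \<open>0 < norm \<xi>\<close>] by simp
    qed simp
  qed
  also have "\<dots> = (\<integral>\<^sup>+s. \<integral>\<^sup>+\<xi>. (if norm (\<xi>::space) \<le> R \<and> norm \<xi> \<le> s \<and> 0 < s then ennreal (2 / s ^ 3) else 0) \<partial>lborel \<partial>lborel)"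
    by (rule lborel_pair.Fubini'[symmetric]) measurable
  also have "\<dots> \<le> (\<integral>\<^sup>+s. (if 0 \<le> s \<and> s \<le> R then ennreal (2 * ?v) else 0) + ennreal (?v * R ^ 3) * (if R \<le> s then ennreal (2 / s ^ 3) else 0) \<partial>lborel)"
  proof (rule nn_integral_mono)
    fix s :: real
    consider "s \<le> 0" | "0 < s" "s \<le> R" | "R < s" by linarith
    then show "(\<integral>\<^sup>+\<xi>. (if norm (\<xi>::space) \<le> R \<and> norm \<xi> \<le> s \<and> 0 < s then ennreal (2 / s ^ 3) else 0) \<partial>lborel)
      \<le> (if 0 \<le> s \<and> s \<le> R then ennreal (2 * ?v) else 0) + ennreal (?v * R ^ 3) * (if R \<le> s then ennreal (2 / s ^ 3) else 0)"
    proof cases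
      case 1
      then show ?thesis by auto
    next
      case 2
      have "(\<integral>\<^sup>+\<xi>. (if norm (\<xi>::space) \<le> R \<and> norm \<xi> \<le> s \<and> 0 < s then ennreal (2 / s ^ 3) else 0) \<partial>lborel)
        = (\<integral>\<^sup>+\<xi>. ennreal (2 / s ^ 3) * indicator (cball (0::space) s) \<xi> \<partial>lborel)"
        using 2 by (intro nn_integral_cong) (auto simp: indicator_def)
      also have "\<dots> = ennreal (2 / s ^ 3) * ennreal (?v * s ^ 3)"
        using 2 by (subst nn_integral_cmult_indicator) (auto simp: emeasure_cball)
      also have "\<dots> = ennreal (2 * ?v)" using 2 by (simp add: ennreal_mult[symmetric])
      finally show ?thesis using 2 by simp
    next
      case 3
      have "(\<integral>\<^sup>+\<xi>. (if norm (\<xi>::space) \<le> R \<and> norm \<xi> \<le> s \<and> 0 < s then ennreal (2 / s ^ 3) else 0) \<partial>lborel)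
        = (\<integral>\<^sup>+\<xi>. ennreal (2 / s ^ 3) * indicator (cball (0::space) R) \<xi> \<partial>lborel)"
        using 3 R by (intro nn_integral_cong) (auto simp: indicator_def)
      also have "\<dots> = ennreal (2 / s ^ 3) * ennreal (?v * R ^ 3)"
        using 3 R by (subst nn_integral_cmult_indicator) (auto simp: emeasure_cball)
      finally show ?thesis using 3 R by (simp add: mult.commute)
    qed
  qed
  also have "\<dots> = (\<integral>\<^sup>+s. (if 0 \<le> s \<and> s \<le> R then ennreal (2 * ?v) else 0) \<partial>lborel)
     + ennreal (?v * R ^ 3) * (\<integral>\<^sup>+s. (if R \<le> s then ennreal (2 / s ^ 3) else 0) \<partial>lborel)"
    by (subst nn_integral_add) (measurable, simp add: nn_integral_cmult)
  also have "(\<integral>\<^sup>+s. (if 0 \<le> s \<and> s \<le> R then ennreal (2 * ?v) else 0) \<partial>lborel) = (\<integral>\<^sup>+s. ennreal (2 * ?v) * indicator {0..R} s \<partial>lborel)"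
    by (intro nn_integral_cong) (auto simp: indicator_def)
  also have "\<dots> = ennreal (2 * ?v * R)"
    using R by (subst nn_integral_cmult_indicator) (auto simp: ennreal_mult[symmetric])
  also have "(\<integral>\<^sup>+s. (if R \<le> s then ennreal (2 / s ^ 3) else 0) \<partial>lborel) = ennreal (1 / R\<^sup>2)"
    by (rule inverse_square_layer[OF R])
  also have "ennreal (2 * ?v * R) + ennreal (?v * R ^ 3) * ennreal (1 / R\<^sup>2) = ennreal (sobK * R)"
  proof -
    have "?v * R ^ 3 * (1 / R\<^sup>2) = ?v * R" using R by (simp add: power2_eq_square power3_eq_cube)
    then show ?thesis using R by (simp add: ennreal_mult[symmetric] sobK_def algebra_simps flip: ennreal_plus)
  qed
  finally show ?thesis .
qed

lemma inverse_fourier_bounded: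
  assumes g: "integrable lborel g" "in_Lp 2 g"
  shows "AE x in lborel. norm (inverse_fourier g x) \<le> c3 * (LBINT \<xi>. norm (g \<xi>))"
  using inverse_fourier_eq_ft[OF g] by eventually_elim (use norm_ft_le[of g] in simp)

text \<open>Cauchy-Schwarz with the weight 1/|xi|, whose square is integrable near the origin in
  three dimensions, bounds the L^1 norm of the low frequencies and hence their supremum in
  space.\<close>

lemma low_frequency_bound:
  assumes f: "in_Lp 2 f" and F: "in_Lp 2 (fgrad f)" and R: "0 < R"
  shows "AE x in lborel. norm (inverse_fourier (cutoff R (fourier f)) x) \<le> c3 * (sqrt (sobK * R) * pnorm 2 (fgrad f))"
proof -
  note Ff = in_Lp_fourier[OF f]
  have [measurable]: "fourier f \<in> borel_measurable borel" "fgrad f \<in> borel_measurable borel" using Ff F by auto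
  define w :: "space \<Rightarrow> complex" where "w \<xi> = (if norm \<xi> \<le> R then of_real (1 / norm \<xi>) else 0)" for \<xi>
  have [measurable]: "w \<in> borel_measurable borel" unfolding w_def by measurable
  have "(\<integral>\<^sup>+\<xi>. ennreal (norm (w \<xi>) ^ 2) \<partial>lborel) = (\<integral>\<^sup>+\<xi>. (if norm (\<xi>::space) \<le> R then ennreal (1 / (norm \<xi>)\<^sup>2) else 0) \<partial>lborel)"
    by (intro nn_integral_cong) (auto simp: w_def norm_divide power_divide)
  also have "\<dots> \<le> ennreal (sobK * R)" by (rule inverse_square_integral[OF R])
  finally have wle: "(\<integral>\<^sup>+\<xi>. ennreal (norm (w \<xi>) ^ 2) \<partial>lborel) \<le> ennreal (sobK * R)" .
  have w: "in_Lp 2 w"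
  proof (rule in_LpI)
    show "integrable lborel (\<lambda>\<xi>. norm (w \<xi>) ^ 2)"
      using wle by (intro integrableI_bounded) (auto intro: le_less_trans)
  qed measurable
  have "pnorm 2 w ^ 2 \<le> sobK * R"
    using wle sobK_pos R unfolding nn_integral_pnorm2[OF w] by simp
  then have wn: "pnorm 2 w \<le> sqrt (sobK * R)" by (rule real_le_rsqrt)
  have eq: "AE \<xi> in lborel. cutoff R (fourier f) \<xi> = w \<xi> * fgrad f \<xi>"
    using AE_lborel_singleton[of "0::space"] by eventually_elim (auto simp: cutoff_def w_def fgrad_def indicator_def scaleR_conv_of_real)
  have "(LBINT \<xi>. norm (cutoff R (fourier f) \<xi>)) = (LBINT \<xi>. norm (w \<xi> * fgrad f \<xi>))"
    by (rule integral_cong_AE) (use in_Lp_cutoff[OF Ff, of R] eq in \<open>auto\<close>)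
  also have "\<dots> \<le> pnorm 2 w * pnorm 2 (fgrad f)" by (rule L2_Cauchy_Schwarz[OF w F])
  also have "\<dots> \<le> sqrt (sobK * R) * pnorm 2 (fgrad f)" by (intro mult_right_mono wn) simp
  finally have "c3 * (LBINT \<xi>. norm (cutoff R (fourier f) \<xi>)) \<le> c3 * (sqrt (sobK * R) * pnorm 2 (fgrad f))"
    by (intro mult_left_mono) auto
  then have le: "norm z \<le> c3 * (sqrt (sobK * R) * pnorm 2 (fgrad f))"
    if "norm z \<le> c3 * (LBINT \<xi>. norm (cutoff R (fourier f) \<xi>))" for z :: complex
    using that by linarith
  show ?thesis
    using inverse_fourier_bounded[OF integrable_cutoff[OF Ff] in_Lp_cutoff[OF Ff], of R]
    by eventually_elim (rule le)
qed

lemma chebyshev_L2: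
  assumes h: "in_Lp 2 h" and l: "0 < l"
  shows "(\<integral>\<^sup>+x. (if l \<le> norm (h x) then 1 else 0) \<partial>lborel) \<le> ennreal (1 / l\<^sup>2) * ennreal (pnorm 2 h ^ 2)"
proof -
  have [measurable]: "h \<in> borel_measurable borel" using h by auto
  have "(\<integral>\<^sup>+x. (if l \<le> norm (h x) then 1 else 0) \<partial>lborel) \<le> (\<integral>\<^sup>+x. ennreal (1 / l\<^sup>2) * ennreal (norm (h x) ^ 2) \<partial>lborel)"
  proof (rule nn_integral_mono)
    fix x
    have "1 \<le> 1 / l\<^sup>2 * norm (h x) ^ 2" if "l \<le> norm (h x)" using that l power_mono[OF that, of 2] by simp
    then show "(if l \<le> norm (h x) then 1 else 0) \<le> ennreal (1 / l\<^sup>2) * ennreal (norm (h x) ^ 2)"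
      by (auto simp: ennreal_mult[symmetric] simp flip: ennreal_1 intro!: ennreal_leI)
  qed
  also have "\<dots> = ennreal (1 / l\<^sup>2) * ennreal (pnorm 2 h ^ 2)"
    by (subst nn_integral_cmult) (measurable, simp add: nn_integral_pnorm2[OF h])
  finally show ?thesis .
qed

text \<open>This is 6 / k^2 * b^2 divided by b^6, for the frequency scale \<open>k\<close> of the
  next proof; 96 = 6 * 4^2.\<close>

definition sobC :: real where "sobC = 96 * c3 ^ 4 * sobK ^ 2"

text \<open>Chemin and Xu's proof: at height \<open>l\<close>, cut the frequencies at a level proportional to $l^2$, chosen so
  that the low frequencies contribute at most $l/2$; Chebyshev's inequality for the high frequencies and
  integration in \<open>l\<close> then reproduce $\int |\xi|^2 |\hat f|^2$.\<close>

lemma sobolev_nn_integral: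
  assumes f: "in_Lp 2 f" and F: "in_Lp 2 (fgrad f)" and b: "0 < b" "pnorm 2 (fgrad f) \<le> b"
  shows "(\<integral>\<^sup>+x. ennreal (norm (f x) ^ 6) \<partial>lborel) \<le> ennreal (sobC * b ^ 6)"
proof -
  note Ff = in_Lp_fourier[OF f]
  have [measurable]: "f \<in> borel_measurable borel" "fourier f \<in> borel_measurable borel" using f Ff by auto
  have c3: "0 < c3" by simp
  \<comment> \<open>\<open>k\<close> solves c3 * sqrt (sobK * (k * l^2)) * b = l / 2, which says
    that frequencies below k l^2 contribute at most l / 2.\<close>
  define k where "k = 1 / (4 * c3\<^sup>2 * b\<^sup>2 * sobK)"
  have k: "0 < k" using b sobK_pos by (simp add: k_def)
  have level: "(\<integral>\<^sup>+x. (if l \<le> norm (f x) then 1 else 0) \<partial>lborel)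
     \<le> ennreal (4 / l\<^sup>2) * (\<integral>\<^sup>+\<xi>. (if k * l\<^sup>2 \<le> norm \<xi> then ennreal (norm (fourier f \<xi>) ^ 2) else 0) \<partial>lborel)" if l: "0 < l" for l
  proof -
    define R where "R = k * l\<^sup>2"
    have R: "0 < R" using k l by (simp add: R_def)
    define g where "g \<xi> = fourier f \<xi> - cutoff R (fourier f) \<xi>" for \<xi>
    have g: "in_Lp 2 g" unfolding g_def[abs_def] by (intro in_Lp_diff Ff in_Lp_cutoff)
    note ig = in_Lp_inverse_fourier[OF g]
    have [measurable]: "g \<in> borel_measurable borel" "inverse_fourier g \<in> borel_measurable borel" using g ig by auto
    have low: "c3 * (sqrt (sobK * R) * pnorm 2 (fgrad f)) \<le> l / 2"
    proof -
      have "sobK * R = (l / (2 * c3 * b))\<^sup>2"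
        using sobK_pos b by (simp add: R_def k_def power_divide power_mult_distrib)
      then have "sqrt (sobK * R) = l / (2 * c3 * b)" using l b by simp
      then have "c3 * (sqrt (sobK * R) * pnorm 2 (fgrad f)) = l / 2 * (pnorm 2 (fgrad f) / b)" using b by simp
      also have "\<dots> \<le> l / 2 * 1" using l b by (intro mult_left_mono) auto
      finally show ?thesis by simp
    qed
    have "AE x in lborel. l \<le> norm (f x) \<longrightarrow> l / 2 \<le> norm (inverse_fourier g x)"
      using low_frequency_bound[OF f F R] inverse_fourier_fourier[OF f] inverse_fourier_diff[OF Ff in_Lp_cutoff[OF Ff, of R]]
    proof eventually_elim
      case (elim x)
      have "f x = inverse_fourier g x + inverse_fourier (cutoff R (fourier f)) x"
        using elim(2,3) unfolding g_def[abs_def] by simp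
      then have "norm (f x) \<le> norm (inverse_fourier g x) + norm (inverse_fourier (cutoff R (fourier f)) x)"
        by (simp add: norm_triangle_ineq)
      with elim(1) low show ?case by linarith
    qed
    then have "(\<integral>\<^sup>+x. (if l \<le> norm (f x) then 1 else 0) \<partial>lborel) \<le> (\<integral>\<^sup>+x. (if l / 2 \<le> norm (inverse_fourier g x) then 1 else 0) \<partial>lborel)"
      by (intro nn_integral_mono_AE) (auto elim!: eventually_mono)
    also have "\<dots> \<le> ennreal (1 / (l / 2)\<^sup>2) * ennreal (pnorm 2 (inverse_fourier g) ^ 2)"
      using l by (intro chebyshev_L2 ig) simp
    also have "ennreal (pnorm 2 (inverse_fourier g) ^ 2) = (\<integral>\<^sup>+\<xi>. ennreal (norm (g \<xi>) ^ 2) \<partial>lborel)"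
      by (simp add: pnorm_inverse_fourier g nn_integral_pnorm2)
    also have "\<dots> \<le> (\<integral>\<^sup>+\<xi>. (if k * l\<^sup>2 \<le> norm \<xi> then ennreal (norm (fourier f \<xi>) ^ 2) else 0) \<partial>lborel)"
      by (intro nn_integral_mono) (auto simp: g_def cutoff_def indicator_def R_def)
    finally show ?thesis by (simp add: power_divide mult_left_mono)
  qed
  have "(\<integral>\<^sup>+x. ennreal (norm (f x) ^ 6) \<partial>lborel)
     = (\<integral>\<^sup>+x. \<integral>\<^sup>+l. (if 0 \<le> l \<and> l \<le> norm (f x) then ennreal (6 * l ^ 5) else 0) \<partial>lborel \<partial>lborel)"
  proof (rule nn_integral_cong)
    fix x
    show "ennreal (norm (f x) ^ 6) = (\<integral>\<^sup>+l. (if 0 \<le> l \<and> l \<le> norm (f x) then ennreal (6 * l ^ 5) else 0) \<partial>lborel)"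
    proof -
      have e: "Suc 5 = 6" "real 6 = 6" by simp_all
      show ?thesis using nn_integral_monomial_Icc[of "norm (f x)" 5] unfolding e by simp
    qed
  qed
  also have "\<dots> = (\<integral>\<^sup>+l. \<integral>\<^sup>+x. (if 0 \<le> l \<and> l \<le> norm (f x) then ennreal (6 * l ^ 5) else 0) \<partial>lborel \<partial>lborel)"
    by (rule lborel_pair.Fubini'[symmetric]) measurable
  also have "\<dots> \<le> (\<integral>\<^sup>+l. \<integral>\<^sup>+\<xi>. (if 0 \<le> l \<and> k * l\<^sup>2 \<le> norm \<xi> then ennreal (24 * l ^ 3) * ennreal (norm (fourier f \<xi>) ^ 2) else 0) \<partial>lborel \<partial>lborel)"
  proof (rule nn_integral_mono)
    fix l :: real
    show "(\<integral>\<^sup>+x. (if 0 \<le> l \<and> l \<le> norm (f x) then ennreal (6 * l ^ 5) else 0) \<partial>lborel)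
      \<le> (\<integral>\<^sup>+\<xi>. (if 0 \<le> l \<and> k * l\<^sup>2 \<le> norm \<xi> then ennreal (24 * l ^ 3) * ennreal (norm (fourier f \<xi>) ^ 2) else 0) \<partial>lborel)"
    proof (cases "0 < l")
      case True
      have "(\<integral>\<^sup>+x. (if 0 \<le> l \<and> l \<le> norm (f x) then ennreal (6 * l ^ 5) else 0) \<partial>lborel)
        = (\<integral>\<^sup>+x. ennreal (6 * l ^ 5) * (if l \<le> norm (f x) then 1 else 0) \<partial>lborel)"
        using True by (intro nn_integral_cong) auto
      also have "\<dots> = ennreal (6 * l ^ 5) * (\<integral>\<^sup>+x. (if l \<le> norm (f x) then 1 else 0) \<partial>lborel)"
        by (rule nn_integral_cmult) measurable
      also have "\<dots> \<le> ennreal (6 * l ^ 5) * (ennreal (4 / l\<^sup>2) * (\<integral>\<^sup>+\<xi>. (if k * l\<^sup>2 \<le> norm \<xi> then ennreal (norm (fourier f \<xi>) ^ 2) else 0) \<partial>lborel))"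
        by (intro mult_left_mono level True) simp
      also have "\<dots> = ennreal (24 * l ^ 3) * (\<integral>\<^sup>+\<xi>. (if k * l\<^sup>2 \<le> norm \<xi> then ennreal (norm (fourier f \<xi>) ^ 2) else 0) \<partial>lborel)"
      proof -
        have "6 * l ^ 5 * (4 / l\<^sup>2) = 24 * l ^ 3" using True by (simp add: field_simps eval_nat_numeral)
        then show ?thesis using True by (simp add: mult.assoc[symmetric] ennreal_mult[symmetric])
      qed
      also have "\<dots> = (\<integral>\<^sup>+\<xi>. ennreal (24 * l ^ 3) * (if k * l\<^sup>2 \<le> norm \<xi> then ennreal (norm (fourier f \<xi>) ^ 2) else 0) \<partial>lborel)"
        by (rule nn_integral_cmult[symmetric]) measurable
      also have "\<dots> = (\<integral>\<^sup>+\<xi>. (if 0 \<le> l \<and> k * l\<^sup>2 \<le> norm \<xi> then ennreal (24 * l ^ 3) * ennreal (norm (fourier f \<xi>) ^ 2) else 0) \<partial>lborel)"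
        using True by (intro nn_integral_cong) auto
      finally show ?thesis .
    next
      case False
      then have "l = 0 \<or> l < 0" by auto
      then show ?thesis by (auto simp: zero_power)
    qed
  qed
  also have "\<dots> = (\<integral>\<^sup>+\<xi>. \<integral>\<^sup>+l. (if 0 \<le> l \<and> k * l\<^sup>2 \<le> norm \<xi> then ennreal (24 * l ^ 3) * ennreal (norm (fourier f \<xi>) ^ 2) else 0) \<partial>lborel \<partial>lborel)"
    by (rule lborel_pair.Fubini') measurable
  \<comment> \<open>For fixed xi the layers reach up to a with a^2 = |xi| / k, and 24 l^3 integrates
    to 6 a^4; this restores the weight |xi|^2.\<close>
  also have "\<dots> = (\<integral>\<^sup>+\<xi>. ennreal (6 / k\<^sup>2) * ennreal (norm (fgrad f \<xi>) ^ 2) \<partial>lborel)"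
  proof (rule nn_integral_cong)
    fix \<xi> :: space
    define a where "a = sqrt (norm \<xi> / k)"
    have a: "0 \<le> a" using k by (simp add: a_def)
    have iff: "0 \<le> l \<and> k * l\<^sup>2 \<le> norm \<xi> \<longleftrightarrow> 0 \<le> l \<and> l \<le> a" for l
    proof -
      have "k * l\<^sup>2 \<le> norm \<xi> \<longleftrightarrow> l\<^sup>2 \<le> norm \<xi> / k" using k by (simp add: field_simps)
      then show ?thesis unfolding a_def using real_le_rsqrt real_sqrt_le_mono[of "l\<^sup>2" "norm \<xi> / k"] by (auto simp: real_le_rsqrt) (metis k real_sqrt_le_iff real_sqrt_abs abs_of_nonneg)
    qed
    have "(\<integral>\<^sup>+l. (if 0 \<le> l \<and> k * l\<^sup>2 \<le> norm \<xi> then ennreal (24 * l ^ 3) * ennreal (norm (fourier f \<xi>) ^ 2) else 0) \<partial>lborel)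
      = (\<integral>\<^sup>+l. ennreal (6 * norm (fourier f \<xi>) ^ 2) * (if 0 \<le> l \<and> l \<le> a then ennreal (real (Suc 3) * l ^ 3) else 0) \<partial>lborel)"
      unfolding iff by (intro nn_integral_cong) (auto simp: ennreal_mult[symmetric] mult_ac)
    also have "\<dots> = ennreal (6 * norm (fourier f \<xi>) ^ 2) * ennreal (a ^ 4)"
    proof -
      have m: "(\<lambda>l. if 0 \<le> l \<and> l \<le> a then ennreal (real (Suc 3) * l ^ 3) else 0) \<in> borel_measurable lborel"
        by measurable
      have e: "a ^ Suc 3 = a ^ 4" by simp
      show ?thesis unfolding nn_integral_cmult[OF m] nn_integral_monomial_Icc[OF a] e ..
    qed
    also have "a ^ 4 = (norm \<xi> / k)\<^sup>2"
    proof -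
      have "a ^ 4 = (a\<^sup>2)\<^sup>2" by simp
      then show ?thesis using k by (simp add: a_def)
    qed
    also have "ennreal (6 * norm (fourier f \<xi>) ^ 2) * ennreal ((norm \<xi> / k)\<^sup>2) = ennreal (6 / k\<^sup>2) * ennreal (norm (fgrad f \<xi>) ^ 2)"
      by (simp add: ennreal_mult[symmetric] fgrad_def power_mult_distrib power_divide mult_ac)
    finally show "(\<integral>\<^sup>+l. (if 0 \<le> l \<and> k * l\<^sup>2 \<le> norm \<xi> then ennreal (24 * l ^ 3) * ennreal (norm (fourier f \<xi>) ^ 2) else 0) \<partial>lborel)
       = ennreal (6 / k\<^sup>2) * ennreal (norm (fgrad f \<xi>) ^ 2)" .
  qed
  also have "\<dots> = ennreal (6 / k\<^sup>2) * ennreal (pnorm 2 (fgrad f) ^ 2)"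
    using F by (subst nn_integral_cmult) (auto simp: nn_integral_pnorm2)
  also have "\<dots> \<le> ennreal (6 / k\<^sup>2) * ennreal (b\<^sup>2)"
    by (intro mult_left_mono ennreal_leI power_mono b) auto
  also have "\<dots> = ennreal (sobC * b ^ 6)"
  proof -
    have "6 / k\<^sup>2 * b\<^sup>2 = sobC * b ^ 6"
      by (simp add: k_def sobC_def power_divide power_mult_distrib)
    then show ?thesis by (simp add: ennreal_mult[symmetric])
  qed
  finally show ?thesis .
qed

text \<open>The bound b is first kept strictly above the gradient norm, because a vanishing norm
  would define no frequency scale, and is then lowered to it.\<close>

theorem sobolev:
  assumes f: "in_Lp 2 f" and F: "in_Lp 2 (fgrad f)"
  shows "in_Lp 6 f" "pnorm 6 f ^ 6 \<le> sobC * pnorm 2 (fgrad f) ^ 6"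
proof -
  let ?d = "pnorm 2 (fgrad f)"
  have le: "(\<integral>\<^sup>+x. ennreal (norm (f x) ^ 6) \<partial>lborel) \<le> ennreal (sobC * b ^ 6)" if "?d < b" for b
    using that pnorm_nonneg[of 2 "fgrad f"] by (intro sobolev_nn_integral f F) linarith+
  show 6: "in_Lp 6 f"
  proof (rule in_LpI)
    show "integrable lborel (\<lambda>x. norm (f x) ^ 6)"
      using le[of "?d + 1"] f by (intro integrableI_bounded) (auto intro: le_less_trans)
  qed (use f in auto)
  have le': "pnorm 6 f ^ 6 \<le> sobC * b ^ 6" if "?d < b" for b
    using le[OF that] 6 by (subst (asm) nn_integral_eq_integral) (auto simp: pnorm_power sobC_def)
  have "(\<lambda>n. sobC * (?d + 1 / real (Suc n)) ^ 6) \<longlonglongrightarrow> sobC * (?d + 0) ^ 6"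
    by (intro tendsto_intros LIMSEQ_Suc[OF lim_1_over_n])
  then have "pnorm 6 f ^ 6 \<le> sobC * (?d + 0) ^ 6"
    by (rule tendsto_lowerbound) (auto intro!: always_eventually le')
  then show "pnorm 6 f ^ 6 \<le> sobC * ?d ^ 6" by simp
qed

section \<open>Interpolation of L^4\<close>

lemma L4_interpolation_2_6:
  assumes "in_Lp 2 f" "in_Lp 6 f"
  shows "in_Lp 4 f" "pnorm 4 f ^ 4 \<le> pnorm 2 f ^ 2 + pnorm 6 f ^ 6"
proof -
  \<comment> \<open>An additive pointwise inequality takes the place of Hoelder's; its right side
    still becomes small together with the two norms, as the decay estimates require.\<close>
  have le: "a ^ 4 \<le> a ^ 2 + a ^ 6" for a :: real
  proof -
    have "0 \<le> (a - a ^ 3) ^ 2 + a ^ 4" by (intro add_nonneg_nonneg) auto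
    then have "0 \<le> a ^ 2 + a ^ 6 - a ^ 4" by (simp add: power2_diff power_mult_distrib eval_nat_numeral algebra_simps)
    then show ?thesis by simp
  qed
  have i: "integrable lborel (\<lambda>x. norm (f x) ^ 2 + norm (f x) ^ 6)" using assms by auto
  show 4: "in_Lp 4 f"
  proof (rule in_LpI)
    show "integrable lborel (\<lambda>x. norm (f x) ^ 4)"
      by (rule Bochner_Integration.integrable_bound[OF i]) (use assms(1) le in \<open>auto\<close>)
  qed (use assms in auto)
  have "(LBINT x. norm (f x) ^ 4) \<le> (LBINT x. norm (f x) ^ 2 + norm (f x) ^ 6)"
    by (rule integral_mono) (use 4 i le in auto)
  also have "\<dots> = (LBINT x. norm (f x) ^ 2) + (LBINT x. norm (f x) ^ 6)"
    by (rule Bochner_Integration.integral_add) (use assms in auto)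
  finally show "pnorm 4 f ^ 4 \<le> pnorm 2 f ^ 2 + pnorm 6 f ^ 6" by (simp add: pnorm_power)
qed

text \<open>Values are split at height l: a^4 <= l a^3 below it and a^4 <= a^6 / l^2 above it. The
  height stays free, so the L^6 part can be made small before the L^3 part is used.\<close>

lemma L4_interpolation_3_6:
  assumes "in_Lp 4 f" "in_Lp 3 f" "in_Lp 6 f" and l: "0 < l"
  shows "pnorm 4 f ^ 4 \<le> l * pnorm 3 f ^ 3 + pnorm 6 f ^ 6 / l ^ 2"
proof -
  have le: "a ^ 4 \<le> l * a ^ 3 + a ^ 6 / l ^ 2" if a: "0 \<le> a" for a :: real
  proof (cases "a \<le> l")
    case True
    then have "a * a ^ 3 \<le> l * a ^ 3" using a by (intro mult_right_mono) auto
    then show ?thesis using a by (simp add: eval_nat_numeral add_increasing2)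
  next
    case False
    then have "l ^ 2 * a ^ 4 \<le> a ^ 2 * a ^ 4" using l by (intro mult_right_mono power_mono) auto
    then have "a ^ 4 \<le> a ^ 6 / l ^ 2" using l by (simp add: field_simps eval_nat_numeral)
    then show ?thesis using a l by (simp add: add_increasing)
  qed
  have "(LBINT x. norm (f x) ^ 4) \<le> (LBINT x. l * norm (f x) ^ 3 + norm (f x) ^ 6 / l ^ 2)"
  proof (rule integral_mono)
    show "integrable lborel (\<lambda>x. l * norm (f x) ^ 3 + norm (f x) ^ 6 / l ^ 2)"
      by (intro Bochner_Integration.integrable_add integrable_mult_right integrable_divide in_LpD(2) assms)
  qed (use assms le in auto)
  also have "\<dots> = l * (LBINT x. norm (f x) ^ 3) + (LBINT x. norm (f x) ^ 6) / l ^ 2"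
    by (subst Bochner_Integration.integral_add) (use assms in auto)
  finally show ?thesis by (simp add: pnorm_power)
qed

lemma H1_L4:
  assumes "in_H1 f"
  shows "in_Lp 4 f" "pnorm 4 f ^ 4 \<le> pnorm 2 f ^ 2 + sobC * pnorm 2 (fgrad f) ^ 6"
proof -
  have f: "in_Lp 2 f" "in_Lp 2 (fgrad f)" using assms by (auto simp: in_H1_iff_fourier)
  note s = sobolev[OF f]
  show "in_Lp 4 f" by (rule L4_interpolation_2_6(1)[OF f(1) s(1)])
  show "pnorm 4 f ^ 4 \<le> pnorm 2 f ^ 2 + sobC * pnorm 2 (fgrad f) ^ 6"
    using L4_interpolation_2_6(2)[OF f(1) s(1)] s(2) by linarith
qed

section \<open>Dispersive decay\<close>

text \<open>Translation by \<open>a n\<close> shifts the phase by pi and so reverses the sign of the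
  exponential. Averaging the integral with its translate bounds it by half the L^1 distance between
  k and its translate, and \<open>a n\<close> tends to 0.\<close>

lemma riemann_lebesgue:
  fixes k :: "'a::euclidean_space \<Rightarrow> complex"
  assumes k: "integrable lborel k" and v: "v \<noteq> 0" and s: "filterlim (\<lambda>n. \<bar>s n\<bar>) at_top sequentially"
  shows "(\<lambda>n. LBINT \<eta>. cis (s n * (v \<bullet> \<eta>)) * k \<eta>) \<longlonglongrightarrow> 0"
proof -
  have [measurable]: "k \<in> borel_measurable borel" using k by auto
  define a where "a n = (pi / (s n * (norm v)\<^sup>2)) *\<^sub>R v" for n
  have "(\<lambda>n. inverse (\<bar>s n\<bar>)) \<longlonglongrightarrow> 0" by (rule tendsto_inverse_0_at_top[OF s])
  then have "(\<lambda>n. \<bar>inverse (s n)\<bar>) \<longlonglongrightarrow> 0" by simp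
  then have "(\<lambda>n. inverse (s n)) \<longlonglongrightarrow> 0" by (rule tendsto_rabs_zero_cancel)
  then have "(\<lambda>n. (pi * inverse ((norm v)\<^sup>2) * inverse (s n)) *\<^sub>R v) \<longlonglongrightarrow> (pi * inverse ((norm v)\<^sup>2) * 0) *\<^sub>R v"
    by (intro tendsto_scaleR tendsto_mult tendsto_const)
  moreover have "a = (\<lambda>n. (pi * inverse ((norm v)\<^sup>2) * inverse (s n)) *\<^sub>R v)"
    by (rule ext) (simp add: a_def divide_inverse mult_ac)
  ultimately have a0: "a \<longlonglongrightarrow> 0" by simp
  have lim: "(\<lambda>n. (LBINT \<eta>. norm (k (\<eta> + a n) - k \<eta>)) / 2) \<longlonglongrightarrow> 0"
    using tendsto_divide[OF translation_continuous_L1[OF k a0] tendsto_const[of 2]] by simp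
  have bound: "norm (LBINT \<eta>. cis (s n * (v \<bullet> \<eta>)) * k \<eta>) \<le> (LBINT \<eta>. norm (k (\<eta> + a n) - k \<eta>)) / 2" if sn: "s n \<noteq> 0" for n
  proof -
    have ph: "cis (s n * (v \<bullet> (\<eta> + a n))) = - cis (s n * (v \<bullet> \<eta>))" for \<eta>
    proof -
      have "s n * (v \<bullet> a n) = pi" using sn v by (simp add: a_def power2_norm_eq_inner[symmetric])
      then have "s n * (v \<bullet> (\<eta> + a n)) = s n * (v \<bullet> \<eta>) + pi" by (simp add: inner_add_right distrib_left)
      then show ?thesis by (simp add: cis_mult[symmetric])
    qed
    have ka: "integrable lborel (\<lambda>\<eta>. k (\<eta> + a n))" by (subst lborel_integral_translate(2)) (measurable, rule k)
    have ci: "integrable lborel (\<lambda>\<eta>. cis (s n * (v \<bullet> \<eta>)) * k \<eta>)" "integrable lborel (\<lambda>\<eta>. cis (s n * (v \<bullet> \<eta>)) * k (\<eta> + a n))"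
      by (intro integrable_cis_mult k ka; measurable)+
    have "(LBINT \<eta>. cis (s n * (v \<bullet> \<eta>)) * k \<eta>) = (LBINT \<eta>. cis (s n * (v \<bullet> (\<eta> + a n))) * k (\<eta> + a n))"
      by (rule lborel_integral_translate(1)[symmetric]) measurable
    also have "\<dots> = - (LBINT \<eta>. cis (s n * (v \<bullet> \<eta>)) * k (\<eta> + a n))"
      unfolding ph by simp
    finally have "2 * (LBINT \<eta>. cis (s n * (v \<bullet> \<eta>)) * k \<eta>)
      = (LBINT \<eta>. cis (s n * (v \<bullet> \<eta>)) * k \<eta>) - (LBINT \<eta>. cis (s n * (v \<bullet> \<eta>)) * k (\<eta> + a n))" by simp
    also have "\<dots> = (LBINT \<eta>. cis (s n * (v \<bullet> \<eta>)) * (k \<eta> - k (\<eta> + a n)))"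
      unfolding right_diff_distrib by (rule Bochner_Integration.integral_diff[OF ci, symmetric])
    also have "norm \<dots> \<le> (LBINT \<eta>. norm (k (\<eta> + a n) - k \<eta>))"
      using integral_norm_bound[of lborel "\<lambda>\<eta>. cis (s n * (v \<bullet> \<eta>)) * (k \<eta> - k (\<eta> + a n))"]
      by (simp add: norm_mult norm_minus_commute)
    finally show ?thesis by (simp add: norm_mult)
  qed
  have "\<forall>\<^sub>F n in sequentially. s n \<noteq> 0"
    using s[unfolded filterlim_at_top_dense, rule_format, of 0] by eventually_elim auto
  then have "\<forall>\<^sub>F n in sequentially. norm (LBINT \<eta>. cis (s n * (v \<bullet> \<eta>)) * k \<eta>) \<le> (LBINT \<eta>. norm (k (\<eta> + a n) - k \<eta>)) / 2"
    by eventually_elim (rule bound)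
  from Lim_null_comparison[OF this lim] show ?thesis .
qed

text \<open>The contribution of the frequency difference h to the square of the oscillatory
  integral; the linear phase is the part of -s (|eta + h|^2 - |eta|^2) that depends on eta.\<close>

definition correlation :: "(space \<Rightarrow> complex) \<Rightarrow> real \<Rightarrow> space \<Rightarrow> complex" where
  "correlation g s h = (LBINT \<eta>. cis (- 2 * s * (h \<bullet> \<eta>)) * (g (\<eta> + h) * cnj (g \<eta>)))"

text \<open>Squaring the oscillatory integral and substituting $\xi = \eta + h$ makes the phase linear in $\eta$,
  and the point $x$ only contributes a factor of modulus one that does not depend on $\eta$.\<close>

lemma oscillatory_bound:
  fixes g :: "space \<Rightarrow> complex"
  assumes g: "integrable lborel g"
  shows "(norm (LBINT \<xi>. cis (x \<bullet> \<xi>) * (cis (- s * (norm \<xi>)\<^sup>2) * g \<xi>)))\<^sup>2 \<le> (LBINT h. norm (correlation g s h))"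
proof -
  have [measurable]: "g \<in> borel_measurable borel" using g by auto
  define A where "A \<xi> = cis (x \<bullet> \<xi>) * (cis (- s * (norm \<xi>)\<^sup>2) * g \<xi>)" for \<xi>
  have Ai: "integrable lborel A" unfolding A_def[abs_def] by (intro integrable_cis_mult g; measurable)
  have [measurable]: "A \<in> borel_measurable borel" using Ai by auto
  have tr: "(LBINT h. A (h + \<eta>)) = (LBINT \<xi>. A \<xi>)" "(LBINT h. norm (A (h + \<eta>))) = (LBINT \<xi>. norm (A \<xi>))" for \<eta>
    by (rule lborel_integral_translate; measurable)+
  have Ait: "integrable lborel (\<lambda>h. A (h + \<eta>))" for \<eta> by (subst lborel_integral_translate(2)) (measurable, rule Ai)
  have int: "integrable (lborel \<Otimes>\<^sub>M lborel) (\<lambda>(\<eta>, h). A (h + \<eta>) * cnj (A \<eta>))"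
  proof (rule lborel_pair.Fubini_integrable)
    show "integrable lborel (\<lambda>\<eta>. LBINT h. norm (case (\<eta>, h) of (\<eta>, h) \<Rightarrow> A (h + \<eta>) * cnj (A \<eta>)))"
      using Ai by (simp add: norm_mult tr)
    show "AE \<eta> in lborel. integrable lborel (\<lambda>h. case (\<eta>, h) of (\<eta>, h) \<Rightarrow> A (h + \<eta>) * cnj (A \<eta>))"
      by (intro AE_I2) (auto intro!: integrable_mult_left Ait)
  qed measurable
  have "(LBINT \<xi>. A \<xi>) * cnj (LBINT \<xi>. A \<xi>) = (LBINT \<eta>. (LBINT h. A (h + \<eta>)) * cnj (A \<eta>))"
    by (simp add: tr)
  also have "\<dots> = (LBINT \<eta>. LBINT h. A (h + \<eta>) * cnj (A \<eta>))" by simp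
  also have "\<dots> = (LBINT h. LBINT \<eta>. A (h + \<eta>) * cnj (A \<eta>))"
    using lborel_pair.Fubini_integral[OF int] by simp
  also have "\<dots> = (LBINT h. cis (x \<bullet> h - s * (norm h)\<^sup>2) * correlation g s h)"
  proof (intro Bochner_Integration.integral_cong refl)
    fix h
    have "A (h + \<eta>) * cnj (A \<eta>) = cis (x \<bullet> h - s * (norm h)\<^sup>2) * (cis (- 2 * s * (h \<bullet> \<eta>)) * (g (\<eta> + h) * cnj (g \<eta>)))" for \<eta>
    proof -
      have "A (h + \<eta>) * cnj (A \<eta>) = cis (x \<bullet> (h + \<eta>)) * cis (- s * (norm (h + \<eta>))\<^sup>2) * cis (- (x \<bullet> \<eta>)) * cis (s * (norm \<eta>)\<^sup>2) * (g (\<eta> + h) * cnj (g \<eta>))"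
        by (simp add: A_def cis_cnj mult_ac add.commute)
      also have "cis (x \<bullet> (h + \<eta>)) * cis (- s * (norm (h + \<eta>))\<^sup>2) * cis (- (x \<bullet> \<eta>)) * cis (s * (norm \<eta>)\<^sup>2)
         = cis (x \<bullet> h - s * (norm h)\<^sup>2) * cis (- 2 * s * (h \<bullet> \<eta>))"
        unfolding cis_mult
        by (rule arg_cong[where f=cis])
           (simp add: power2_norm_eq_inner inner_add_left inner_add_right inner_commute algebra_simps)
      finally show ?thesis by (simp only: mult.assoc)
    qed
    then show "(LBINT \<eta>. A (h + \<eta>) * cnj (A \<eta>)) = cis (x \<bullet> h - s * (norm h)\<^sup>2) * correlation g s h"
      unfolding correlation_def by (simp only: integral_mult_right_zero)
  qed
  also have "norm \<dots> \<le> (LBINT h. norm (correlation g s h))"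
    using integral_norm_bound[of lborel "\<lambda>h. cis (x \<bullet> h - s * (norm h)\<^sup>2) * correlation g s h"] by (simp add: norm_mult)
  finally show ?thesis by (simp add: A_def norm_mult power2_eq_square)
qed

text \<open>For each nonzero h the phase oscillates faster and faster, and g in L^2 makes the
  amplitude integrable, so Riemann-Lebesgue applies. The dominating function of h is the
  autocorrelation of |g|, integrable since g is in L^1.\<close>

lemma correlation_tendsto:
  assumes g1: "integrable lborel g" and g2: "in_Lp 2 g" and s: "filterlim (\<lambda>n. \<bar>s n\<bar>) at_top sequentially"
  shows "(\<lambda>n. LBINT h. norm (correlation g (s n) h)) \<longlonglongrightarrow> 0"
proof -
  have [measurable]: "g \<in> borel_measurable borel" using g1 by auto
  have [measurable]: "correlation g t \<in> borel_measurable borel" for t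
    unfolding correlation_def[abs_def] by measurable
  have k: "integrable lborel (\<lambda>\<eta>. g (\<eta> + h) * cnj (g \<eta>))" for h
    by (intro in_L2_mult_integrable in_Lp_translate in_Lp_cnj g2)
  have int: "integrable (lborel \<Otimes>\<^sub>M lborel) (\<lambda>(\<eta>, h). g (\<eta> + h) * cnj (g \<eta>))"
  proof (rule lborel_pair.Fubini_integrable)
    have tr: "(LBINT h. norm (g (\<eta> + h))) = (LBINT \<xi>. norm (g \<xi>))" for \<eta>
      using lborel_integral_translate(1)[of "\<lambda>h. norm (g h)" \<eta>] by (simp add: add.commute)
    show "integrable lborel (\<lambda>\<eta>. LBINT h. norm (case (\<eta>, h) of (\<eta>, h) \<Rightarrow> g (\<eta> + h) * cnj (g \<eta>)))"
      using g1 by (simp add: norm_mult tr)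
    have "integrable lborel (\<lambda>h. g (\<eta> + h))" for \<eta>
      using lborel_integral_translate(2)[of g \<eta>] g1 by (simp add: add.commute)
    then show "AE \<eta> in lborel. integrable lborel (\<lambda>h. case (\<eta>, h) of (\<eta>, h) \<Rightarrow> g (\<eta> + h) * cnj (g \<eta>))"
      by (intro AE_I2) auto
  qed measurable
  have K: "integrable lborel (\<lambda>h. LBINT \<eta>. norm (g (\<eta> + h) * cnj (g \<eta>)))"
  proof (rule lborel_pair.integrable_snd)
    show "integrable (lborel \<Otimes>\<^sub>M lborel) (\<lambda>(\<eta>, h). norm (g (\<eta> + h) * cnj (g \<eta>)))"
      using integrable_norm[OF int] by (simp add: case_prod_unfold)
  qed
  have "(\<lambda>n. LBINT h. norm (correlation g (s n) h)) \<longlonglongrightarrow> (LINT h|(lborel::space measure). 0)"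
  proof (rule integral_dominated_convergence[OF _ _ K])
    show "AE h in lborel. norm (norm (correlation g (s n) h)) \<le> (LBINT \<eta>. norm (g (\<eta> + h) * cnj (g \<eta>)))" for n
    proof (rule AE_I2)
      fix h
      show "norm (norm (correlation g (s n) h)) \<le> (LBINT \<eta>. norm (g (\<eta> + h) * cnj (g \<eta>)))"
        unfolding correlation_def
        using integral_norm_bound[of lborel "\<lambda>\<eta>. cis (- 2 * s n * (h \<bullet> \<eta>)) * (g (\<eta> + h) * cnj (g \<eta>))"] by (simp add: norm_mult)
    qed
    show "AE h in lborel. (\<lambda>n. norm (correlation g (s n) h)) \<longlonglongrightarrow> 0"
      using AE_lborel_singleton[of 0]
    proof eventually_elim
      case (elim h)
      have "filterlim (\<lambda>n. 2 * \<bar>s n\<bar>) at_top sequentially"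
        by (rule filterlim_tendsto_pos_mult_at_top[OF tendsto_const _ s]) simp
      then have "filterlim (\<lambda>n. \<bar>- 2 * s n\<bar>) at_top sequentially" by (simp add: abs_mult)
      from tendsto_norm[OF riemann_lebesgue[OF k elim this]]
      show ?case by (simp add: correlation_def)
    qed
  qed measurable
  then show ?thesis by simp
qed

text \<open>The bound depends on G only through its modulus, so inserting the phase of the group
  leaves it unchanged: this gives estimates in L^4 that are uniform in time.\<close>

lemma inverse_fourier_H1:
  assumes G: "in_Lp 2 G" and wG: "in_Lp 2 (\<lambda>\<xi>. norm \<xi> *\<^sub>R G \<xi>)"
  shows "in_H1 (inverse_fourier G)"
    "pnorm 4 (inverse_fourier G) ^ 4 \<le> pnorm 2 G ^ 2 + sobC * pnorm 2 (\<lambda>\<xi>. norm \<xi> *\<^sub>R G \<xi>) ^ 6"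
proof -
  note u = in_Lp_inverse_fourier[OF G]
  have [measurable]: "fourier (inverse_fourier G) \<in> borel_measurable borel" "G \<in> borel_measurable borel"
    using in_Lp_fourier[OF u] G by auto
  have m: "fgrad (inverse_fourier G) \<in> borel_measurable borel" "(\<lambda>\<xi>. norm \<xi> *\<^sub>R G \<xi>) \<in> borel_measurable borel"
    unfolding fgrad_def[abs_def] by measurable
  have eq: "AE \<xi> in lborel. fgrad (inverse_fourier G) \<xi> = norm \<xi> *\<^sub>R G \<xi>"
    using fourier_inverse_fourier[OF G] by eventually_elim (simp add: fgrad_def)
  show H: "in_H1 (inverse_fourier G)"
    unfolding in_H1_iff_fourier using u in_Lp_AE_cong[OF wG m(1) eq] by simp
  show "pnorm 4 (inverse_fourier G) ^ 4 \<le> pnorm 2 G ^ 2 + sobC * pnorm 2 (\<lambda>\<xi>. norm \<xi> *\<^sub>R G \<xi>) ^ 6"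
    using H1_L4(2)[OF H] unfolding pnorm_AE_cong[OF eq m] pnorm_inverse_fourier[OF G] .
qed

lemma L4_from_sup_bound:
  assumes u: "in_Lp 2 u" and b: "AE x in lborel. (norm (u x))\<^sup>2 \<le> b" and b0: "0 \<le> b"
  shows "in_Lp 4 u" "pnorm 4 u ^ 4 \<le> b * pnorm 2 u ^ 2"
proof -
  have le: "AE x in lborel. norm (u x) ^ 4 \<le> b * norm (u x) ^ 2"
    using b
  proof eventually_elim
    case (elim x)
    have "norm (u x) ^ 4 = (norm (u x))\<^sup>2 * (norm (u x))\<^sup>2" by (simp add: eval_nat_numeral)
    also have "\<dots> \<le> b * (norm (u x))\<^sup>2" by (intro mult_right_mono elim) simp
    finally show ?case .
  qed
  have i: "integrable lborel (\<lambda>x. b * norm (u x) ^ 2)" using u by auto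
  show 4: "in_Lp 4 u"
  proof (rule in_LpI)
    show "integrable lborel (\<lambda>x. norm (u x) ^ 4)"
      by (rule Bochner_Integration.integrable_bound[OF i]) (use u le b0 in \<open>auto simp: abs_mult elim!: eventually_mono\<close>)
  qed (use u in auto)
  have "(LBINT x. norm (u x) ^ 4) \<le> (LBINT x. b * norm (u x) ^ 2)"
    by (rule integral_mono_AE) (use 4 i le in auto)
  then show "pnorm 4 u ^ 4 \<le> b * pnorm 2 u ^ 2" by (simp add: pnorm_power)
qed

lemma tendsto_pnorm4:
  assumes "(\<lambda>n. pnorm 4 (u n) ^ 4) \<longlonglongrightarrow> 0"
  shows "(\<lambda>n. pnorm 4 (u n)) \<longlonglongrightarrow> 0"
  using tendsto_real_root[OF assms, of 4] by (simp add: real_root_power_cancel)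

text \<open>The supremum in space tends to 0 while the L^2 norm is conserved; L^4 lies between the
  two.\<close>

lemma low_frequency_decay:
  assumes G1: "integrable lborel G" and G2: "in_Lp 2 G" and s: "filterlim (\<lambda>n. \<bar>s n\<bar>) at_top sequentially"
  shows "(\<lambda>n. pnorm 4 (inverse_fourier (\<lambda>\<xi>. cis (- s n * (norm \<xi>)\<^sup>2) * G \<xi>))) \<longlonglongrightarrow> 0"
proof (rule tendsto_pnorm4)
  let ?u = "\<lambda>n. inverse_fourier (\<lambda>\<xi>. cis (- s n * (norm \<xi>)\<^sup>2) * G \<xi>)"
  let ?b = "\<lambda>n. LBINT h. norm (correlation G (s n) h)"
  have le: "pnorm 4 (?u n) ^ 4 \<le> c3\<^sup>2 * ?b n * pnorm 2 G ^ 2" for n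
  proof -
    note P2 = in_Lp_phase[OF G2, of "s n"]
    have P1: "integrable lborel (\<lambda>\<xi>. cis (- s n * (norm \<xi>)\<^sup>2) * G \<xi>)" by (intro integrable_cis_mult G1) measurable
    have "pnorm 4 (?u n) ^ 4 \<le> (c3\<^sup>2 * ?b n) * pnorm 2 (?u n) ^ 2"
    proof (rule L4_from_sup_bound(2)[OF in_Lp_inverse_fourier[OF P2]])
      show "AE x in lborel. (norm (?u n x))\<^sup>2 \<le> c3\<^sup>2 * ?b n"
        using inverse_fourier_eq_ft[OF P1 P2]
      proof eventually_elim
        case (elim x)
        have "(norm (?u n x))\<^sup>2 = c3\<^sup>2 * (norm (LBINT \<xi>. cis (x \<bullet> \<xi>) * (cis (- s n * (norm \<xi>)\<^sup>2) * G \<xi>)))\<^sup>2"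
          unfolding elim ft_def norm_scaleR power_mult_distrib by (simp add: inner_commute)
        also have "\<dots> \<le> c3\<^sup>2 * ?b n" by (intro mult_left_mono oscillatory_bound G1) simp
        finally show ?case .
      qed
    qed simp
    also have "pnorm 2 (?u n) = pnorm 2 G"
      unfolding pnorm_inverse_fourier[OF P2] by (simp add: pnorm_def norm_mult)
    finally show ?thesis .
  qed
  have "(\<lambda>n. c3\<^sup>2 * ?b n * pnorm 2 G ^ 2) \<longlonglongrightarrow> c3\<^sup>2 * 0 * pnorm 2 G ^ 2"
    by (intro tendsto_mult tendsto_const correlation_tendsto G1 G2 s)
  then have "(\<lambda>n. c3\<^sup>2 * ?b n * pnorm 2 G ^ 2) \<longlonglongrightarrow> 0" by simp
  then show "(\<lambda>n. pnorm 4 (?u n) ^ 4) \<longlonglongrightarrow> 0"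
    by (rule tendsto_sandwich[OF _ _ tendsto_const, rotated 2])
       (intro always_eventually allI zero_le_power pnorm_nonneg, intro always_eventually allI le)
qed

text \<open>Frequencies are cut at a radius R. Above it the function is small in H^1, hence in L^4
  uniformly in time; below it the transform is integrable and the oscillatory bound applies.\<close>

theorem schrodinger_L4_decay:
  assumes f: "in_H1 f" and s: "filterlim (\<lambda>n. \<bar>s n\<bar>) at_top sequentially"
  shows "(\<lambda>n. pnorm 4 (schrodinger (s n) f)) \<longlonglongrightarrow> 0"
proof (rule LIMSEQ_I)
  fix e :: real assume e: "0 < e"
  have f2: "in_Lp 2 f" and F: "in_Lp 2 (fgrad f)" using f by (auto simp: in_H1_iff_fourier)
  note Ff = in_Lp_fourier[OF f2]
  let ?r = "\<lambda>R \<xi>. fourier f \<xi> - cutoff R (fourier f) \<xi>"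
  have r2: "in_Lp 2 (?r R)" for R by (intro in_Lp_diff Ff in_Lp_cutoff)
  have wr: "(\<lambda>\<xi>. norm \<xi> *\<^sub>R ?r R \<xi>) = (\<lambda>\<xi>. fgrad f \<xi> - cutoff R (fgrad f) \<xi>)" for R
    by (auto simp: fgrad_def cutoff_def indicator_def fun_eq_iff)
  have wr2: "in_Lp 2 (\<lambda>\<xi>. norm \<xi> *\<^sub>R ?r R \<xi>)" for R unfolding wr by (intro in_Lp_diff F in_Lp_cutoff)
  have "((\<lambda>R. pnorm 2 (?r R) ^ 2 + sobC * pnorm 2 (\<lambda>\<xi>. norm \<xi> *\<^sub>R ?r R \<xi>) ^ 6) \<longlongrightarrow> 0 ^ 2 + sobC * 0 ^ 6) at_top"
    unfolding wr pnorm_minus_commute[of 2 "fourier f"] pnorm_minus_commute[of 2 "fgrad f"]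
    by (intro tendsto_add tendsto_mult tendsto_const tendsto_power cutoff_tendsto Ff F) auto
  then have "((\<lambda>R. pnorm 2 (?r R) ^ 2 + sobC * pnorm 2 (\<lambda>\<xi>. norm \<xi> *\<^sub>R ?r R \<xi>) ^ 6) \<longlongrightarrow> 0) at_top" by simp
  from order_tendstoD(2)[OF this, of "(e/2)^4"] e
  obtain R where R: "pnorm 2 (?r R) ^ 2 + sobC * pnorm 2 (\<lambda>\<xi>. norm \<xi> *\<^sub>R ?r R \<xi>) ^ 6 < (e/2)^4"
    by (auto simp: eventually_at_top_linorder)
  let ?u = "\<lambda>n. inverse_fourier (\<lambda>\<xi>. cis (- s n * (norm \<xi>)\<^sup>2) * cutoff R (fourier f) \<xi>)"
  let ?v = "\<lambda>n. inverse_fourier (\<lambda>\<xi>. cis (- s n * (norm \<xi>)\<^sup>2) * ?r R \<xi>)"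
  have cF: "in_Lp 2 (cutoff R (fourier f))" "in_Lp 2 (\<lambda>\<xi>. norm \<xi> *\<^sub>R cutoff R (fourier f) \<xi>)"
  proof -
    show "in_Lp 2 (cutoff R (fourier f))" by (rule in_Lp_cutoff[OF Ff])
    have "(\<lambda>\<xi>. norm \<xi> *\<^sub>R cutoff R (fourier f) \<xi>) = cutoff R (fgrad f)"
      by (auto simp: fgrad_def cutoff_def fun_eq_iff)
    then show "in_Lp 2 (\<lambda>\<xi>. norm \<xi> *\<^sub>R cutoff R (fourier f) \<xi>)" using in_Lp_cutoff[OF F] by simp
  qed
  have phase: "in_Lp 2 (\<lambda>\<xi>. norm \<xi> *\<^sub>R (cis (- t * (norm \<xi>)\<^sup>2) * G \<xi>))" if "in_Lp 2 (\<lambda>\<xi>. norm \<xi> *\<^sub>R G \<xi>)" for t and G :: "space \<Rightarrow> complex"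
    using in_Lp_phase[OF that, of t] by simp
  have v: "in_Lp 4 (?v n)" "pnorm 4 (?v n) \<le> e / 2" for n
  proof -
    have H': "in_H1 (?v n)" "pnorm 4 (?v n) ^ 4 \<le> pnorm 2 (\<lambda>\<xi>. cis (- s n * (norm \<xi>)\<^sup>2) * ?r R \<xi>) ^ 2
       + sobC * pnorm 2 (\<lambda>\<xi>. norm \<xi> *\<^sub>R (cis (- s n * (norm \<xi>)\<^sup>2) * ?r R \<xi>)) ^ 6"
      by (rule inverse_fourier_H1[OF in_Lp_phase[OF r2] phase[OF wr2]])+
    show "in_Lp 4 (?v n)" by (rule H1_L4(1)[OF H'(1)])
    have "pnorm 4 (?v n) ^ 4 \<le> pnorm 2 (?r R) ^ 2 + sobC * pnorm 2 (\<lambda>\<xi>. norm \<xi> *\<^sub>R ?r R \<xi>) ^ 6"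
      using H'(2) by (simp add: pnorm_def norm_mult)
    with R have "pnorm 4 (?v n) ^ 4 \<le> (e/2)^4" by linarith
    then show "pnorm 4 (?v n) \<le> e / 2" using e by (simp add: power_mono_iff)
  qed
  have u: "in_Lp 4 (?u n)" for n
    by (rule H1_L4(1), rule inverse_fourier_H1(1)[OF in_Lp_phase[OF cF(1)] phase[OF cF(2)]])
  have "(\<lambda>n. pnorm 4 (?u n)) \<longlonglongrightarrow> 0"
    by (rule low_frequency_decay[OF integrable_cutoff[OF Ff] cF(1) s])
  from LIMSEQ_D[OF this, of "e/2"] e obtain N where N: "\<And>n. n \<ge> N \<Longrightarrow> pnorm 4 (?u n) < e / 2" by auto
  show "\<exists>no. \<forall>n\<ge>no. norm (pnorm 4 (schrodinger (s n) f) - 0) < e"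
  proof (intro exI[of _ N] allI impI)
    fix n assume n: "N \<le> n"
    have eq: "AE x in lborel. schrodinger (s n) f x = ?u n x + ?v n x"
    proof -
      have "(\<lambda>\<xi>. cis (- s n * (norm \<xi>)\<^sup>2) * ?r R \<xi>)
        = (\<lambda>\<xi>. cis (- s n * (norm \<xi>)\<^sup>2) * fourier f \<xi> - cis (- s n * (norm \<xi>)\<^sup>2) * cutoff R (fourier f) \<xi>)"
        by (simp add: right_diff_distrib)
      then show ?thesis
        using inverse_fourier_diff[OF in_Lp_phase[OF Ff, of "s n"] in_Lp_phase[OF cF(1), of "s n"]]
        unfolding schrodinger_def by (auto elim!: eventually_mono)
    qed
    have "pnorm 4 (schrodinger (s n) f) = pnorm 4 (\<lambda>x. ?u n x + ?v n x)"
      by (rule pnorm_AE_cong[OF eq]) (use in_Lp_schrodinger[OF f2, of "s n"] in_Lp_add[OF u v(1), of n n] in auto)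
    also have "\<dots> \<le> pnorm 4 (?u n) + pnorm 4 (?v n)" by (rule pnorm_triangle[OF u v(1)]) simp
    finally show "norm (pnorm 4 (schrodinger (s n) f) - 0) < e" using N[OF n] v(2)[of n] by simp
  qed
qed

text \<open>The difference of two phases is a phase times \<open>cis\<close> of the time difference
  minus 1. Hence only s - t matters, and dominated convergence against the transform and its
  weighted version gives smallness in H^1.\<close>

lemma schrodinger_L4_continuous:
  assumes f: "in_H1 f" and s: "(\<lambda>n. s n - t n) \<longlonglongrightarrow> 0"
  shows "(\<lambda>n. pnorm 4 (\<lambda>x. schrodinger (s n) f x - schrodinger (t n) f x)) \<longlonglongrightarrow> 0"
proof (rule tendsto_pnorm4)
  have f2: "in_Lp 2 f" and F: "in_Lp 2 (fgrad f)" using f by (auto simp: in_H1_iff_fourier)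
  note Ff = in_Lp_fourier[OF f2]
  have [measurable]: "fourier f \<in> borel_measurable borel" using Ff by auto
  let ?d = "\<lambda>n \<xi>. cis (- (s n - t n) * (norm \<xi>)\<^sup>2) - 1 :: complex"
  let ?D = "\<lambda>n \<xi>. cis (- s n * (norm \<xi>)\<^sup>2) * fourier f \<xi> - cis (- t n * (norm \<xi>)\<^sup>2) * fourier f \<xi>"
  have D: "?D n \<xi> = cis (- t n * (norm \<xi>)\<^sup>2) * (?d n \<xi> * fourier f \<xi>)" for n \<xi>
    by (simp add: algebra_simps cis_mult mult.assoc[symmetric])
  have nD: "norm (?D n \<xi>) = norm (?d n \<xi> * fourier f \<xi>)" for n \<xi> unfolding D by (simp add: norm_mult)
  have D2: "in_Lp 2 (?D n)" for n by (intro in_Lp_diff in_Lp_phase Ff)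
  have wD2: "in_Lp 2 (\<lambda>\<xi>. norm \<xi> *\<^sub>R ?D n \<xi>)" for n
    using in_Lp_diff[OF in_Lp_phase[OF F, of "s n"] in_Lp_phase[OF F, of "t n"]]
    by (simp add: fgrad_def scaleR_diff_right)
  have lim: "(\<lambda>n. pnorm 2 (\<lambda>\<xi>. ?d n \<xi> * h \<xi>)) \<longlonglongrightarrow> 0" if h: "in_Lp 2 h" for h :: "space \<Rightarrow> complex"
  proof (rule pnorm_dominated[OF in_Lp_scaleR[OF h, of 2]])
    have [measurable]: "h \<in> borel_measurable borel" using h by auto
    show "(\<lambda>\<xi>. ?d n \<xi> * h \<xi>) \<in> borel_measurable borel" for n by measurable
    show "AE \<xi> in lborel. norm (?d n \<xi> * h \<xi>) \<le> norm (2 *\<^sub>R h \<xi>)" for n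
    proof (rule AE_I2)
      fix \<xi> :: space
      have "norm (?d n \<xi>) \<le> 2" using norm_triangle_ineq4[of "cis (- (s n - t n) * (norm \<xi>)\<^sup>2)" 1] by simp
      then show "norm (?d n \<xi> * h \<xi>) \<le> norm (2 *\<^sub>R h \<xi>)" by (simp add: norm_mult mult_right_mono)
    qed
    show "AE \<xi> in lborel. (\<lambda>n. ?d n \<xi> * h \<xi>) \<longlonglongrightarrow> 0"
    proof (rule AE_I2)
      fix \<xi> :: space
      have "(\<lambda>n. cis (- (s n - t n) * (norm \<xi>)\<^sup>2)) \<longlonglongrightarrow> cis (- 0 * (norm \<xi>)\<^sup>2)"
        by (intro isCont_tendsto_compose[where g=cis] tendsto_mult tendsto_minus tendsto_const s)
           (auto simp: cis_conv_exp[abs_def] intro!: continuous_intros)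
      then have "(\<lambda>n. ?d n \<xi> * h \<xi>) \<longlonglongrightarrow> (cis (- 0 * (norm \<xi>)\<^sup>2) - 1) * h \<xi>"
        by (intro tendsto_mult tendsto_diff tendsto_const)
      then show "(\<lambda>n. ?d n \<xi> * h \<xi>) \<longlonglongrightarrow> 0" by simp
    qed
  qed simp
  have le: "pnorm 4 (\<lambda>x. schrodinger (s n) f x - schrodinger (t n) f x) ^ 4
     \<le> pnorm 2 (\<lambda>\<xi>. ?d n \<xi> * fourier f \<xi>) ^ 2 + sobC * pnorm 2 (\<lambda>\<xi>. ?d n \<xi> * fgrad f \<xi>) ^ 6" for n
  proof -
    note H = inverse_fourier_H1[OF D2 wD2]
    have eq: "AE x in lborel. schrodinger (s n) f x - schrodinger (t n) f x = inverse_fourier (?D n) x"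
      using inverse_fourier_diff[OF in_Lp_phase[OF Ff, of "s n"] in_Lp_phase[OF Ff, of "t n"]]
      unfolding schrodinger_def by (auto elim!: eventually_mono)
    have "pnorm 4 (\<lambda>x. schrodinger (s n) f x - schrodinger (t n) f x) = pnorm 4 (inverse_fourier (?D n))"
      by (rule pnorm_AE_cong[OF eq])
         (use in_Lp_diff[OF in_Lp_schrodinger[OF f2, of "s n"] in_Lp_schrodinger[OF f2, of "t n"]] in_Lp_inverse_fourier[OF D2] in auto)
    also have "pnorm 2 (?D n) = pnorm 2 (\<lambda>\<xi>. ?d n \<xi> * fourier f \<xi>)" unfolding pnorm_def nD ..
    moreover have "pnorm 2 (\<lambda>\<xi>. norm \<xi> *\<^sub>R ?D n \<xi>) = pnorm 2 (\<lambda>\<xi>. ?d n \<xi> * fgrad f \<xi>)"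
      unfolding pnorm_def norm_scaleR nD fgrad_def by (simp add: norm_mult mult_ac)
    ultimately show ?thesis using H(2)[of n] by simp
  qed
  have "(\<lambda>n. pnorm 2 (\<lambda>\<xi>. ?d n \<xi> * fourier f \<xi>) ^ 2 + sobC * pnorm 2 (\<lambda>\<xi>. ?d n \<xi> * fgrad f \<xi>) ^ 6) \<longlonglongrightarrow> 0 ^ 2 + sobC * 0 ^ 6"
    by (intro tendsto_add tendsto_mult tendsto_const tendsto_power lim Ff F)
  then have "(\<lambda>n. pnorm 2 (\<lambda>\<xi>. ?d n \<xi> * fourier f \<xi>) ^ 2 + sobC * pnorm 2 (\<lambda>\<xi>. ?d n \<xi> * fgrad f \<xi>) ^ 6) \<longlonglongrightarrow> 0" by simp
  then show "(\<lambda>n. pnorm 4 (\<lambda>x. schrodinger (s n) f x - schrodinger (t n) f x) ^ 4) \<longlonglongrightarrow> 0"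
    by (rule tendsto_sandwich[OF _ _ tendsto_const, rotated 2])
       (intro always_eventually allI zero_le_power pnorm_nonneg, intro always_eventually allI le)
qed

text \<open>Both choices are uniform in time. Failure of every T would give times tending to
  infinity without decay. Failure of every R would give times in a compact interval, and near an
  accumulation point of them the tails are close to those at one fixed time.\<close>

lemma schrodinger_L4_core:
  assumes f: "in_H1 f" and e: "0 < e"
  shows "\<exists>T R. (\<forall>t. T < \<bar>t\<bar> \<longrightarrow> pnorm 4 (schrodinger t f) \<le> e) \<and>
    (\<forall>t. \<bar>t\<bar> \<le> T \<longrightarrow> pnorm 4 (\<lambda>x. cutoff R (schrodinger t f) x - schrodinger t f x) \<le> e)"
proof -
  have u4: "in_Lp 4 (schrodinger t f)" for t by (rule H1_L4(1)[OF in_H1_schrodinger(1)[OF f]])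
  have "\<exists>T. \<forall>t. T < \<bar>t\<bar> \<longrightarrow> pnorm 4 (schrodinger t f) \<le> e"
  proof (rule ccontr)
    assume "\<not> ?thesis"
    then have "\<forall>n::nat. \<exists>t. real n < \<bar>t\<bar> \<and> e < pnorm 4 (schrodinger t f)" by (force simp: not_le)
    then obtain t where t: "\<And>n. real n < \<bar>t n\<bar>" "\<And>n. e < pnorm 4 (schrodinger (t n) f)" by metis
    have "filterlim (\<lambda>n. \<bar>t n\<bar>) at_top sequentially"
      by (rule filterlim_at_top_mono[OF filterlim_real_sequentially]) (use t(1) in \<open>auto intro!: always_eventually less_imp_le\<close>)
    from LIMSEQ_D[OF schrodinger_L4_decay[OF f this] e] t(2) show False
      by (metis abs_of_nonneg diff_zero le_refl less_asym pnorm_nonneg real_norm_def)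
  qed
  then obtain T where T: "\<And>t. T < \<bar>t\<bar> \<Longrightarrow> pnorm 4 (schrodinger t f) \<le> e" by blast
  have "\<exists>R. \<forall>t. \<bar>t\<bar> \<le> T \<longrightarrow> pnorm 4 (\<lambda>x. cutoff R (schrodinger t f) x - schrodinger t f x) \<le> e"
  proof (rule ccontr)
    assume "\<not> ?thesis"
    then have "\<forall>n::nat. \<exists>t. \<bar>t\<bar> \<le> T \<and> e < pnorm 4 (\<lambda>x. cutoff (real n) (schrodinger t f) x - schrodinger t f x)" by (force simp: not_le)
    then obtain t where t: "\<And>n. \<bar>t n\<bar> \<le> T"
      "\<And>n. e < pnorm 4 (\<lambda>x. cutoff (real n) (schrodinger (t n) f) x - schrodinger (t n) f x)" by metis
    have "seq_compact {- T..T}" by (simp add: compact_imp_seq_compact)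
    moreover have "\<forall>n. t n \<in> {- T..T}" using t(1) by (auto simp: abs_le_iff minus_le_iff)
    ultimately obtain l r where r: "strict_mono r" "(t \<circ> r) \<longlonglongrightarrow> l" by (rule seq_compactE)
    have lim1: "(\<lambda>n. pnorm 4 (\<lambda>x. schrodinger (t (r n)) f x - schrodinger l f x)) \<longlonglongrightarrow> 0"
      using r(2) by (intro schrodinger_L4_continuous f) (simp add: o_def LIM_zero)
    have "filterlim (\<lambda>n. real (r n)) at_top sequentially"
      by (rule filterlim_compose[OF filterlim_real_sequentially filterlim_subseq[OF r(1)]])
    then have lim2: "(\<lambda>n. pnorm 4 (\<lambda>x. cutoff (real (r n)) (schrodinger l f) x - schrodinger l f x)) \<longlonglongrightarrow> 0"
      by (rule filterlim_compose[OF cutoff_tendsto[OF u4], rotated]) simp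
    \<comment> \<open>Replacing time s by the limit time costs just the L^4 distance of the two
      functions, because the tail of a function is pointwise bounded by the function.\<close>
    have le: "pnorm 4 (\<lambda>x. cutoff R (schrodinger s f) x - schrodinger s f x)
      \<le> pnorm 4 (\<lambda>x. schrodinger s f x - schrodinger l f x) + pnorm 4 (\<lambda>x. cutoff R (schrodinger l f) x - schrodinger l f x)" for R s
    proof -
      let ?w = "\<lambda>x. schrodinger s f x - schrodinger l f x"
      have w: "in_Lp 4 ?w" by (intro in_Lp_diff u4)
      have "pnorm 4 (\<lambda>x. cutoff R (schrodinger s f) x - schrodinger s f x)
        = pnorm 4 (\<lambda>x. (cutoff R ?w x - ?w x) + (cutoff R (schrodinger l f) x - schrodinger l f x))"
        by (rule arg_cong[where f="pnorm 4"]) (auto simp: cutoff_def fun_eq_iff scaleR_diff_right)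
      also have "\<dots> \<le> pnorm 4 (\<lambda>x. cutoff R ?w x - ?w x) + pnorm 4 (\<lambda>x. cutoff R (schrodinger l f) x - schrodinger l f x)"
        by (intro pnorm_triangle in_Lp_diff in_Lp_cutoff w u4) simp
      also have "pnorm 4 (\<lambda>x. cutoff R ?w x - ?w x) \<le> pnorm 4 ?w"
        by (rule pnorm_bound[OF w]) (use in_Lp_diff[OF in_Lp_cutoff[OF w] w] in \<open>auto simp: cutoff_def indicator_def norm_minus_commute\<close>)
      finally show ?thesis by simp
    qed
    have "(\<lambda>n. pnorm 4 (\<lambda>x. schrodinger (t (r n)) f x - schrodinger l f x) + pnorm 4 (\<lambda>x. cutoff (real (r n)) (schrodinger l f) x - schrodinger l f x)) \<longlonglongrightarrow> 0"
      using tendsto_add[OF lim1 lim2] by simp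
    from order_tendstoD(2)[OF this e] obtain n where
      "pnorm 4 (\<lambda>x. schrodinger (t (r n)) f x - schrodinger l f x) + pnorm 4 (\<lambda>x. cutoff (real (r n)) (schrodinger l f) x - schrodinger l f x) < e"
      by (auto simp: eventually_sequentially)
    with le[of "real (r n)" "t (r n)"] t(2)[of "r n"] show False by linarith
  qed
  then show ?thesis using T by blast
qed

section \<open>Remainders\<close>

lemma AE_lborel_interval:
  fixes P :: "real \<Rightarrow> bool"
  assumes "AE x in lborel. P x" "0 < e"
  shows "\<exists>x. 0 < x \<and> x < e \<and> P x"
proof (rule ccontr)
  assume "\<not> ?thesis"
  then have n: "\<not> P x" if "x \<in> {0<..<e}" for x using that by auto
  obtain N where N: "{x \<in> space lborel. \<not> P x} \<subseteq> N" "emeasure lborel N = 0" "N \<in> sets lborel"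
    using AE_E[OF assms(1)] by blast
  have "emeasure lborel {0<..<e} \<le> emeasure lborel N"
    using n N by (intro emeasure_mono) auto
  with N(2) assms(2) show False by simp
qed

lemma epowr_cube: "0 \<le> a \<Longrightarrow> epowr (ennreal a) 3 = ennreal (a ^ 3)"
  by (simp add: epowr_def powr_numeral)

lemma Lp_norm_3_le:
  assumes f: "f \<in> borel_measurable borel" and A: "0 \<le> A" and le: "Lp_norm lborel 3 (\<lambda>x. ennreal (norm (f x))) \<le> ennreal A"
  shows "in_Lp 3 f" "pnorm 3 f \<le> A"
proof -
  let ?I = "\<integral>\<^sup>+x. ennreal (norm (f x) ^ 3) \<partial>lborel"
  have Lp: "Lp_norm lborel 3 (\<lambda>x. ennreal (norm (f x))) = epowr ?I (1 / 3)"
  proof -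
    have "(3::ereal) \<noteq> \<infinity>" "real_of_ereal 3 = 3" by simp_all
    then show ?thesis unfolding Lp_norm_def by (simp add: epowr_cube)
  qed
  have fin: "?I \<noteq> top"
    using le unfolding Lp by (auto simp: epowr_def top_unique split: if_splits)
  have i: "integrable lborel (\<lambda>x. norm (f x) ^ 3)"
    using fin f by (intro integrableI_bounded) (auto simp: less_top)
  show 3: "in_Lp 3 f" using f i by (rule in_LpI)
  have I: "?I = ennreal (pnorm 3 f ^ 3)"
    using 3 by (subst nn_integral_eq_integral) (auto simp: pnorm_power)
  have "(pnorm 3 f ^ 3) powr (1 / 3) = pnorm 3 f"
  proof (cases "pnorm 3 f = 0")
    case False
    then have "0 < pnorm 3 f" using pnorm_nonneg[of 3 f] by linarith
    then show ?thesis by (simp add: powr_numeral[symmetric] powr_powr del: powr_numeral)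
  qed simp
  then show "pnorm 3 f \<le> A" using le A unfolding Lp I by (simp add: epowr_def)
qed

text \<open>The essential supremum controls the L^3 norm at almost every time, which leaves out the
  time 0 that matters. Good times exist arbitrarily close to 0; along them the evolution tends to w
  in L^2, and Fatou carries the bound over to w.\<close>

lemma S_half_norm_L3:
  assumes w: "in_Lp 2 w" and six: "3 \<le> six_minus" and A: "0 \<le> A"
    and le: "S_half_norm six_minus four_plus (\<lambda>\<tau>. schrodinger \<tau> w) \<le> ennreal A"
  shows "in_Lp 3 w" "pnorm 3 w \<le> A"
proof -
  let ?v = "\<lambda>\<tau>. schrodinger \<tau> w"
  have "mixed_norm \<infinity> 3 ?v \<le> S_half_norm six_minus four_plus ?v"
    unfolding S_half_norm_def
  proof (rule Sup_upper, rule CollectI, intro exI conjI)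
    \<comment> \<open>2 / infinity + 3 / 3 = 1 = 3 / 2 - 1 / 2.\<close>
    show "strichartz_admissible (1 / 2) \<infinity> 3"
      by (simp add: strichartz_admissible_def one_ereal_def divide_ereal_def)
  qed (use six in \<open>auto simp: numeral_eq_ereal\<close>)
  with le have m: "mixed_norm \<infinity> 3 ?v \<le> ennreal A" by simp
  let ?F = "\<lambda>t. Lp_norm lborel 3 (\<lambda>x. ennreal (norm (?v t x)))"
  have ess: "esssup lborel ?F \<le> ennreal A" using m by (simp add: mixed_norm_def Lp_norm_def[of _ \<infinity>])
  have "AE t in lborel. ?F t \<le> esssup lborel ?F"
    by (rule esssup_AE)
  then have "AE t in lborel. ?F t \<le> ennreal A" by eventually_elim (use ess in auto)
  then have "\<forall>n. \<exists>t. 0 < t \<and> t < 1 / real (Suc n) \<and> ?F t \<le> ennreal A"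
    by (intro allI AE_lborel_interval) auto
  then obtain t where t: "\<And>n. 0 < t n" "\<And>n. t n < 1 / real (Suc n)" "\<And>n. ?F (t n) \<le> ennreal A" by metis
  have "t \<longlonglongrightarrow> 0"
    by (rule tendsto_sandwich[OF _ _ tendsto_const LIMSEQ_Suc[OF lim_1_over_n]])
       (use t in \<open>auto intro!: always_eventually less_imp_le simp del: of_nat_Suc\<close>)
  from schrodinger_continuous_0[OF w this]
  obtain r where r: "strict_mono r" "AE x in lborel. (\<lambda>n. ?v (t (r n)) x) \<longlonglongrightarrow> w x"
    using pnorm_AE_subseq[of 2 "\<lambda>n. ?v (t n)" w] in_Lp_schrodinger[OF w] w by auto
  have L: "in_Lp 3 (?v (t n))" "pnorm 3 (?v (t n)) \<le> A" for n
    using in_Lp_schrodinger[OF w] by (auto intro!: Lp_norm_3_le[OF _ A t(3)])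
  note F = pnorm_Fatou[where f="\<lambda>n. ?v (t (r n))" and p=3 and g=w and C=A, OF L(1) _ _ r(2) _ A]
  show "in_Lp 3 w" by (rule F(1)) (use w L(2) in auto)
  show "pnorm 3 w \<le> A" by (rule F(2)) (use w L(2) in auto)
qed

text \<open>The threshold depends on the gradient bound D and on e, not on w, so it can be fixed
  before a remainder is selected.\<close>

lemma small_remainder:
  assumes e: "0 < e" and D: "0 \<le> D"
  obtains A where "0 < A"
    "\<And>w. in_H1 w \<Longrightarrow> (Hdot_norm 1 w)\<^sup>2 \<le> D \<Longrightarrow> in_Lp 3 w \<Longrightarrow> pnorm 3 w \<le> A \<Longrightarrow> pnorm 4 w \<le> e"
proof -
  define B where "B = sobC * D ^ 3"
  have B: "0 \<le> B" using D by (simp add: B_def sobC_def)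
  \<comment> \<open>l^2 >= 2 B / e^4 makes the L^6 term at most e^4 / 2; the summand 1 keeps l
    positive when B = 0.\<close>
  define l where "l = sqrt (2 * B / e ^ 4) + 1"
  have l: "0 < l" using B e by (simp add: l_def add_nonneg_pos)
  have Bl: "B / l ^ 2 \<le> e ^ 4 / 2"
  proof -
    have "2 * B / e ^ 4 = (sqrt (2 * B / e ^ 4))\<^sup>2" using B e by simp
    also have "\<dots> \<le> l ^ 2" unfolding l_def by (intro power_mono) (use B e in auto)
    finally show ?thesis using e l by (simp add: field_simps)
  qed
  \<comment> \<open>A <= 1 gives A^3 <= A, and A <= e^4 / (2 l) then makes the L^3 term at most e^4
    / 2.\<close>
  define A where "A = min 1 (e ^ 4 / (2 * l))"
  have A: "0 < A" using e l by (simp add: A_def)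
  have lA: "l * A ^ 3 \<le> e ^ 4 / 2"
  proof -
    have "A ^ 3 \<le> A" using A power_decreasing[of 1 3 A] by (simp add: A_def)
    then have "l * A ^ 3 \<le> l * A" using l by simp
    also have "\<dots> \<le> l * (e ^ 4 / (2 * l))" using l by (intro mult_left_mono) (auto simp: A_def)
    finally show ?thesis using l by simp
  qed
  show ?thesis
  proof (rule that[OF A])
    fix w assume w: "in_H1 w" "(Hdot_norm 1 w)\<^sup>2 \<le> D" "in_Lp 3 w" "pnorm 3 w \<le> A"
    have w2: "in_Lp 2 w" "in_Lp 2 (fgrad w)" using w(1) by (auto simp: in_H1_iff_fourier)
    have "pnorm 6 w ^ 6 \<le> sobC * (pnorm 2 (fgrad w) ^ 2) ^ 3"
      using sobolev(2)[OF w2] by (simp flip: power_mult)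
    also have "\<dots> \<le> B" unfolding B_def
      using w(2) by (intro mult_left_mono power_mono) (auto simp: Hdot_norm_1 sobC_def)
    finally have 6: "pnorm 6 w ^ 6 \<le> B" .
    have "pnorm 4 w ^ 4 \<le> l * pnorm 3 w ^ 3 + pnorm 6 w ^ 6 / l ^ 2"
      by (rule L4_interpolation_3_6[OF H1_L4(1)[OF w(1)] w(3) sobolev(1)[OF w2] l])
    also have "\<dots> \<le> l * A ^ 3 + B / l ^ 2"
      using l w(4) 6 by (intro add_mono mult_left_mono divide_right_mono power_mono) auto
    also have "\<dots> \<le> e ^ 4" using lA Bl by linarith
    finally show "pnorm 4 w \<le> e" using e by (simp add: power_mono_iff)
  qed
qed

section \<open>Asymptotic orthogonality of the profiles\<close>

lemma power4_diff_le:
  fixes a b :: real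
  assumes "0 \<le> a" "a \<le> B" "0 \<le> b" "b \<le> B"
  shows "\<bar>a ^ 4 - b ^ 4\<bar> \<le> 4 * B ^ 3 * \<bar>a - b\<bar>"
proof -
  have "a ^ 4 - b ^ 4 = (a - b) * (a ^ 3 + a ^ 2 * b + a * b ^ 2 + b ^ 3)"
    by (simp add: eval_nat_numeral algebra_simps)
  moreover have "a ^ 3 + a ^ 2 * b + a * b ^ 2 + b ^ 3 \<le> B ^ 3 + B ^ 2 * B + B * B ^ 2 + B ^ 3"
    using assms by (intro add_mono mult_mono power_mono) auto
  moreover have "0 \<le> a ^ 3 + a ^ 2 * b + a * b ^ 2 + b ^ 3" using assms by simp
  ultimately have "\<bar>a ^ 4 - b ^ 4\<bar> \<le> \<bar>a - b\<bar> * (4 * B ^ 3)"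
    by (simp add: abs_mult mult_left_mono eval_nat_numeral)
  then show ?thesis by (simp add: mult.commute)
qed

lemma pnorm4_sum_disjoint:
  fixes f :: "'i \<Rightarrow> 'a::euclidean_space \<Rightarrow> 'b::euclidean_space"
  assumes "finite J" "\<And>j. j \<in> J \<Longrightarrow> in_Lp 4 (f j)"
    and disj: "\<And>j k x. j \<in> J \<Longrightarrow> k \<in> J \<Longrightarrow> j \<noteq> k \<Longrightarrow> f j x = 0 \<or> f k x = 0"
  shows "pnorm 4 (\<lambda>x. \<Sum>j\<in>J. f j x) ^ 4 = (\<Sum>j\<in>J. pnorm 4 (f j) ^ 4)"
proof -
  have "norm (\<Sum>j\<in>J. f j x) ^ 4 = (\<Sum>j\<in>J. norm (f j x) ^ 4)" for x
  proof (cases "\<exists>k\<in>J. f k x \<noteq> 0")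
    case True
    then obtain k where k: "k \<in> J" "f k x \<noteq> 0" by blast
    then have z: "f j x = 0" if "j \<in> J - {k}" for j using disj[of j k x] that by auto
    show ?thesis using z by (simp add: sum.remove[OF assms(1) k(1)])
  qed simp
  then have "pnorm 4 (\<lambda>x. \<Sum>j\<in>J. f j x) ^ 4 = (LBINT x. (\<Sum>j\<in>J. norm (f j x) ^ 4))" by (simp add: pnorm_power)
  also have "\<dots> = (\<Sum>j\<in>J. LBINT x. norm (f j x) ^ 4)"
    using assms(2) by (intro Bochner_Integration.integral_sum) auto
  finally show ?thesis by (simp add: pnorm_power)
qed

definition profile :: "(space \<Rightarrow> complex) \<Rightarrow> real \<Rightarrow> space \<Rightarrow> space \<Rightarrow> complex" where
  "profile f s z x = schrodinger (- s) f (x - z)"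

lemma profile_Lp:
  assumes "in_H1 f" shows "in_Lp 4 (profile f s z)" "pnorm 4 (profile f s z) = pnorm 4 (schrodinger (- s) f)"
proof -
  note L = H1_L4(1)[OF in_H1_schrodinger(1)[OF assms, of "- s"]]
  show "in_Lp 4 (profile f s z)" "pnorm 4 (profile f s z) = pnorm 4 (schrodinger (- s) f)"
    using in_Lp_translate[OF L, of "- z"] pnorm_translate[OF L, of "- z"] by (simp_all add: profile_def[abs_def])
qed

lemma profile_bounded:
  assumes f: "in_H1 f" shows "\<exists>K\<ge>0. \<forall>s z. pnorm 4 (profile f s z) \<le> K"
proof (intro exI conjI allI)
  \<comment> \<open>Taking \<open>1 + ?Q\<close> as the bound avoids a fourth root: a norm above 1
    is at most its own fourth power.\<close>
  let ?Q = "pnorm 2 f ^ 2 + sobC * pnorm 2 (fgrad f) ^ 6"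
  have Q: "0 \<le> ?Q" by (simp add: sobC_def)
  then show "0 \<le> 1 + ?Q" by simp
  fix s z
  have f2: "in_Lp 2 f" using f by (simp add: in_H1_iff_fourier)
  have "pnorm 2 (schrodinger (- s) f) = pnorm 2 f"
    unfolding schrodinger_def pnorm_inverse_fourier[OF in_Lp_phase[OF in_Lp_fourier[OF f2]]]
    using plancherel[OF f2] by (simp add: pnorm_def norm_mult)
  then have le: "pnorm 4 (profile f s z) ^ 4 \<le> ?Q"
    using H1_L4(2)[OF in_H1_schrodinger(1)[OF f, of "- s"]] by (simp add: profile_Lp[OF f] in_H1_schrodinger(2)[OF f])
  show "pnorm 4 (profile f s z) \<le> 1 + ?Q"
  proof (cases "pnorm 4 (profile f s z) \<le> 1")
    case False
    then have "pnorm 4 (profile f s z) \<le> pnorm 4 (profile f s z) ^ 4" using self_le_power[of "pnorm 4 (profile f s z)" 4] by simp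
    with le show ?thesis by linarith
  qed (use Q in linarith)
qed

text \<open>Each profile is replaced by 0 or by a truncation to a ball. If two truncations
  overlapped, their time shifts would differ by at most the sum of the thresholds and their centres
  by at most the sum of the radii, against the divergence once n is large. So the truncations are
  disjoint, and their fourth powers add exactly.\<close>

theorem profiles_L4_orthogonal:
  fixes \<psi> :: "nat \<Rightarrow> space \<Rightarrow> complex"
  assumes J: "finite J" and psi: "\<And>j. j \<in> J \<Longrightarrow> in_H1 (\<psi> j)"
    and div: "\<And>j k. j \<in> J \<Longrightarrow> k \<in> J \<Longrightarrow> j \<noteq> k \<Longrightarrow>
       filterlim (\<lambda>n. \<bar>t j n - t k n\<bar> + norm (y j n - y k n)) at_top sequentially"
  shows "(\<lambda>n. pnorm 4 (\<lambda>x. \<Sum>j\<in>J. profile (\<psi> j) (t j n) (y j n) x) ^ 4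
            - (\<Sum>j\<in>J. pnorm 4 (profile (\<psi> j) (t j n) (y j n)) ^ 4)) \<longlonglongrightarrow> 0"
proof (rule LIMSEQ_I)
  fix e :: real assume e: "0 < e"
  let ?p = "\<lambda>j n. profile (\<psi> j) (t j n) (y j n)"
  have pL: "in_Lp 4 (?p j n)" if "j \<in> J" for j n by (rule profile_Lp[OF psi[OF that]])
  have "\<forall>j\<in>J. \<exists>K\<ge>0. \<forall>s z. pnorm 4 (profile (\<psi> j) s z) \<le> K" using profile_bounded psi by blast
  then obtain k where k: "\<And>j. j \<in> J \<Longrightarrow> 0 \<le> k j" "\<And>j s z. j \<in> J \<Longrightarrow> pnorm 4 (profile (\<psi> j) s z) \<le> k j" by metis
  define K where "K = (\<Sum>j\<in>J. k j)"
  have K0: "0 \<le> K" unfolding K_def by (intro sum_nonneg k)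
  have kK: "k j \<le> K" if "j \<in> J" for j unfolding K_def by (rule member_le_sum[of j J k, OF that _ J]) (rule k(1), simp)
  define m where "m = real (card J)"
  have m: "0 \<le> m" by (simp add: m_def)
  \<comment> \<open>The fourth power of the sum costs 4 K^3 * (m d), and the m separate fourth
    powers cost 4 K^3 * d each; the summand 1 keeps the denominator positive and the final
    inequality strict.\<close>
  define d where "d = e / (1 + 4 * K ^ 3 * m + m * (4 * K ^ 3))"
  have den: "0 < 1 + 4 * K ^ 3 * m + m * (4 * K ^ 3)" using K0 m by (intro add_pos_nonneg) auto
  have d: "0 < d" using e den by (simp add: d_def)
  define isT where "isT j T \<longleftrightarrow> (\<forall>s. T < \<bar>s\<bar> \<longrightarrow> pnorm 4 (schrodinger s (\<psi> j)) \<le> d)" for j T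
  define isR where "isR j T R \<longleftrightarrow> (\<forall>s. \<bar>s\<bar> \<le> T \<longrightarrow> pnorm 4 (\<lambda>x. cutoff R (schrodinger s (\<psi> j)) x - schrodinger s (\<psi> j) x) \<le> d)" for j T R
  have "\<forall>j\<in>J. \<exists>T R. isT j T \<and> isR j T R"
  proof
    fix j assume "j \<in> J"
    from schrodinger_L4_core[OF psi[OF this] d]
    show "\<exists>T R. isT j T \<and> isR j T R" unfolding isT_def isR_def .
  qed
  from bchoice[OF this] obtain T where "\<forall>j\<in>J. \<exists>R. isT j (T j) \<and> isR j (T j) R" by blast
  from bchoice[OF this] obtain R where iTR: "\<forall>j\<in>J. isT j (T j) \<and> isR j (T j) (R j)" by blast
  have TR: "pnorm 4 (schrodinger s (\<psi> j)) \<le> d" if "j \<in> J" "T j < \<bar>s\<bar>" for j s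
    using iTR that unfolding isT_def by blast
  have TR': "pnorm 4 (\<lambda>x. cutoff (R j) (schrodinger s (\<psi> j)) x - schrodinger s (\<psi> j) x) \<le> d" if "j \<in> J" "\<bar>s\<bar> \<le> T j" for j s
    using iTR that unfolding isR_def by blast
  \<comment> \<open>The approximant: dropped when the time shift exceeds the threshold, cut off
    around the space shift otherwise. Either way it is within d of the profile in L^4.\<close>
  define c where "c j n x = (if \<bar>t j n\<bar> \<le> T j then cutoff (R j) (schrodinger (- t j n) (\<psi> j)) (x - y j n) else 0)" for j n x
  have u4: "in_Lp 4 (schrodinger s (\<psi> j))" if "j \<in> J" for s j by (rule H1_L4(1)[OF in_H1_schrodinger(1)[OF psi[OF that]]])
  have cL: "in_Lp 4 (c j n)" if "j \<in> J" for j n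
    using in_Lp_translate[where c="- y j n", OF in_Lp_cutoff[where R="R j", OF u4[OF that, of "- t j n"]]]
    by (cases "\<bar>t j n\<bar> \<le> T j") (simp_all add: c_def[abs_def])
  have near: "pnorm 4 (\<lambda>x. ?p j n x - c j n x) \<le> d" if j: "j \<in> J" for j n
  proof (cases "\<bar>t j n\<bar> \<le> T j")
    case True
    have "pnorm 4 (\<lambda>x. ?p j n x - c j n x) = pnorm 4 (\<lambda>x. c j n x - ?p j n x)" by (rule pnorm_minus_commute)
    also have "\<dots> = pnorm 4 (\<lambda>x. cutoff (R j) (schrodinger (- t j n) (\<psi> j)) x - schrodinger (- t j n) (\<psi> j) x)"
      using pnorm_translate[where c="- y j n", OF in_Lp_diff[OF in_Lp_cutoff[where R="R j", OF u4[OF j, of "- t j n"]] u4[OF j, of "- t j n"]]] True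
      by (simp add: c_def profile_def)
    also have "\<dots> \<le> d" using TR'[OF j, of "- t j n"] True by simp
    finally show ?thesis .
  next
    case False
    then show ?thesis using TR[OF j, of "- t j n"] profile_Lp(2)[OF psi[OF j], of "t j n" "y j n"]
      by (simp add: c_def)
  qed
  have cle: "pnorm 4 (c j n) \<le> k j" if j: "j \<in> J" for j n
  proof -
    have "pnorm 4 (c j n) \<le> pnorm 4 (?p j n)"
      by (rule pnorm_bound[OF pL[OF j]]) (use cL[OF j] in \<open>auto simp: c_def profile_def cutoff_def indicator_def\<close>)
    with k(2)[OF j] show ?thesis by (meson order_trans)
  qed
  let ?P = "\<lambda>n x. \<Sum>j\<in>J. ?p j n x" and ?C = "\<lambda>n x. \<Sum>j\<in>J. c j n x"
  have PL: "in_Lp 4 (?P n)" and CL: "in_Lp 4 (?C n)" for n by (auto intro!: in_Lp_sum pL cL)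
  have PK: "pnorm 4 (?P n) \<le> K" for n
    using pnorm_sum[of 4 J "\<lambda>j. ?p j n"] pL sum_mono[of J "\<lambda>j. pnorm 4 (?p j n)" k] k(2) unfolding K_def by fastforce
  have CK: "pnorm 4 (?C n) \<le> K" for n
    using pnorm_sum[of 4 J "\<lambda>j. c j n"] cL sum_mono[of J "\<lambda>j. pnorm 4 (c j n)" k] cle unfolding K_def by fastforce
  have PC: "\<bar>pnorm 4 (?P n) - pnorm 4 (?C n)\<bar> \<le> m * d" for n
  proof -
    have "\<bar>pnorm 4 (?P n) - pnorm 4 (?C n)\<bar> \<le> pnorm 4 (\<lambda>x. ?P n x - ?C n x)" by (rule pnorm_abs_diff[OF PL CL]) simp
    also have "\<dots> = pnorm 4 (\<lambda>x. \<Sum>j\<in>J. ?p j n x - c j n x)" by (simp add: sum_subtractf)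
    also have "\<dots> \<le> (\<Sum>j\<in>J. pnorm 4 (\<lambda>x. ?p j n x - c j n x))"
      by (rule pnorm_sum) (auto intro!: in_Lp_diff pL cL)
    also have "\<dots> \<le> (\<Sum>j\<in>J. d)" by (intro sum_mono near)
    finally show ?thesis by (simp add: m_def)
  qed
  have "\<forall>\<^sub>F n in sequentially. \<forall>j\<in>J. \<forall>l\<in>J. j \<noteq> l \<longrightarrow> T j + T l + R j + R l < \<bar>t j n - t l n\<bar> + norm (y j n - y l n)"
  proof (rule eventually_ball_finite[OF J], rule ballI, rule eventually_ball_finite[OF J], rule ballI)
    fix j l assume jl: "j \<in> J" "l \<in> J"
    show "\<forall>\<^sub>F n in sequentially. j \<noteq> l \<longrightarrow> T j + T l + R j + R l < \<bar>t j n - t l n\<bar> + norm (y j n - y l n)"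
    proof (cases "j = l")
      case False
      from div[OF jl False, unfolded filterlim_at_top_dense, rule_format, of "T j + T l + R j + R l"]
      show ?thesis by eventually_elim simp
    qed simp
  qed
  then obtain N where N: "\<And>n j l. n \<ge> N \<Longrightarrow> j \<in> J \<Longrightarrow> l \<in> J \<Longrightarrow> j \<noteq> l \<Longrightarrow> T j + T l + R j + R l < \<bar>t j n - t l n\<bar> + norm (y j n - y l n)"
    by (auto simp: eventually_sequentially)
  show "\<exists>no. \<forall>n\<ge>no. norm (pnorm 4 (?P n) ^ 4 - (\<Sum>j\<in>J. pnorm 4 (?p j n) ^ 4) - 0) < e"
  proof (intro exI[of _ N] allI impI)
    fix n assume n: "N \<le> n"
    have "pnorm 4 (?C n) ^ 4 = (\<Sum>j\<in>J. pnorm 4 (c j n) ^ 4)"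
    proof (rule pnorm4_sum_disjoint[of J "\<lambda>j. c j n", OF J])
      show "in_Lp 4 (c j n)" if "j \<in> J" for j by (rule cL[OF that])
      fix j l x assume jl: "j \<in> J" "l \<in> J" "j \<noteq> l"
      show "c j n x = 0 \<or> c l n x = 0"
      proof (rule ccontr)
        assume "\<not> ?thesis"
        then have "\<bar>t j n\<bar> \<le> T j" "\<bar>t l n\<bar> \<le> T l" "norm (x - y j n) \<le> R j" "norm (x - y l n) \<le> R l"
          by (auto simp: c_def cutoff_def indicator_def split: if_splits)
        moreover have "norm (y j n - y l n) \<le> norm (x - y j n) + norm (x - y l n)"
          using norm_triangle_ineq4[of "x - y l n" "x - y j n"] by simp
        ultimately show False using N[OF n jl] by linarith
      qed
    qed
    then have eq: "pnorm 4 (?P n) ^ 4 - (\<Sum>j\<in>J. pnorm 4 (?p j n) ^ 4)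
       = (pnorm 4 (?P n) ^ 4 - pnorm 4 (?C n) ^ 4) - (\<Sum>j\<in>J. pnorm 4 (?p j n) ^ 4 - pnorm 4 (c j n) ^ 4)"
      by (simp add: sum_subtractf)
    have K3: "0 \<le> 4 * K ^ 3" using K0 by simp
    have t1: "\<bar>pnorm 4 (?P n) ^ 4 - pnorm 4 (?C n) ^ 4\<bar> \<le> 4 * K ^ 3 * (m * d)"
      using power4_diff_le[OF pnorm_nonneg PK pnorm_nonneg CK, of n n] mult_left_mono[OF PC[of n] K3] by linarith
    have t2: "\<bar>pnorm 4 (?p j n) ^ 4 - pnorm 4 (c j n) ^ 4\<bar> \<le> 4 * K ^ 3 * d" if j: "j \<in> J" for j
    proof -
      have near': "\<bar>pnorm 4 (?p j n) - pnorm 4 (c j n)\<bar> \<le> d"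
        by (rule order_trans[OF pnorm_abs_diff[OF pL[OF j] cL[OF j]] near[OF j]]) simp
      have "pnorm 4 (?p j n) \<le> K" "pnorm 4 (c j n) \<le> K"
        using k(2)[OF j, of "t j n" "y j n"] cle[OF j, of n] kK[OF j] by linarith+
      from power4_diff_le[OF pnorm_nonneg this(1) pnorm_nonneg this(2)] mult_left_mono[OF near' K3]
      show ?thesis by linarith
    qed
    have "\<bar>\<Sum>j\<in>J. pnorm 4 (?p j n) ^ 4 - pnorm 4 (c j n) ^ 4\<bar> \<le> (\<Sum>j\<in>J. \<bar>pnorm 4 (?p j n) ^ 4 - pnorm 4 (c j n) ^ 4\<bar>)"
      by (rule sum_abs)
    also have "\<dots> \<le> (\<Sum>j\<in>J. 4 * K ^ 3 * d)" by (rule sum_mono) (rule t2)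
    finally have t3: "\<bar>\<Sum>j\<in>J. pnorm 4 (?p j n) ^ 4 - pnorm 4 (c j n) ^ 4\<bar> \<le> m * (4 * K ^ 3 * d)"
      by (simp add: m_def)
    have "4 * K ^ 3 * (m * d) + m * (4 * K ^ 3 * d) = (4 * K ^ 3 * m + m * (4 * K ^ 3)) * d" by (simp add: algebra_simps)
    also have "\<dots> < (1 + 4 * K ^ 3 * m + m * (4 * K ^ 3)) * d" using d by (simp add: distrib_right)
    also have "\<dots> = e" using den by (simp add: d_def)
    finally have "\<bar>pnorm 4 (?P n) ^ 4 - (\<Sum>j\<in>J. pnorm 4 (?p j n) ^ 4)\<bar> < e"
      unfolding eq using t1 t3 by linarith
    then show "norm (pnorm 4 (?P n) ^ 4 - (\<Sum>j\<in>J. pnorm 4 (?p j n) ^ 4) - 0) < e" by simp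
  qed
qed

section \<open>The energy expansion\<close>

theorem lemma2p3:
  fixes six_minus four_plus :: real
    and \<phi> :: "nat \<Rightarrow> space \<Rightarrow> complex"
    and \<psi> :: "nat \<Rightarrow> space \<Rightarrow> complex"
    and t :: "nat \<Rightarrow> nat \<Rightarrow> real"
    and y :: "nat \<Rightarrow> nat \<Rightarrow> space"
    and W :: "nat \<Rightarrow> nat \<Rightarrow> space \<Rightarrow> complex"
  assumes six_minus: "3 \<le> six_minus" "six_minus < 6"
    and four_plus: "4 < four_plus"
    and phi_H1: "\<And>n. in_H1 (\<phi> n)"
    and phi_bounded: "\<exists>C. \<forall>n. H1_norm (\<phi> n) \<le> C"
    and psi_H1: "\<And>j. 1 \<le> j \<Longrightarrow> in_H1 (\<psi> j)"
    and W_H1: "\<And>M n. 1 \<le> M \<Longrightarrow> in_H1 (W M n)"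
    and decomposition: "\<And>M n. 1 \<le> M \<Longrightarrow>
          AE x in lborel. \<phi> n x
            = (\<Sum>j=1..M. schrodinger (- t j n) (\<psi> j) (x - y j n)) + W M n x"
    and divergence: "\<And>j k. 1 \<le> j \<Longrightarrow> 1 \<le> k \<Longrightarrow> j \<noteq> k \<Longrightarrow>
          filterlim (\<lambda>n. \<bar>t j n - t k n\<bar> + norm (y j n - y k n)) at_top sequentially"
    and remainder: "\<exists>L. (\<forall>M\<ge>1. (\<lambda>n. S_half_norm six_minus four_plus (\<lambda>\<tau>. schrodinger \<tau> (W M n)))
                              \<longlonglongrightarrow> L M) \<and> L \<longlonglongrightarrow> 0"
    and pythagorean: "\<And>M s. 1 \<le> M \<Longrightarrow> 0 \<le> s \<Longrightarrow> s \<le> 1 \<Longrightarrow>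
          (\<lambda>n. (Hdot_norm s (\<phi> n))\<^sup>2
                - ((\<Sum>j=1..M. (Hdot_norm s (\<psi> j))\<^sup>2) + (Hdot_norm s (W M n))\<^sup>2)) \<longlonglongrightarrow> 0"
  shows "\<forall>M\<ge>1. (\<lambda>n. energy (\<phi> n)
           - ((\<Sum>j=1..M. energy (schrodinger (- t j n) (\<psi> j))) + energy (W M n))) \<longlonglongrightarrow> 0"
proof (intro allI impI)
  fix M :: nat assume M: "1 \<le> M"
  let ?p = "\<lambda>j n. profile (\<psi> j) (t j n) (y j n)"
  obtain C where C: "\<And>n. H1_norm (\<phi> n) \<le> C" using phi_bounded by auto
  have H1sq: "pnorm 2 (\<phi> n) ^ 2 + (Hdot_norm 1 (\<phi> n))\<^sup>2 \<le> C\<^sup>2" for n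
  proof -
    have "H1_norm (\<phi> n) = sqrt (pnorm 2 (\<phi> n) ^ 2 + (Hdot_norm 1 (\<phi> n))\<^sup>2)"
      by (simp add: H1_norm_def integral_weak_gradient[OF phi_H1] Hdot_norm_1 pnorm_power)
    with C[of n] show ?thesis by (simp add: sqrt_le_D)
  qed
  have phi4: "in_Lp 4 (\<phi> n)" for n by (rule H1_L4(1)[OF phi_H1])
  have W4: "in_Lp 4 (W M' n)" if "1 \<le> M'" for M' n by (rule H1_L4(1)[OF W_H1[OF that]])
  have p4: "in_Lp 4 (?p j n)" if "1 \<le> j" for j n by (rule profile_Lp(1)[OF psi_H1[OF that]])
  define Q where "Q = C\<^sup>2 + sobC * (C\<^sup>2) ^ 3"
  have Q: "0 \<le> Q" by (simp add: Q_def sobC_def)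
  have phiQ: "pnorm 4 (\<phi> n) \<le> 1 + Q" for n
  proof -
    have "pnorm 2 (fgrad (\<phi> n)) ^ 6 = (pnorm 2 (fgrad (\<phi> n)) ^ 2) ^ 3" by (simp flip: power_mult)
    also have "\<dots> \<le> (C\<^sup>2) ^ 3"
    proof (rule power_mono)
      show "pnorm 2 (fgrad (\<phi> n)) ^ 2 \<le> C\<^sup>2"
        using H1sq[of n] zero_le_power2[of "pnorm 2 (\<phi> n)"] unfolding Hdot_norm_1 by linarith
    qed simp
    finally have "sobC * pnorm 2 (fgrad (\<phi> n)) ^ 6 \<le> sobC * (C\<^sup>2) ^ 3" by (intro mult_left_mono) (simp_all add: sobC_def)
    moreover have "pnorm 2 (\<phi> n) ^ 2 \<le> C\<^sup>2" using H1sq[of n] zero_le_power2[of "Hdot_norm 1 (\<phi> n)"] by linarith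
    ultimately have le: "pnorm 4 (\<phi> n) ^ 4 \<le> Q" using H1_L4(2)[OF phi_H1[of n]] by (simp add: Q_def)
    show ?thesis
    proof (cases "pnorm 4 (\<phi> n) \<le> 1")
      case False
      then have "pnorm 4 (\<phi> n) \<le> pnorm 4 (\<phi> n) ^ 4" using self_le_power[of "pnorm 4 (\<phi> n)" 4] by simp
      with le show ?thesis by linarith
    qed (use Q in linarith)
  qed
  have dec: "AE x in lborel. \<phi> n x = (\<Sum>j=1..M'. ?p j n x) + W M' n x" if "1 \<le> M'" for M' n
    using decomposition[OF that] by (simp add: profile_def)
  have "\<forall>j\<in>{1..M}. \<exists>K\<ge>0. \<forall>s z. pnorm 4 (profile (\<psi> j) s z) \<le> K"
    using profile_bounded psi_H1 by simp
  then obtain k where k: "\<And>j s z. j \<in> {1..M} \<Longrightarrow> pnorm 4 (profile (\<psi> j) s z) \<le> k j" by metis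
  \<comment> \<open>For the given M the remainder is merely bounded, being the difference between
    \<phi> and M bounded profiles.\<close>
  have WB: "pnorm 4 (W M n) \<le> 1 + Q + (\<Sum>j=1..M. k j)" for n
  proof -
    have "pnorm 4 (W M n) = pnorm 4 (\<lambda>x. \<phi> n x - (\<Sum>j=1..M. ?p j n x))"
    proof (rule pnorm_AE_cong)
      show "AE x in lborel. W M n x = \<phi> n x - (\<Sum>j=1..M. ?p j n x)" using dec[OF M, of n] by eventually_elim simp
      have "in_Lp 4 (\<lambda>x. \<phi> n x - (\<Sum>j=1..M. ?p j n x))" by (intro in_Lp_diff phi4 in_Lp_sum p4) auto
      then show "(\<lambda>x. \<phi> n x - (\<Sum>j=1..M. ?p j n x)) \<in> borel_measurable borel" by auto
      show "W M n \<in> borel_measurable borel" using W4[OF M] by auto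
    qed
    also have "\<dots> \<le> pnorm 4 (\<phi> n) + pnorm 4 (\<lambda>x. \<Sum>j=1..M. ?p j n x)"
      by (intro pnorm_triangle_diff phi4 in_Lp_sum p4) auto
    also have "pnorm 4 (\<lambda>x. \<Sum>j=1..M. ?p j n x) \<le> (\<Sum>j=1..M. pnorm 4 (?p j n))"
      by (rule pnorm_sum) (auto intro: p4)
    also have "\<dots> \<le> (\<Sum>j=1..M. k j)" by (intro sum_mono k)
    finally show ?thesis using phiQ[of n] by linarith
  qed
  \<comment> \<open>The additional 1 lets B also bound the sums of profiles, which will differ from
    \<open>\<phi> n\<close> and \<open>W M n\<close> by at most d <= 1 in L^4.\<close>
  define B where "B = 1 + (1 + Q + (\<Sum>j=1..M. \<bar>k j\<bar>))"
  have B: "1 \<le> B" unfolding B_def using Q sum_nonneg[of "{1..M}" "\<lambda>j. \<bar>k j\<bar>"] by simp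
  have k0: "0 \<le> (\<Sum>j=1..M. \<bar>k j\<bar>)" by (rule sum_nonneg) simp
  have k1: "(\<Sum>j=1..M. k j) \<le> (\<Sum>j=1..M. \<bar>k j\<bar>)" by (rule sum_mono) simp
  have phiB: "pnorm 4 (\<phi> n) + 1 \<le> B" for n
    using phiQ[of n] k0 unfolding B_def by linarith
  have WB': "pnorm 4 (W M n) + 1 \<le> B" for n
    using WB[of n] k1 unfolding B_def by linarith
  have small: "\<exists>M'\<ge>M. \<forall>\<^sub>F n in sequentially. pnorm 4 (W M' n) \<le> e" if e: "0 < e" for e
  proof -
    obtain A where A: "0 < A"
      "\<And>w. in_H1 w \<Longrightarrow> (Hdot_norm 1 w)\<^sup>2 \<le> C\<^sup>2 + 1 \<Longrightarrow> in_Lp 3 w \<Longrightarrow> pnorm 3 w \<le> A \<Longrightarrow> pnorm 4 w \<le> e"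
      using small_remainder[OF e, of "C\<^sup>2 + 1"] by auto
    obtain L where L: "\<And>M. 1 \<le> M \<Longrightarrow> (\<lambda>n. S_half_norm six_minus four_plus (\<lambda>\<tau>. schrodinger \<tau> (W M n))) \<longlonglongrightarrow> L M" "L \<longlonglongrightarrow> 0"
      using remainder by auto
    have "\<forall>\<^sub>F M' in sequentially. L M' < ennreal A \<and> M \<le> M'"
      using order_tendstoD(2)[OF L(2), of "ennreal A"] A(1) eventually_ge_at_top[of M] by (auto intro: eventually_conj)
    then obtain M' where M': "L M' < ennreal A" "M \<le> M'" by (auto simp: eventually_sequentially)
    then have M1: "1 \<le> M'" using M by simp
    have "\<forall>\<^sub>F n in sequentially. S_half_norm six_minus four_plus (\<lambda>\<tau>. schrodinger \<tau> (W M' n)) < ennreal A"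
      by (rule order_tendstoD(2)[OF L(1)[OF M1] M'(1)])
    \<comment> \<open>Since the profile terms are nonnegative, the expansion at s = 1 bounds the
      gradient of \<open>W M' n\<close> by a constant independent of M'. This matters because A was
      fixed before M'.\<close>
    moreover have "\<forall>\<^sub>F n in sequentially. - 1 < (Hdot_norm 1 (\<phi> n))\<^sup>2 - ((\<Sum>j=1..M'. (Hdot_norm 1 (\<psi> j))\<^sup>2) + (Hdot_norm 1 (W M' n))\<^sup>2)"
      using order_tendstoD(1)[OF pythagorean[OF M1, of 1], of "- 1"] by simp
    ultimately have "\<forall>\<^sub>F n in sequentially. pnorm 4 (W M' n) \<le> e"
    proof eventually_elim
      case (elim n)
      have w2: "in_Lp 2 (W M' n)" using W_H1[OF M1, of n] by (simp add: in_H1_iff_fourier)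
      have "0 \<le> (\<Sum>j=1..M'. (Hdot_norm 1 (\<psi> j))\<^sup>2)" by (intro sum_nonneg) simp
      then have "(Hdot_norm 1 (W M' n))\<^sup>2 \<le> C\<^sup>2 + 1"
        using elim(2) H1sq[of n] zero_le_power2[of "pnorm 2 (\<phi> n)"] by linarith
      with A(2)[OF W_H1[OF M1]] S_half_norm_L3[OF w2 six_minus(1) less_imp_le[OF A(1)] less_imp_le[OF elim(1)]]
      show ?case by blast
    qed
    with M'(2) show ?thesis by blast
  qed
  have L4: "(\<lambda>n. pnorm 4 (\<phi> n) ^ 4 - ((\<Sum>j=1..M. pnorm 4 (?p j n) ^ 4) + pnorm 4 (W M n) ^ 4)) \<longlonglongrightarrow> 0"
  proof (rule LIMSEQ_I)
    fix e :: real assume e: "0 < e"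
    \<comment> \<open>Comparing fourth powers costs a factor 4 B^3, and each of the four errors
      below is allowed e / 4, hence 16 B^3.\<close>
    define d where "d = min 1 (e / (16 * B ^ 3))"
    have d: "0 < d" "d \<le> 1" using e B by (auto simp: d_def)
    have dB: "4 * B ^ 3 * d \<le> e / 4"
    proof -
      have "4 * B ^ 3 * d \<le> 4 * B ^ 3 * (e / (16 * B ^ 3))" using B by (intro mult_left_mono) (auto simp: d_def)
      then show ?thesis using B by simp
    qed
    obtain M' where M': "M \<le> M'" and ev: "\<forall>\<^sub>F n in sequentially. pnorm 4 (W M' n) \<le> d" using small[OF d(1)] by auto
    have M1: "1 \<le> M'" using M M' by simp
    let ?S = "\<lambda>n x. \<Sum>j=1..M'. ?p j n x" and ?R = "\<lambda>n x. \<Sum>j\<in>{M<..M'}. ?p j n x"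
    have o1: "(\<lambda>n. pnorm 4 (?S n) ^ 4 - (\<Sum>j=1..M'. pnorm 4 (?p j n) ^ 4)) \<longlonglongrightarrow> 0"
      by (rule profiles_L4_orthogonal) (auto intro: psi_H1 divergence)
    have o2: "(\<lambda>n. pnorm 4 (?R n) ^ 4 - (\<Sum>j\<in>{M<..M'}. pnorm 4 (?p j n) ^ 4)) \<longlonglongrightarrow> 0"
      by (rule profiles_L4_orthogonal) (use M in \<open>auto intro: psi_H1 divergence\<close>)
    have split: "(\<Sum>j=1..M'. g j) = (\<Sum>j=1..M. g j) + (\<Sum>j\<in>{M<..M'}. g j)" for g :: "nat \<Rightarrow> 'c::comm_monoid_add"
    proof -
      have "{1..M'} = {1..M} \<union> {M<..M'}" using M M' by auto
      then show ?thesis by (simp only:) (rule sum.union_disjoint, auto)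
    qed
    have S4: "in_Lp 4 (?S n)" and R4: "in_Lp 4 (?R n)" for n using M by (auto intro!: in_Lp_sum p4)
    have phiS: "\<bar>pnorm 4 (\<phi> n) - pnorm 4 (?S n)\<bar> \<le> pnorm 4 (W M' n)" for n
    proof -
      have "pnorm 4 (\<lambda>x. \<phi> n x - ?S n x) = pnorm 4 (W M' n)"
      proof (rule pnorm_AE_cong)
        show "AE x in lborel. \<phi> n x - ?S n x = W M' n x" using dec[OF M1, of n] by eventually_elim simp
      qed (use in_Lp_diff[OF phi4 S4] W4[OF M1] in auto)
      with pnorm_abs_diff[OF phi4 S4, of n n] show ?thesis by simp
    qed
    \<comment> \<open>Subtracting the decompositions at M and M' exhibits \<open>W M n\<close> as
      the sum of the profiles with M < j <= M' plus the small remainder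
      \<open>W M' n\<close>.\<close>
    have WR: "\<bar>pnorm 4 (W M n) - pnorm 4 (?R n)\<bar> \<le> pnorm 4 (W M' n)" for n
    proof -
      have "pnorm 4 (\<lambda>x. W M n x - ?R n x) = pnorm 4 (W M' n)"
      proof (rule pnorm_AE_cong)
        show "AE x in lborel. W M n x - ?R n x = W M' n x"
          using dec[OF M1, of n] dec[OF M, of n]
        proof eventually_elim
          case (elim x)
          then show ?case using split[of "\<lambda>j. ?p j n x"] by (simp add: algebra_simps)
        qed
      qed (use in_Lp_diff[OF W4[OF M] R4] W4[OF M1] in auto)
      with pnorm_abs_diff[OF W4[OF M] R4, of n n] show ?thesis by simp
    qed
    have e4: "0 < e / 4" using e by simp
    from LIMSEQ_D[OF o1 e4] obtain N1 where N1: "\<And>n. n \<ge> N1 \<Longrightarrow> \<bar>pnorm 4 (?S n) ^ 4 - (\<Sum>j=1..M'. pnorm 4 (?p j n) ^ 4)\<bar> < e / 4" by auto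
    from LIMSEQ_D[OF o2 e4] obtain N2 where N2: "\<And>n. n \<ge> N2 \<Longrightarrow> \<bar>pnorm 4 (?R n) ^ 4 - (\<Sum>j\<in>{M<..M'}. pnorm 4 (?p j n) ^ 4)\<bar> < e / 4" by auto
    from ev obtain N3 where N3: "\<And>n. n \<ge> N3 \<Longrightarrow> pnorm 4 (W M' n) \<le> d" by (auto simp: eventually_sequentially)
    show "\<exists>no. \<forall>n\<ge>no. norm (pnorm 4 (\<phi> n) ^ 4 - ((\<Sum>j=1..M. pnorm 4 (?p j n) ^ 4) + pnorm 4 (W M n) ^ 4) - 0) < e"
    proof (intro exI[of _ "N1 + N2 + N3"] allI impI)
      fix n assume n: "N1 + N2 + N3 \<le> n"
      have w: "pnorm 4 (W M' n) \<le> d" using N3 n by simp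
      have a: "\<bar>pnorm 4 (\<phi> n) ^ 4 - pnorm 4 (?S n) ^ 4\<bar> \<le> e / 4"
      proof -
        have "\<bar>pnorm 4 (\<phi> n) ^ 4 - pnorm 4 (?S n) ^ 4\<bar> \<le> 4 * B ^ 3 * \<bar>pnorm 4 (\<phi> n) - pnorm 4 (?S n)\<bar>"
          by (rule power4_diff_le) (use phiB[of n] phiS[of n] w d in auto)
        also have "\<dots> \<le> 4 * B ^ 3 * d" using B phiS[of n] w by (intro mult_left_mono) auto
        finally show ?thesis using dB by linarith
      qed
      have b: "\<bar>pnorm 4 (W M n) ^ 4 - pnorm 4 (?R n) ^ 4\<bar> \<le> e / 4"
      proof -
        have "\<bar>pnorm 4 (W M n) ^ 4 - pnorm 4 (?R n) ^ 4\<bar> \<le> 4 * B ^ 3 * \<bar>pnorm 4 (W M n) - pnorm 4 (?R n)\<bar>"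
          by (rule power4_diff_le) (use WB'[of n] WR[of n] w d in auto)
        also have "\<dots> \<le> 4 * B ^ 3 * d" using B WR[of n] w by (intro mult_left_mono) auto
        finally show ?thesis using dB by linarith
      qed
      show "norm (pnorm 4 (\<phi> n) ^ 4 - ((\<Sum>j=1..M. pnorm 4 (?p j n) ^ 4) + pnorm 4 (W M n) ^ 4) - 0) < e"
        using a b N1[of n] N2[of n] n split[of "\<lambda>j. pnorm 4 (?p j n) ^ 4"] unfolding real_norm_def abs_le_iff abs_less_iff by simp
    qed
  qed
  \<comment> \<open>The group preserves the gradient norm, so that of \<psi> stands for that of its
    evolution, and the L^4 norm ignores the space shift, so the evolution may be replaced by the
    translated profile.\<close>
  have "energy (\<phi> n) - ((\<Sum>j=1..M. energy (schrodinger (- t j n) (\<psi> j))) + energy (W M n))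
    = 1 / 2 * ((Hdot_norm 1 (\<phi> n))\<^sup>2 - ((\<Sum>j=1..M. (Hdot_norm 1 (\<psi> j))\<^sup>2) + (Hdot_norm 1 (W M n))\<^sup>2))
    - 1 / 4 * (pnorm 4 (\<phi> n) ^ 4 - ((\<Sum>j=1..M. pnorm 4 (?p j n) ^ 4) + pnorm 4 (W M n) ^ 4))" for n
  proof -
    have "(\<Sum>j=1..M. energy (schrodinger (- t j n) (\<psi> j))) = (\<Sum>j=1..M. 1 / 2 * (Hdot_norm 1 (\<psi> j))\<^sup>2 - 1 / 4 * pnorm 4 (?p j n) ^ 4)"
      by (intro sum.cong refl) (simp add: energy_eq in_H1_schrodinger psi_H1 Hdot_norm_1 profile_Lp(2))
    also have "\<dots> = 1 / 2 * (\<Sum>j=1..M. (Hdot_norm 1 (\<psi> j))\<^sup>2) - 1 / 4 * (\<Sum>j=1..M. pnorm 4 (?p j n) ^ 4)"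
      by (simp add: sum_subtractf sum_distrib_left)
    finally show ?thesis
      unfolding energy_eq[OF phi_H1] energy_eq[OF W_H1[OF M]] by (simp add: field_simps)
  qed
  moreover have "(\<lambda>n. 1 / 2 * ((Hdot_norm 1 (\<phi> n))\<^sup>2 - ((\<Sum>j=1..M. (Hdot_norm 1 (\<psi> j))\<^sup>2) + (Hdot_norm 1 (W M n))\<^sup>2))
    - 1 / 4 * (pnorm 4 (\<phi> n) ^ 4 - ((\<Sum>j=1..M. pnorm 4 (?p j n) ^ 4) + pnorm 4 (W M n) ^ 4))) \<longlonglongrightarrow> 1 / 2 * 0 - 1 / 4 * 0"
    by (intro tendsto_diff tendsto_mult tendsto_const L4 pythagorean[OF M]) auto
  ultimately show "(\<lambda>n. energy (\<phi> n) - ((\<Sum>j=1..M. energy (schrodinger (- t j n) (\<psi> j))) + energy (W M n))) \<longlonglongrightarrow> 0"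
    by simp
qed

end
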